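(* Let $\gamma\in[0,2)$. The Liouville Brownian motion spends Lebesgue-almost all its time in the $\gamma$-thick points of $X$ for all starting points: almost surely in $X$, for all $x\in D$, almost surely under $\mathbb P^B_x$, $$\lambda\{t\ge0;\ \mathcal B^x_t\in K_\gamma^c\}=0,$$ where $\lambda$ is the Lebesgue measure on $[0,\infty)$.
   Context: Setting. $D$ is the plane $\mathbb R^2$, the flat torus $\mathbb T^2$ or the round sphere $\mathbb S^2$, with its volume (Lebesgue) measure $dx$ and distance $|x-y|$. $X$ is a centered Gaussian field with law $\mathbb P^X$ and covariance: if $D=\mathbb R^2$ (Massive Free Field, mass $m>0$), $\int_1^\infty \frac{k_m(u(x-y))}{u}du$ with $k_m(z)=\frac12\int_0^\infty e^{-\frac{m^2|z|^2}{2v}-\frac v2}dv$; if $D$ is compact (Gaussian Free Field with zero mean), $\pi\int_0^\infty (p_t(x,y)-|D|^{-1})dt$, where $p_t$ is the heat kernel of $\frac12\Delta$. Cutoffs: fix a strictly increasing unbounded sequence $(c_n)_{n\ge1}$ with $c_1=1$; $(X_n)_n$ are continuous centered Gaussian fields with independent increments $X_{n+1}-X_n$, approximating $X$, where $X_n$ has covariance $\int_1^{c_{n+1}}\frac{k_m(u(x-y))}{u}du$ if $D=\mathbb R^2$, and $\pi\int_{c_{n+1}^{-2}}^\infty(p_t(x,y)-|D|^{-1})dt$ if $D$ is compact. Let $B^x$ be a standard Brownian motion on $D$ (generator $\frac12\Delta$) from $x$, independent of $X$, with law $\mathbb P^B_x$. It is known that for $\gamma\in[0,2)$, a.s. in $X$,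 for all $x\in D$, $F^n(x,t)=\int_0^te^{\gamma X_n(B^x_r)-\frac{\gamma^2}{2}\mathbb E[X_n(B^x_r)^2]}dr$ converges in $\mathbb P^B_x$-probability, locally uniformly in $t$, to a continuous strictly increasing functional $F(x,\cdot)$ tending to $+\infty$. The Liouville Brownian motion from $x$ is $\mathcal B^x_t=B^x_{\langle\mathcal B^x\rangle_t}$, with $\langle\mathcal B^x\rangle_t=\inf\{s>0;F(x,s)>t\}$. The set of $\gamma$-thick points of $X$ is $$K_\gamma=\Big\{x\in D;\ \lim_{n\to\infty}\frac{X_n(x)}{\ln c_{n+1}}=\gamma\Big\}.$$ *)

theory Defs
  imports "HOL-Probability.Probability"
begin

section \<open>The three surfaces\<close>

definition C2_on :: "'a::euclidean_space set \<Rightarrow> ('a \<Rightarrow> real) \<Rightarrow> bool" where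
  "C2_on U f \<longleftrightarrow>
     (\<exists>(f' :: 'a \<Rightarrow> 'a \<Rightarrow>\<^sub>L real) (f'' :: 'a \<Rightarrow> 'a \<Rightarrow>\<^sub>L ('a \<Rightarrow>\<^sub>L real)).
        (\<forall>x\<in>U. (f has_derivative blinfun_apply (f' x)) (at x)) \<and>
        (\<forall>x\<in>U. (f' has_derivative blinfun_apply (f'' x)) (at x)) \<and>
        continuous_on U f'')"

definition second_deriv0 :: "(real \<Rightarrow> real) \<Rightarrow> real" where
  "second_deriv0 g = deriv (deriv g) 0"

definition euclidean_laplacian :: "('a::euclidean_space \<Rightarrow> real) \<Rightarrow> 'a \<Rightarrow> real" where
  "euclidean_laplacian f x = (\<Sum>b\<in>Basis. second_deriv0 (\<lambda>s. f (x + s *\<^sub>R b)))"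

text \<open>The underlying set \<open>D\<close> of a surface is \<^term>\<open>space (vol S)\<close>, and
  \<^term>\<open>sets (vol S)\<close> is its Borel \<open>\<sigma>\<close>-algebra. The field \<open>test\<close> holds the compactly supported
  \<open>C\<^sup>2\<close> functions on \<open>D\<close> (as total functions whose values off \<open>D\<close> are irrelevant) and
  \<open>laplacian\<close> is the Laplace--Beltrami operator on them.\<close>

record 'a surface =
  vol :: "'a measure"
  test :: "('a \<Rightarrow> real) set"
  laplacian :: "('a \<Rightarrow> real) \<Rightarrow> 'a \<Rightarrow> real"

abbreviation pts :: "'a surface \<Rightarrow> 'a set" where
  "pts S \<equiv> space (vol S)"

definition plane :: "(real ^ 2) surface" where
  "plane = \<lparr> vol = lborel,
             test = {f. C2_on UNIV f \<and> (\<exists>R. \<forall>x. norm x > R \<longrightarrow> f x = 0)},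
             laplacian = euclidean_laplacian \<rparr>"

text \<open>The flat torus \<open>\<real>\<^sup>2 / (L\<int>)\<^sup>2\<close>, realised on the product of two unit circles through the
  covering map \<open>torus_cover L\<close>; its volume and Laplacian are those of the quotient, not
  those induced from the embedding in \<open>\<complex>\<^sup>2\<close>. The curves in the Laplacian are the unit-speed
  geodesics in the two coordinate directions.\<close>

definition torus_cover :: "real \<Rightarrow> real \<times> real \<Rightarrow> complex \<times> complex" where
  "torus_cover L a = (cis (2 * pi * fst a / L), cis (2 * pi * snd a / L))"

definition flat_torus :: "real \<Rightarrow> (complex \<times> complex) surface" where
  "flat_torus L =
     \<lparr> vol = distr (restrict_space lborel ({0..<L} \<times> {0..<L}))
                   (restrict_space borel (sphere 0 1 \<times> sphere 0 1)) (torus_cover L),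
       test = {f. C2_on UNIV (f \<circ> torus_cover L)},
       laplacian = (\<lambda>f z. second_deriv0 (\<lambda>s. f (fst z * cis (2 * pi * s / L), snd z)) +
                          second_deriv0 (\<lambda>s. f (fst z, snd z * cis (2 * pi * s / L)))) \<rparr>"

text \<open>The unit sphere of \<open>\<real>\<^sup>3\<close>. The area of \<open>A\<close> is three times the volume of the cone
  \<open>{r x. 0 < r < 1, x \<in> A}\<close>; smoothness and the Laplacian are read off the extension of \<open>f\<close>
  that is constant along rays.\<close>

definition radial_extension :: "(real ^ 3 \<Rightarrow> real) \<Rightarrow> real ^ 3 \<Rightarrow> real" where
  "radial_extension f y = f (y /\<^sub>R norm y)"

definition round_sphere :: "(real ^ 3) surface" where
  "round_sphere =
     \<lparr> vol = scale_measure 3 (distr (restrict_space lborel (ball 0 1 - {0}))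
                   (restrict_space borel (sphere 0 1)) (\<lambda>y. y /\<^sub>R norm y)),
       test = {f. C2_on (- {0}) (radial_extension f)},
       laplacian = (\<lambda>f. euclidean_laplacian (radial_extension f)) \<rparr>"


section \<open>Heat kernel and Brownian motion\<close>

text \<open>The heat kernel of \<open>\<Delta>/2\<close>: the continuous transition density such that \<open>p\<^sub>t(x, \<cdot>)\<close> solves
  \<open>\<partial>\<^sub>t u = \<Delta>u/2\<close> with initial value \<open>\<delta>\<^sub>x\<close>. The equation and the initial condition are stated
  together, in integrated form against test functions.\<close>

definition heat_kernel :: "'a::topological_space surface \<Rightarrow> (real \<Rightarrow> 'a \<Rightarrow> 'a \<Rightarrow> real) \<Rightarrow> bool" where
  "heat_kernel S p \<longleftrightarrow>
     continuous_on ({0<..} \<times> pts S \<times> pts S) (\<lambda>(t, x, y). p t x y) \<and>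
     (\<forall>t>0. \<forall>x\<in>pts S. \<forall>y\<in>pts S. 0 \<le> p t x y) \<and>
     (\<forall>t>0. \<forall>x\<in>pts S. (\<integral>\<^sup>+y. ennreal (p t x y) \<partial>vol S) = 1) \<and>
     (\<forall>f\<in>test S. \<forall>x\<in>pts S. \<forall>t>0.
        (LINT y|vol S. p t x y * f y) =
          f x + 1 / 2 * (LINT s:{0<..t}|lborel. (LINT y|vol S. p s x y * laplacian S f y)))"

text \<open>\<open>fdd S p x [(s\<^sub>1, A\<^sub>1), \<dots>, (s\<^sub>k, A\<^sub>k)]\<close> is the probability that the Markov process with
  transition density \<open>p\<close> started at \<open>x\<close> is in \<open>A\<^sub>i\<close> at time \<open>s\<^sub>1 + \<dots> + s\<^sub>i\<close> for all \<open>i\<close>.\<close>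

fun fdd :: "'a surface \<Rightarrow> (real \<Rightarrow> 'a \<Rightarrow> 'a \<Rightarrow> real) \<Rightarrow> 'a \<Rightarrow> (real \<times> 'a set) list \<Rightarrow> ennreal" where
  "fdd S p x [] = 1"
| "fdd S p x ((s, A) # l) =
     (\<integral>\<^sup>+y. ennreal (p s x y) * fdd S p y l * indicator A y \<partial>vol S)"

definition brownian_motion ::
    "'a::topological_space surface \<Rightarrow> (real \<Rightarrow> 'a \<Rightarrow> 'a \<Rightarrow> real) \<Rightarrow> 'a \<Rightarrow>
     'b measure \<Rightarrow> (real \<Rightarrow> 'b \<Rightarrow> 'a) \<Rightarrow> bool" where
  "brownian_motion S p x M B \<longleftrightarrow>
     prob_space M \<and>
     (\<forall>t\<ge>0. B t \<in> measurable M (vol S)) \<and>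
     (\<forall>w\<in>space M. B 0 w = x \<and> continuous_on {0..} (\<lambda>t. B t w)) \<and>
     (\<forall>l. (\<forall>(s, A)\<in>set l. 0 < s \<and> A \<in> sets (vol S)) \<longrightarrow>
        emeasure M {w \<in> space M. \<forall>i<length l.
            B (\<Sum>j\<le>i. fst (l ! j)) w \<in> snd (l ! i)} = fdd S p x l)"


section \<open>The Gaussian fields\<close>

text \<open>A family indexed by \<open>I\<close> all of whose finite linear combinations are centered normal,
  the zero variable (\<open>\<sigma> = 0\<close>) included.\<close>

definition centered_gaussian_field ::
    "'w measure \<Rightarrow> 'i set \<Rightarrow> ('w \<Rightarrow> 'i \<Rightarrow> real) \<Rightarrow> ('i \<Rightarrow> 'i \<Rightarrow> real) \<Rightarrow> bool" where
  "centered_gaussian_field M I Z K \<longleftrightarrow>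
     (\<forall>i\<in>I. (\<lambda>w. Z w i) \<in> borel_measurable M) \<and>
     (\<forall>J a. finite J \<and> J \<subseteq> I \<longrightarrow>
        (\<exists>\<sigma>\<ge>0. distr M borel (\<lambda>w. \<Sum>i\<in>J. a i * Z w i) =
                distr (density lborel std_normal_density) borel (\<lambda>z. \<sigma> * z))) \<and>
     (\<forall>i\<in>I. \<forall>j\<in>I. (LINT w|M. Z w i * Z w j) = K i j)"

definition mff_k :: "real \<Rightarrow> real ^ 2 \<Rightarrow> real" where
  "mff_k m z = 1 / 2 * (LINT v:{0..}|lborel. exp (- (m\<^sup>2 * (norm z)\<^sup>2 / (2 * v)) - v / 2))"

definition mff_cov :: "real \<Rightarrow> real ^ 2 \<Rightarrow> real ^ 2 \<Rightarrow> real" where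
  "mff_cov m x y = (LINT u:{1..}|lborel. mff_k m (u *\<^sub>R (x - y)) / u)"

definition mff_cutoff_cov :: "real \<Rightarrow> (nat \<Rightarrow> real) \<Rightarrow> nat \<Rightarrow> real ^ 2 \<Rightarrow> real ^ 2 \<Rightarrow> real" where
  "mff_cutoff_cov m c n x y = (LINT u:{1..c (n + 1)}|lborel. mff_k m (u *\<^sub>R (x - y)) / u)"

definition gff_cov ::
    "'a surface \<Rightarrow> (real \<Rightarrow> 'a \<Rightarrow> 'a \<Rightarrow> real) \<Rightarrow> 'a \<Rightarrow> 'a \<Rightarrow> real" where
  "gff_cov S p x y =
     pi * (LINT t:{0<..}|lborel. (p t x y - 1 / measure (vol S) (pts S)))"

definition gff_cutoff_cov ::
    "'a surface \<Rightarrow> (real \<Rightarrow> 'a \<Rightarrow> 'a \<Rightarrow> real) \<Rightarrow> (nat \<Rightarrow> real) \<Rightarrow> nat \<Rightarrow> 'a \<Rightarrow> 'a \<Rightarrow> real" where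
  "gff_cutoff_cov S p c n x y =
     pi * (LINT t:{1 / (c (n + 1))\<^sup>2..}|lborel. (p t x y - 1 / measure (vol S) (pts S)))"

definition cutoff_sequence :: "(nat \<Rightarrow> real) \<Rightarrow> bool" where
  "cutoff_sequence c \<longleftrightarrow> c 1 = 1 \<and> strict_mono_on {1..} c \<and> \<not> bdd_above (c ` {1..})"

text \<open>\<open>X\<close> is a random distribution, hence a Gaussian family indexed by test functions; the
  cutoffs \<open>Xn n\<close>, \<open>n \<ge> 1\<close>, are indexed by points. Independence of increments is that of the
  fields \<open>X\<^sub>1, X\<^sub>2 - X\<^sub>1, X\<^sub>3 - X\<^sub>2, \<dots>\<close>, as random elements of \<open>\<real>\<^sup>D\<close>.\<close>

definition field_with_cutoffs ::
    "'a::topological_space surface \<Rightarrow> ('a \<Rightarrow> 'a \<Rightarrow> real) \<Rightarrow> (nat \<Rightarrow> 'a \<Rightarrow> 'a \<Rightarrow> real) \<Rightarrow>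
     'w measure \<Rightarrow> ('w \<Rightarrow> ('a \<Rightarrow> real) \<Rightarrow> real) \<Rightarrow> (nat \<Rightarrow> 'w \<Rightarrow> 'a \<Rightarrow> real) \<Rightarrow> bool" where
  "field_with_cutoffs S G Gn PX X Xn \<longleftrightarrow>
     prob_space PX \<and>
     centered_gaussian_field PX (test S) X
       (\<lambda>f g. LINT x|vol S. (LINT y|vol S. f x * G x y * g y)) \<and>
     (\<forall>n\<ge>1. centered_gaussian_field PX (pts S) (Xn n) (Gn n)) \<and>
     (\<forall>n\<ge>1. \<forall>w\<in>space PX. continuous_on (pts S) (Xn n w)) \<and>
     prob_space.indep_vars PX (\<lambda>_. PiM (pts S) (\<lambda>_. borel))
       (\<lambda>k w. \<lambda>x\<in>pts S. Xn k w x - (if k = 1 then 0 else Xn (k - 1) w x)) {1..} \<and>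
     (\<forall>f\<in>test S.
        (\<lambda>n. LINT w|PX. ((LINT x|vol S. Xn n w x * f x) - X w f)\<^sup>2) \<longlonglongrightarrow> 0)"

definition thick_points ::
    "'a surface \<Rightarrow> (nat \<Rightarrow> real) \<Rightarrow> (nat \<Rightarrow> 'w \<Rightarrow> 'a \<Rightarrow> real) \<Rightarrow> real \<Rightarrow> 'w \<Rightarrow> 'a set" where
  "thick_points S c Xn \<gamma> w = {x \<in> pts S. (\<lambda>n. Xn n w x / ln (c (n + 1))) \<longlonglongrightarrow> \<gamma>}"


section \<open>Liouville Brownian motion\<close>

definition approx_clock ::
    "'w measure \<Rightarrow> (nat \<Rightarrow> 'w \<Rightarrow> 'a \<Rightarrow> real) \<Rightarrow> real \<Rightarrow> nat \<Rightarrow> 'w \<Rightarrow> (real \<Rightarrow> 'a) \<Rightarrow> real \<Rightarrow> real" where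
  "approx_clock PX Xn \<gamma> n w \<beta> t =
     (LINT r:{0..t}|lborel.
        exp (\<gamma> * Xn n w (\<beta> r) - \<gamma>\<^sup>2 / 2 * (LINT w'|PX. (Xn n w' (\<beta> r))\<^sup>2)))"

text \<open>\<open>F w x t b\<close> is the limiting functional \<open>F(x, t)\<close> for the environment \<open>w\<close> and the Brownian
  sample \<open>b\<close>. Convergence in probability is locally uniform in \<open>t\<close>. As \<open>F\<close> is only almost
  surely continuous, the events involved are measurable up to null sets, whence the completion.\<close>

definition liouville_clock ::
    "'a surface \<Rightarrow> 'w measure \<Rightarrow> (nat \<Rightarrow> 'w \<Rightarrow> 'a \<Rightarrow> real) \<Rightarrow> real \<Rightarrow>
     ('a \<Rightarrow> 'b measure) \<Rightarrow> ('a \<Rightarrow> real \<Rightarrow> 'b \<Rightarrow> 'a) \<Rightarrow> ('w \<Rightarrow> 'a \<Rightarrow> real \<Rightarrow> 'b \<Rightarrow> real) \<Rightarrow> bool" where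
  "liouville_clock S PX Xn \<gamma> PB B F \<longleftrightarrow>
     (AE w in PX. \<forall>x\<in>pts S.
        (\<forall>t\<ge>0. F w x t \<in> borel_measurable (PB x)) \<and>
        (AE b in PB x. continuous_on {0..} (\<lambda>t. F w x t b) \<and>
                       strict_mono_on {0..} (\<lambda>t. F w x t b) \<and>
                       filterlim (\<lambda>t. F w x t b) at_top at_top) \<and>
        (\<forall>T\<ge>0. \<forall>\<epsilon>>0.
           (\<lambda>n. measure (completion (PB x))
                  {b \<in> space (PB x). \<exists>t\<in>{0..T}.
                     \<epsilon> < \<bar>approx_clock PX Xn \<gamma> n w (\<lambda>r. B x r b) t - F w x t b\<bar>}) \<longlonglongrightarrow> 0))"

definition liouville_bm :: "(real \<Rightarrow> real) \<Rightarrow> (real \<Rightarrow> 'a) \<Rightarrow> real \<Rightarrow> 'a" where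
  "liouville_bm \<phi> \<beta> t = \<beta> (Inf {s. 0 < s \<and> t < \<phi> s})"

text \<open>Independence of \<open>B\<close> and \<open>X\<close> is encoded by carrying the field on \<open>PX\<close> and each Brownian
  motion \<open>B x\<close> on a separate probability space \<open>PB x\<close>, i.e. by working on their product.\<close>

definition liouville_setting ::
    "'a::topological_space surface \<Rightarrow> (real \<Rightarrow> 'a \<Rightarrow> 'a \<Rightarrow> real) \<Rightarrow>
     ('a \<Rightarrow> 'a \<Rightarrow> real) \<Rightarrow> (nat \<Rightarrow> 'a \<Rightarrow> 'a \<Rightarrow> real) \<Rightarrow> real \<Rightarrow>
     'w measure \<Rightarrow> ('w \<Rightarrow> ('a \<Rightarrow> real) \<Rightarrow> real) \<Rightarrow> (nat \<Rightarrow> 'w \<Rightarrow> 'a \<Rightarrow> real) \<Rightarrow>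
     ('a \<Rightarrow> 'b measure) \<Rightarrow> ('a \<Rightarrow> real \<Rightarrow> 'b \<Rightarrow> 'a) \<Rightarrow>
     ('w \<Rightarrow> 'a \<Rightarrow> real \<Rightarrow> 'b \<Rightarrow> real) \<Rightarrow> bool" where
  "liouville_setting S p G Gn \<gamma> PX X Xn PB B F \<longleftrightarrow>
     heat_kernel S p \<and>
     field_with_cutoffs S G Gn PX X Xn \<and>
     (\<forall>x\<in>pts S. brownian_motion S p x (PB x) (B x)) \<and>
     liouville_clock S PX Xn \<gamma> PB B F"

end

theory Submission
  imports Defs
begin

text \<open>Only the one-time marginals of Brownian motion enter. On \<open>[\<delta>, T]\<close> they have bounded densities, so
  the expected time that the clock assigns to an open set is, by the portmanteau inequality and
  Fatou's lemma, at most a constant times the lower limit of the masses that the chaos measures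
  \<open>M\<^sub>n(dx) = exp (\<gamma> X\<^sub>n x - \<gamma>\<^sup>2 V\<^sub>n / 2) dx\<close>, with \<open>V\<^sub>n = E (X\<^sub>n x)\<^sup>2\<close>, give to it. Take the open set
  where \<open>\<bar>X\<^sub>k x - \<gamma> V\<^sub>k\<bar> > \<epsilon> V\<^sub>k\<close> for some \<open>k\<close> between \<open>N\<close> and \<open>M\<close>. Changing \<open>\<gamma>\<close> into \<open>\<gamma> \<plusminus> \<epsilon>\<close> at
  the first such \<open>k\<close> bounds its expected mass by \<open>2 exp (- \<epsilon>\<^sup>2 V\<^sub>N / 2)\<close> per unit volume, uniformly
  in \<open>M\<close>. Hence the clock charges only the points where \<open>X\<^sub>n x / V\<^sub>n\<close> tends to \<open>\<gamma>\<close>.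

  It remains that \<open>V\<^sub>n\<close> is asymptotic to \<open>ln c\<^sub>n\<^sub>+\<^sub>1\<close>. This is immediate on the plane. In the compact
  cases it follows from \<open>2 \<pi> t p t x x \<longlongrightarrow> 1\<close> as \<open>t\<close> tends to \<open>0\<close>, which is extracted from the heat
  equation alone: on the sphere by comparing the moments of \<open>(1 + x \<bullet> y) / 2\<close> with explicit
  barriers, on the torus by reducing to a theta function through trigonometric eigenfunctions.\<close>

section \<open>Exponential martingales of Gaussian walks\<close>

text \<open>The order of quantifiers shapes the proof: exceptional environments must not depend on
  the starting point. The field is therefore controlled only through masses that do not see
  \<open>x\<close>; a fixed environment then meets every \<open>x\<close> through the bound on the
  density. The clock is known only as a limit in probability, and what survives in the limit is an
  upper bound for its mass on open sets. Hence the exceptional set is written as an intersection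
  over \<open>N\<close> of unions, increasing in \<open>M\<close>, of open sets, and the quantity
  shown to vanish is \<open>INF N. SUP M. liminf n\<close> of masses. The window from
  \<open>N\<close> to \<open>M\<close> is finite because the change of parameter compares densities
  at a level \<open>n \<ge> M\<close>; there both have mean one, and no limiting measure with
  parameter \<gamma> \<plusminus> \<epsilon> ever appears. Short times are cut off because the
  density blows up as time tends to 0, and space is cut into balls because the plane has infinite
  volume. Slopes are measured against \<open>V n\<close> because this is the clock of the
  exponential martingales; the logarithm of the cutoff is substituted at the very end.\<close>

lemma
  assumes d: "distr M borel Y = distr (density lborel std_normal_density) borel (\<lambda>z. \<sigma> * z)"
    and [measurable]: "Y \<in> borel_measurable M"
  shows nn_integral_exp_scaled_normal:
      "(\<integral>\<^sup>+w. ennreal (exp (\<theta> * Y w)) \<partial>M) = ennreal (exp (\<theta>\<^sup>2 * \<sigma>\<^sup>2 / 2))"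
    and integral_square_scaled_normal: "(LINT w|M. (Y w)\<^sup>2) = \<sigma>\<^sup>2"
proof -
  interpret n: prob_space "density lborel (normal_density (\<theta> * \<sigma>) 1)"
    by (rule prob_space_normal_density) simp
  have 1: "(\<integral>\<^sup>+z. ennreal (normal_density (\<theta> * \<sigma>) 1 z) \<partial>lborel) = 1"
    using n.emeasure_space_1 by (simp add: emeasure_density)
  have "(\<integral>\<^sup>+w. ennreal (exp (\<theta> * Y w)) \<partial>M) = (\<integral>\<^sup>+y. ennreal (exp (\<theta> * y)) \<partial>distr M borel Y)"
    by (simp add: nn_integral_distr)
  also have "\<dots> = (\<integral>\<^sup>+z. ennreal (std_normal_density z) * ennreal (exp (\<theta> * (\<sigma> * z))) \<partial>lborel)"
    unfolding d by (simp add: nn_integral_distr nn_integral_density)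
  \<comment> \<open>Completing the square: the tilted density is a normal density with mean
    \<open>\<theta> * \<sigma>\<close> and variance 1, up to the factor sought. This covers
    \<open>\<sigma> = 0\<close>, since the law of \<open>Y\<close> is an image and not a
    density.\<close>
  also have "\<dots> = (\<integral>\<^sup>+z. ennreal (exp (\<theta>\<^sup>2 * \<sigma>\<^sup>2 / 2)) * ennreal (normal_density (\<theta> * \<sigma>) 1 z) \<partial>lborel)"
    by (intro nn_integral_cong)
      (simp add: normal_density_def ennreal_mult'[symmetric] mult_exp_exp power2_eq_square field_simps)
  also have "\<dots> = ennreal (exp (\<theta>\<^sup>2 * \<sigma>\<^sup>2 / 2))"
    by (simp add: nn_integral_cmult 1)
  finally show "(\<integral>\<^sup>+w. ennreal (exp (\<theta> * Y w)) \<partial>M) = ennreal (exp (\<theta>\<^sup>2 * \<sigma>\<^sup>2 / 2))" .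
  have "(LINT w|M. (Y w)\<^sup>2) = (LINT y|distr M borel Y. y\<^sup>2)"
    by (simp add: integral_distr)
  also have "\<dots> = (LINT z|lborel. \<sigma>\<^sup>2 * (std_normal_density z * z ^ (2 * 1)))"
    unfolding d
    by (simp add: integral_distr integral_density power_mult_distrib mult.left_commute[of _ "\<sigma>\<^sup>2"]
        del: integral_mult_right_zero)
  also have "\<dots> = \<sigma>\<^sup>2 * (fact (2 * 1) / (2 ^ 1 * fact 1))"
    using integral_std_normal_moment_even[of 1] by simp
  finally show "(LINT w|M. (Y w)\<^sup>2) = \<sigma>\<^sup>2" by simp
qed

lemma (in prob_space) indep_var_nn_integral_mult:
  fixes f g :: "'a \<Rightarrow> ennreal"
  assumes "indep_var borel f borel g"
  shows "(\<integral>\<^sup>+w. f w * g w \<partial>M) = (\<integral>\<^sup>+w. f w \<partial>M) * (\<integral>\<^sup>+w. g w \<partial>M)"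
proof -
  have "case_bool borel borel = (\<lambda>_. borel :: ennreal measure)"
    by (auto simp: fun_eq_iff split: bool.split)
  then have "indep_vars (\<lambda>_. borel) (case_bool f g) UNIV"
    using assms by (simp add: indep_var_def)
  from indep_vars_nn_integral[OF _ this] show ?thesis
    by (simp add: UNIV_bool mult.commute)
qed

text \<open>The partial sums enter through their Laplace transforms only, so increments of variance
  zero are allowed. Indices start at 1, as the levels of the field do.\<close>

locale gaussian_walk = prob_space +
  fixes \<xi> :: "nat \<Rightarrow> 'a \<Rightarrow> real" and V :: "nat \<Rightarrow> real"
  assumes indep: "indep_vars (\<lambda>_. borel) \<xi> {1..}"
    and laplace: "\<And>k \<theta>. 1 \<le> k \<Longrightarrow>
      (\<integral>\<^sup>+w. ennreal (exp (\<theta> * (\<Sum>i=1..k. \<xi> i w))) \<partial>M) = ennreal (exp (\<theta>\<^sup>2 * V k / 2))"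
begin

abbreviation walk :: "nat \<Rightarrow> 'a \<Rightarrow> real" where
  "walk k w \<equiv> \<Sum>i=1..k. \<xi> i w"

definition exp_mart :: "real \<Rightarrow> nat \<Rightarrow> 'a \<Rightarrow> real" where
  "exp_mart \<theta> k w = exp (\<theta> * walk k w - \<theta>\<^sup>2 / 2 * V k)"

lemma measurable_xi[measurable]: "1 \<le> k \<Longrightarrow> \<xi> k \<in> borel_measurable M"
  using indep by (auto simp: indep_vars_def)

lemma measurable_walk[measurable]: "walk k \<in> borel_measurable M"
  by measurable

lemma measurable_exp_mart[measurable]: "exp_mart \<theta> k \<in> borel_measurable M"
  unfolding exp_mart_def by measurable

lemma exp_mart_nonneg: "0 \<le> exp_mart \<theta> k w"
  by (simp add: exp_mart_def)

lemma nn_integral_exp_mart: "1 \<le> k \<Longrightarrow> (\<integral>\<^sup>+w. ennreal (exp_mart \<theta> k w) \<partial>M) = 1"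
  using laplace[of k \<theta>]
  by (simp add: exp_mart_def exp_diff divide_ennreal[symmetric] nn_integral_divide ennreal_divide_self)

text \<open>After time \<open>k\<close> the martingale picks up a factor built from the increments
  \<open>k + 1\<close> to \<open>n\<close>, independent of everything known at time
  \<open>k\<close>; this factor has mean one because the martingale has mean one at both ends. With
  \<open>h\<close> the indicator of a first passage at \<open>k\<close>, this acts as optional
  stopping.\<close>

lemma exp_mart_stopping:
  assumes k: "1 \<le> k" "k \<le> n" and h[measurable]: "h \<in> borel_measurable (PiM {1..k} (\<lambda>_. borel))"
  shows "(\<integral>\<^sup>+w. ennreal (exp_mart \<theta> n w) * h (\<lambda>i\<in>{1..k}. \<xi> i w) \<partial>M) =
    (\<integral>\<^sup>+w. ennreal (exp_mart \<theta> k w) * h (\<lambda>i\<in>{1..k}. \<xi> i w) \<partial>M)"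
proof -
  define f where "f = (\<lambda>x. ennreal (exp (\<theta> * (\<Sum>i=1..k. x i) - \<theta>\<^sup>2 / 2 * V k)) * h x)"
  define g where "g = (\<lambda>x. ennreal (exp (\<theta> * (\<Sum>i\<in>{k+1..n}. x i) - \<theta>\<^sup>2 / 2 * (V n - V k))))"
  let ?f = "f \<circ> (\<lambda>w. \<lambda>i\<in>{1..k}. \<xi> i w)" and ?g = "g \<circ> (\<lambda>w. \<lambda>i\<in>{k+1..n}. \<xi> i w)"
  have [measurable]: "f \<in> borel_measurable (PiM {1..k} (\<lambda>_. borel))"
    unfolding f_def by measurable
  have [measurable]: "g \<in> borel_measurable (PiM {k+1..n} (\<lambda>_. borel))"
    unfolding g_def by measurable
  have iv0: "indep_var (PiM {1..k} (\<lambda>_. borel)) (\<lambda>w. \<lambda>i\<in>{1..k}. \<xi> i w)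
      (PiM {k+1..n} (\<lambda>_. borel)) (\<lambda>w. \<lambda>i\<in>{k+1..n}. \<xi> i w)"
    by (rule indep_var_restrict[OF indep]) (use k in auto)
  have iv: "indep_var borel ?f borel ?g"
    by (rule indep_var_compose[OF iv0]) measurable
  have split: "walk n w = walk k w + (\<Sum>i\<in>{k+1..n}. \<xi> i w)" for w
  proof -
    have "{1..n} = {1..k} \<union> {k+1..n}" using k by auto
    then show ?thesis by (simp add: sum.union_disjoint)
  qed
  have f: "?f w = ennreal (exp_mart \<theta> k w) * h (\<lambda>i\<in>{1..k}. \<xi> i w)" for w
    by (simp add: f_def exp_mart_def)
  have g: "ennreal (exp_mart \<theta> n w) = ennreal (exp_mart \<theta> k w) * ?g w" for w
  proof -
    have "exp_mart \<theta> n w = exp_mart \<theta> k w * exp (\<theta> * (\<Sum>i\<in>{k+1..n}. \<xi> i w) - \<theta>\<^sup>2 / 2 * (V n - V k))"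
      by (simp only: exp_mart_def split mult_exp_exp)
        (rule arg_cong[where f=exp], simp add: field_simps del: One_nat_def)
    then show ?thesis
      by (simp add: g_def ennreal_mult exp_mart_nonneg)
  qed
  have "indep_var borel ((\<lambda>x. ennreal (exp (\<theta> * (\<Sum>i=1..k. x i) - \<theta>\<^sup>2 / 2 * V k))) \<circ>
      (\<lambda>w. \<lambda>i\<in>{1..k}. \<xi> i w)) borel ?g"
    by (rule indep_var_compose[OF iv0]) measurable
  from indep_var_nn_integral_mult[OF this]
  have "(\<integral>\<^sup>+w. ennreal (exp_mart \<theta> k w) * ?g w \<partial>M) = (\<integral>\<^sup>+w. ennreal (exp_mart \<theta> k w) \<partial>M) * (\<integral>\<^sup>+w. ?g w \<partial>M)"
    by (simp add: exp_mart_def)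
  then have G: "(\<integral>\<^sup>+w. ?g w \<partial>M) = 1"
    using k nn_integral_exp_mart[of k \<theta>] nn_integral_exp_mart[of n \<theta>] by (simp only: g[symmetric]) simp
  have "(\<integral>\<^sup>+w. ennreal (exp_mart \<theta> n w) * h (\<lambda>i\<in>{1..k}. \<xi> i w) \<partial>M) = (\<integral>\<^sup>+w. ?f w * ?g w \<partial>M)"
    by (simp only: g f mult_ac)
  also have "\<dots> = (\<integral>\<^sup>+w. ?f w \<partial>M)"
    using indep_var_nn_integral_mult[OF iv] G by simp
  finally show ?thesis by (simp only: f)
qed

text \<open>On the first \<open>k\<close> with \<open>\<delta> (S k - \<gamma> V k) \<ge> \<delta>\<^sup>2 V k\<close>, the martingale with parameter \<open>\<gamma>\<close> is at
  most \<open>exp (- \<delta>\<^sup>2 V k / 2)\<close> times the one with parameter \<open>\<gamma> + \<delta>\<close>.\<close>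

lemma exp_mart_maximal:
  assumes "1 \<le> N" "M' \<le> n" and a: "\<And>k. N \<le> k \<Longrightarrow> a \<le> V k"
  shows "(\<integral>\<^sup>+w. ennreal (exp_mart \<gamma> n w) *
      indicator {w. \<exists>k\<in>{N..M'}. \<delta>\<^sup>2 * V k \<le> \<delta> * (walk k w - \<gamma> * V k)} w \<partial>M) \<le>
    ennreal (exp (- \<delta>\<^sup>2 * a / 2))"
proof -
  \<comment> \<open>\<open>\<delta>\<close> may have either sign: a positive one detects a walk
    above the line of slope \<open>\<gamma> + \<delta>\<close> in the clock \<open>V\<close>, a
    negative one a walk below it.\<close>
  define P where "P = (\<lambda>k (x :: nat \<Rightarrow> real). \<delta>\<^sup>2 * V k \<le> \<delta> * ((\<Sum>i=1..k. x i) - \<gamma> * V k))"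
  \<comment> \<open>Indicators of the disjoint events that the first occurrence in the window is at
    \<open>k\<close>; they depend on the first \<open>k\<close> increments alone.\<close>
  define h :: "nat \<Rightarrow> (nat \<Rightarrow> real) \<Rightarrow> ennreal"
    where "h = (\<lambda>k x. indicator {x. P k x \<and> (\<forall>j\<in>{N..<k}. \<not> P j x)} x)"
  let ?h = "\<lambda>k w. h k (\<lambda>i\<in>{1..k}. \<xi> i w)"
  have hm[measurable]: "h k \<in> borel_measurable (PiM {1..k} (\<lambda>_. borel))" for k
  proof -
    have *: "(\<lambda>x. \<Sum>i=1..j. x i) \<in> borel_measurable (PiM {1..k} (\<lambda>_. borel :: real measure))"
      if "j \<le> k" for j
      by (intro borel_measurable_sum measurable_component_singleton) (use that in auto)
    have "Measurable.pred (PiM {1..k} (\<lambda>_. borel)) (\<lambda>x. P k x \<and> (\<forall>j\<in>{N..<k}. \<not> P j x))"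
      unfolding P_def using *
      by (intro pred_intros_logic pred_intros_finite borel_measurable_le borel_measurable_times
        borel_measurable_diff borel_measurable_const) auto
    then show ?thesis
      unfolding h_def by (simp add: pred_def borel_measurable_indicator_iff Int_def conj_commute)
  qed
  have hm': "?h k \<in> borel_measurable M" for k
    by (rule measurable_compose[OF measurable_restrict hm]) auto
  have Pr: "P j (\<lambda>i\<in>{1..k}. \<xi> i w) = P j (\<lambda>i. \<xi> i w)" if "j \<le> k" for j k w
    using that by (auto simp: P_def intro!: arg_cong2[where f="(\<le>)"] sum.cong)
  have heq: "?h k w = indicator {w. P k (\<lambda>i. \<xi> i w) \<and> (\<forall>j\<in>{N..<k}. \<not> P j (\<lambda>i. \<xi> i w))} w" for k w
    by (auto simp: h_def indicator_def Pr simp del: One_nat_def)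
  have le: "ennreal (exp_mart \<gamma> k w) * ?h k w \<le>
      ennreal (exp (- \<delta>\<^sup>2 * a / 2)) * (ennreal (exp_mart (\<gamma> + \<delta>) k w) * ?h k w)" if k: "k \<in> {N..M'}" for k w
  proof (cases "P k (\<lambda>i. \<xi> i w)")
    case True
    have av: "\<delta>\<^sup>2 * a \<le> \<delta>\<^sup>2 * V k" using a k by (intro mult_left_mono) auto
    have "\<gamma> * walk k w - \<gamma>\<^sup>2 / 2 * V k \<le> - \<delta>\<^sup>2 * a / 2 + ((\<gamma> + \<delta>) * walk k w - (\<gamma> + \<delta>)\<^sup>2 / 2 * V k)"
      using True av by (simp add: P_def power2_eq_square field_simps del: One_nat_def)
    then have "exp_mart \<gamma> k w \<le> exp (- \<delta>\<^sup>2 * a / 2) * exp_mart (\<gamma> + \<delta>) k w"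
      by (simp only: exp_mart_def mult_exp_exp exp_le_cancel_iff)
    then have "ennreal (exp_mart \<gamma> k w) \<le> ennreal (exp (- \<delta>\<^sup>2 * a / 2)) * ennreal (exp_mart (\<gamma> + \<delta>) k w)"
      by (simp only: ennreal_mult[symmetric] exp_ge_zero exp_mart_nonneg ennreal_leI)
    then show ?thesis
      unfolding mult.assoc[symmetric] by (rule mult_right_mono) simp
  next
    case False
    then have "?h k w = 0" by (simp only: heq) simp
    then show ?thesis by simp
  qed
  have ind: "indicator {w. \<exists>k\<in>{N..M'}. P k (\<lambda>i. \<xi> i w)} w = (\<Sum>k\<in>{N..M'}. ?h k w)" for w
  proof (cases "\<exists>k\<in>{N..M'}. P k (\<lambda>i. \<xi> i w)")
    case True
    define k0 where "k0 = (LEAST k. N \<le> k \<and> P k (\<lambda>i. \<xi> i w))"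
    have k0: "N \<le> k0 \<and> P k0 (\<lambda>i. \<xi> i w)"
      unfolding k0_def by (rule LeastI_ex) (use True in auto)
    have le_k0: "k0 \<le> k" if "N \<le> k" "P k (\<lambda>i. \<xi> i w)" for k
      unfolding k0_def by (rule Least_le) (use that in auto)
    have lt: "\<not> P j (\<lambda>i. \<xi> i w)" if "N \<le> j" "j < k0" for j
      using le_k0[of j] that by auto
    have k0M: "k0 \<le> M'"
      using True le_k0 by (meson atLeastAtMost_iff order_trans)
    have "?h k w = (if k = k0 then 1 else 0)" if "k \<in> {N..M'}" for k
    proof (cases k k0 rule: linorder_cases)
      case less
      then have "\<not> P k (\<lambda>i. \<xi> i w)" using lt[of k] that by simp
      with less show ?thesis unfolding heq by simp
    next
      case equal
      then show ?thesis using k0 lt unfolding heq by simp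
    next
      case greater
      then have "\<not> (\<forall>j\<in>{N..<k}. \<not> P j (\<lambda>i. \<xi> i w))" using k0 by force
      with greater show ?thesis unfolding heq by (simp add: indicator_def)
    qed
    then have "(\<Sum>k\<in>{N..M'}. ?h k w) = (\<Sum>k\<in>{N..M'}. if k = k0 then 1 else 0)"
      by (intro sum.cong) auto
    then show ?thesis using True k0 k0M by simp
  next
    case False
    then have "?h k w = 0" if "k \<in> {N..M'}" for k
      using that unfolding heq by (auto simp: indicator_def)
    then have "(\<Sum>k\<in>{N..M'}. ?h k w) = 0" by (intro sum.neutral) auto
    with False show ?thesis by (simp add: indicator_def)
  qed
  have "(\<integral>\<^sup>+w. ennreal (exp_mart \<gamma> n w) * indicator {w. \<exists>k\<in>{N..M'}. P k (\<lambda>i. \<xi> i w)} w \<partial>M) =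
      (\<Sum>k\<in>{N..M'}. \<integral>\<^sup>+w. ennreal (exp_mart \<gamma> n w) * ?h k w \<partial>M)"
    unfolding ind sum_distrib_left
    by (intro nn_integral_sum borel_measurable_times_ennreal hm') auto
  also have "\<dots> = (\<Sum>k\<in>{N..M'}. \<integral>\<^sup>+w. ennreal (exp_mart \<gamma> k w) * ?h k w \<partial>M)"
    using assms by (intro sum.cong exp_mart_stopping hm) auto
  also have "\<dots> \<le> (\<Sum>k\<in>{N..M'}. \<integral>\<^sup>+w. ennreal (exp (- \<delta>\<^sup>2 * a / 2)) * (ennreal (exp_mart (\<gamma> + \<delta>) k w) * ?h k w) \<partial>M)"
    by (rule sum_mono, rule nn_integral_mono, rule le)
  also have "\<dots> = ennreal (exp (- \<delta>\<^sup>2 * a / 2)) * (\<Sum>k\<in>{N..M'}. \<integral>\<^sup>+w. ennreal (exp_mart (\<gamma> + \<delta>) k w) * ?h k w \<partial>M)"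
    unfolding sum_distrib_left
    by (intro sum.cong nn_integral_cmult borel_measurable_times_ennreal hm') auto
  \<comment> \<open>Stopping is now undone for the parameter \<open>\<gamma> + \<delta>\<close>: the
    pieces are carried back to the common level \<open>n\<close>, where they add up to at most the
    total mass.\<close>
  also have "(\<Sum>k\<in>{N..M'}. \<integral>\<^sup>+w. ennreal (exp_mart (\<gamma> + \<delta>) k w) * ?h k w \<partial>M) =
      (\<Sum>k\<in>{N..M'}. \<integral>\<^sup>+w. ennreal (exp_mart (\<gamma> + \<delta>) n w) * ?h k w \<partial>M)"
    using assms by (intro sum.cong exp_mart_stopping[symmetric] hm) auto
  also have "\<dots> = (\<integral>\<^sup>+w. ennreal (exp_mart (\<gamma> + \<delta>) n w) * indicator {w. \<exists>k\<in>{N..M'}. P k (\<lambda>i. \<xi> i w)} w \<partial>M)"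
    unfolding ind sum_distrib_left
    by (intro nn_integral_sum[symmetric] borel_measurable_times_ennreal hm') auto
  \<comment> \<open>If \<open>n = 0\<close> the window is empty, as \<open>1 \<le> N\<close> and
    \<open>M' \<le> n\<close>; the mean-one identity starts at level 1.\<close>
  also have "\<dots> \<le> (if n = 0 then 0 else 1)"
  proof (cases "n = 0")
    case True
    then show ?thesis using assms by simp
  next
    case False
    then have "(\<integral>\<^sup>+w. ennreal (exp_mart (\<gamma> + \<delta>) n w) * indicator {w. \<exists>k\<in>{N..M'}. P k (\<lambda>i. \<xi> i w)} w \<partial>M) \<le>
      (\<integral>\<^sup>+w. ennreal (exp_mart (\<gamma> + \<delta>) n w) \<partial>M)"
      by (intro nn_integral_mono) (auto simp: indicator_def)
    then show ?thesis using nn_integral_exp_mart[of n] False by simp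
  qed
  also have "\<dots> \<le> 1" by simp
  finally show ?thesis by (simp add: P_def mult_left_mono)
qed

end

text \<open>Caratheodory functions: replacing \<open>y\<close> by the first member of a dense
  sequence within \<open>1 / (k + 1)\<close> leaves countably many measurable pieces, and continuity
  in \<open>y\<close> recovers \<open>f\<close> in the limit. It serves both the field, in
  environment and point, and the Brownian paths, in sample and time.\<close>

lemma measurable_pair_continuous:
  fixes f :: "'w \<Rightarrow> 'a::{metric_space, second_countable_topology} \<Rightarrow> 'c::{metric_space, second_countable_topology}"
  assumes meas: "\<And>y. y \<in> D \<Longrightarrow> (\<lambda>w. f w y) \<in> borel_measurable M"
    and cont: "\<And>w. w \<in> space M \<Longrightarrow> continuous_on D (f w)"
  shows "(\<lambda>x. f (fst x) (snd x)) \<in> borel_measurable (M \<Otimes>\<^sub>M restrict_space borel D)"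
proof (cases "D = {}")
  case True
  then show ?thesis by (simp add: measurable_def space_pair_measure space_restrict_space)
next
  case False
  obtain T where T: "countable T" "T \<subseteq> D" "D \<subseteq> closure T"
    using separable by blast
  then have "T \<noteq> {}" using False by auto
  define t where "t = from_nat_into T"
  have range: "range t = T" and tD: "t i \<in> D" for i
    using T \<open>T \<noteq> {}\<close> by (auto simp: t_def range_from_nat_into from_nat_into subsetD)
  define j where "j k y = (LEAST i. dist (t i) y < 1 / real (Suc k))" for k y
  have j: "dist (t (j k y)) y < 1 / real (Suc k)" if "y \<in> D" for k y
  proof -
    have "y \<in> closure T" using T that by auto
    then obtain s where "s \<in> T" "dist s y < 1 / real (Suc k)"
      by (auto simp: closure_approachable) (metis of_nat_0_less_iff zero_less_Suc zero_less_divide_1_iff of_nat_Suc)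
    then have "\<exists>i. dist (t i) y < 1 / real (Suc k)"
      using range by (metis imageE)
    then show ?thesis unfolding j_def by (rule LeastI_ex)
  qed
  have jm[measurable]: "j k \<in> measurable (restrict_space borel D) (count_space UNIV)" for k
  proof -
    have [measurable]: "(\<lambda>y. y) \<in> borel_measurable (restrict_space borel D)"
      by (rule measurable_restrict_space1) simp
    show ?thesis unfolding j_def by measurable
  qed
  show ?thesis
  proof (rule borel_measurable_LIMSEQ_metric)
    fix k
    have "(\<lambda>x. f (fst x) (t i)) \<in> borel_measurable (M \<Otimes>\<^sub>M restrict_space borel D)" for i
      by (rule measurable_compose[OF measurable_fst meas[OF tD]])
    moreover have "(\<lambda>x. j k (snd x)) \<in> measurable (M \<Otimes>\<^sub>M restrict_space borel D) (count_space UNIV)"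
      by measurable
    ultimately show "(\<lambda>x. f (fst x) (t (j k (snd x)))) \<in> borel_measurable (M \<Otimes>\<^sub>M restrict_space borel D)"
      by (rule measurable_compose_countable)
  next
    fix x assume "x \<in> space (M \<Otimes>\<^sub>M restrict_space borel D)"
    then have x: "fst x \<in> space M" "snd x \<in> D"
      by (auto simp: space_pair_measure space_restrict_space)
    have "(\<lambda>k. t (j k (snd x))) \<longlonglongrightarrow> snd x"
    proof (rule metric_LIMSEQ_I)
      fix r :: real assume "0 < r"
      then obtain K where K: "1 / real (Suc K) < r" using nat_approx_posE by metis
      show "\<exists>no. \<forall>n\<ge>no. dist (t (j n (snd x))) (snd x) < r"
      proof (intro exI allI impI)
        fix n assume "K \<le> n"
        then have "1 / real (Suc n) \<le> 1 / real (Suc K)" by (simp add: field_simps)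
        then show "dist (t (j n (snd x))) (snd x) < r" using j[OF x(2), of n] K by linarith
      qed
    qed
    then show "(\<lambda>k. f (fst x) (t (j k (snd x)))) \<longlonglongrightarrow> f (fst x) (snd x)"
      using cont[OF x(1)] x(2) tD
      by (auto simp: continuous_on_sequentially comp_def)
  qed
qed

section \<open>Chaos masses of the points with a wrong slope\<close>

locale cutoff_field =
  fixes S :: "'a::euclidean_space surface" and PX :: "'w measure" and Xn :: "nat \<Rightarrow> 'w \<Rightarrow> 'a \<Rightarrow> real"
    and V :: "nat \<Rightarrow> real" and Gn :: "nat \<Rightarrow> 'a \<Rightarrow> 'a \<Rightarrow> real"
  assumes prob: "prob_space PX"
    and closed_pts: "closed (pts S)"
    and sets_vol: "sets (vol S) = sets (restrict_space borel (pts S))"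
    and finite_ball: "\<And>R. emeasure (vol S) (pts S \<inter> ball 0 R) < \<infinity>"
    and gauss: "\<And>n. 1 \<le> n \<Longrightarrow> centered_gaussian_field PX (pts S) (Xn n) (Gn n)"
    and cont: "\<And>n w. 1 \<le> n \<Longrightarrow> w \<in> space PX \<Longrightarrow> continuous_on (pts S) (Xn n w)"
    and indep_incr: "prob_space.indep_vars PX (\<lambda>_. PiM (pts S) (\<lambda>_. borel))
       (\<lambda>k w. \<lambda>x\<in>pts S. Xn k w x - (if k = 1 then 0 else Xn (k - 1) w x)) {1..}"
    and diag: "\<And>n y. 1 \<le> n \<Longrightarrow> y \<in> pts S \<Longrightarrow> Gn n y y = V n"
    and V_top: "filterlim V at_top sequentially"
begin

sublocale prob_space PX by (rule prob)

lemma sigma_finite_vol: "sigma_finite_measure (vol S)"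
proof
  have "pts S \<inter> ball 0 R \<in> sets (vol S)" for R
    unfolding sets_vol sets_restrict_space by auto
  moreover have "(\<Union>n::nat. pts S \<inter> ball 0 (real n)) = pts S"
    by (auto simp: reals_Archimedean2)
  ultimately show "\<exists>A. countable A \<and> A \<subseteq> sets (vol S) \<and> \<Union>A = space (vol S) \<and> (\<forall>a\<in>A. emeasure (vol S) a \<noteq> \<infinity>)"
    using finite_ball by (intro exI[of _ "range (\<lambda>n::nat. pts S \<inter> ball 0 (real n))"]) (auto simp: less_top)
qed

lemma Xn_measurable: "1 \<le> n \<Longrightarrow> y \<in> pts S \<Longrightarrow> (\<lambda>w. Xn n w y) \<in> borel_measurable PX"
  using gauss[of n] by (auto simp: centered_gaussian_field_def)

lemma Xn_pair_measurable:
  assumes "1 \<le> n"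
  shows "(\<lambda>x. Xn n (fst x) (snd x)) \<in> borel_measurable (PX \<Otimes>\<^sub>M vol S)"
proof -
  have "sets (PX \<Otimes>\<^sub>M vol S) = sets (PX \<Otimes>\<^sub>M restrict_space borel (pts S))"
    by (intro sets_pair_measure_cong refl sets_vol)
  then show ?thesis
    using measurable_pair_continuous[of "pts S" "Xn n" PX] assms Xn_measurable cont
    by (simp cong: measurable_cong_sets)
qed

text \<open>Freezing the point turns the cutoffs into a Gaussian walk by telescoping. Nothing is
  known about \<open>Xn 0\<close>, so the first increment is \<open>Xn 1\<close> itself; this is the
  purpose of the case distinction at \<open>k = 1\<close>.\<close>

lemma gaussian_walk_at:
  assumes y: "y \<in> pts S"
  shows "gaussian_walk PX (\<lambda>k w. Xn k w y - (if k = 1 then 0 else Xn (k - 1) w y)) V"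
    and "1 \<le> k \<Longrightarrow> (\<Sum>i=1..k. Xn i w y - (if i = 1 then 0 else Xn (i - 1) w y)) = Xn k w y"
    and "1 \<le> n \<Longrightarrow> (LINT w|PX. (Xn n w y)\<^sup>2) = V n"
proof -
  have tele: "(\<Sum>i=1..k. Xn i w y - (if i = 1 then 0 else Xn (i - 1) w y)) = Xn k w y" if "1 \<le> k" for k w
    using that by (induction k rule: dec_induct) auto
  then show "1 \<le> k \<Longrightarrow> (\<Sum>i=1..k. Xn i w y - (if i = 1 then 0 else Xn (i - 1) w y)) = Xn k w y" .
  have law: "(LINT w|PX. (Xn n w y)\<^sup>2) = V n"
    "(\<integral>\<^sup>+w. ennreal (exp (\<theta> * Xn n w y)) \<partial>PX) = ennreal (exp (\<theta>\<^sup>2 * V n / 2))" if n: "1 \<le> n" for n \<theta>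
  proof -
    note g = gauss[OF n, unfolded centered_gaussian_field_def]
    obtain \<sigma> where s: "distr PX borel (\<lambda>w. \<Sum>i\<in>{y}. 1 * Xn n w i) =
        distr (density lborel std_normal_density) borel (\<lambda>z. \<sigma> * z)"
      using g[THEN conjunct2, THEN conjunct1, rule_format, of "{y}" "\<lambda>_. 1"] y by auto
    then have s: "distr PX borel (\<lambda>w. Xn n w y) = distr (density lborel std_normal_density) borel (\<lambda>z. \<sigma> * z)"
      by simp
    note m = Xn_measurable[OF n y]
    have "(LINT w|PX. Xn n w y * Xn n w y) = V n"
      using g y diag[OF n y] by auto
    then show v: "(LINT w|PX. (Xn n w y)\<^sup>2) = V n"
      by (simp add: power2_eq_square)
    have "\<sigma>\<^sup>2 = V n"
      using integral_square_scaled_normal[OF s m] v by simp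
    then show "(\<integral>\<^sup>+w. ennreal (exp (\<theta> * Xn n w y)) \<partial>PX) = ennreal (exp (\<theta>\<^sup>2 * V n / 2))"
      using nn_integral_exp_scaled_normal[OF s m, of \<theta>] by simp
  qed
  then show "1 \<le> n \<Longrightarrow> (LINT w|PX. (Xn n w y)\<^sup>2) = V n" by blast
  have "indep_vars (\<lambda>_. borel) (\<lambda>k. (\<lambda>x. x y) \<circ>
      (\<lambda>w. \<lambda>x\<in>pts S. Xn k w x - (if k = 1 then 0 else Xn (k - 1) w x))) {1..}"
    by (rule indep_vars_compose[OF indep_incr]) (use y in auto)
  then have "indep_vars (\<lambda>_. borel) (\<lambda>k w. Xn k w y - (if k = 1 then 0 else Xn (k - 1) w y)) {1..}"
    using y by (simp add: comp_def)
  then show "gaussian_walk PX (\<lambda>k w. Xn k w y - (if k = 1 then 0 else Xn (k - 1) w y)) V"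
    using law tele by unfold_locales (simp_all del: One_nat_def)
qed

definition chaos_density :: "real \<Rightarrow> nat \<Rightarrow> 'w \<Rightarrow> 'a \<Rightarrow> real" where
  "chaos_density \<gamma> n w y = exp (\<gamma> * Xn n w y - \<gamma>\<^sup>2 / 2 * V n)"

text \<open>The strict inequality makes the set relatively open, as the passage to the limiting
  clock requires; the window stops at \<open>M\<close> so that a density of level
  \<open>n \<ge> M\<close> sees the whole event.\<close>

definition off_slope :: "real \<Rightarrow> real \<Rightarrow> nat \<Rightarrow> nat \<Rightarrow> 'w \<Rightarrow> 'a set" where
  "off_slope \<gamma> \<epsilon> N M w = {y \<in> pts S. \<exists>k\<in>{N..M}. \<epsilon> * V k < \<bar>Xn k w y - \<gamma> * V k\<bar>}"

definition off_mass :: "real \<Rightarrow> real \<Rightarrow> real \<Rightarrow> nat \<Rightarrow> nat \<Rightarrow> nat \<Rightarrow> 'w \<Rightarrow> ennreal" where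
  "off_mass \<gamma> \<epsilon> R N M n w =
    (\<integral>\<^sup>+y. ennreal (chaos_density \<gamma> n w y) * indicator (off_slope \<gamma> \<epsilon> N M w \<inter> ball 0 R) y \<partial>vol S)"

lemma chaos_pair_measurable:
  assumes "1 \<le> N" "1 \<le> n"
  shows "(\<lambda>x. ennreal (chaos_density \<gamma> n (fst x) (snd x)) *
      indicator (off_slope \<gamma> \<epsilon> N M (fst x) \<inter> ball 0 R) (snd x)) \<in> borel_measurable (PX \<Otimes>\<^sub>M vol S)"
proof -
  have [measurable]: "(\<lambda>x. Xn k (fst x) (snd x)) \<in> borel_measurable (PX \<Otimes>\<^sub>M vol S)" if "1 \<le> k" for k
    using Xn_pair_measurable[OF that] .
  have [measurable]: "(\<lambda>x. x) \<in> borel_measurable (vol S)"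
    using measurable_restrict_space1[of "\<lambda>x. x" borel borel "pts S"] sets_vol by (simp cong: measurable_cong_sets)
  have eq: "indicator (off_slope \<gamma> \<epsilon> N M (fst x) \<inter> ball 0 R) (snd x) =
      (indicator {x \<in> space (PX \<Otimes>\<^sub>M vol S). (\<exists>k\<in>{N..M}. \<epsilon> * V k < \<bar>Xn k (fst x) (snd x) - \<gamma> * V k\<bar>) \<and> norm (snd x) < R} x :: ennreal)"
    if "x \<in> space (PX \<Otimes>\<^sub>M vol S)" for x
    using that by (auto simp: indicator_def off_slope_def space_pair_measure)
  have "{x \<in> space (PX \<Otimes>\<^sub>M vol S). (\<exists>k\<in>{N..M}. \<epsilon> * V k < \<bar>Xn k (fst x) (snd x) - \<gamma> * V k\<bar>) \<and> norm (snd x) < R}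
      \<in> sets (PX \<Otimes>\<^sub>M vol S)"
  proof -
    have 1: "{x \<in> space (PX \<Otimes>\<^sub>M vol S). \<epsilon> * V k < \<bar>Xn k (fst x) (snd x) - \<gamma> * V k\<bar>} \<in> sets (PX \<Otimes>\<^sub>M vol S)"
      if "k \<in> {N..M}" for k
    proof -
      have [measurable]: "(\<lambda>x. Xn k (fst x) (snd x)) \<in> borel_measurable (PX \<Otimes>\<^sub>M vol S)"
        using that assms by (intro Xn_pair_measurable) auto
      show ?thesis by measurable
    qed
    show ?thesis
      by (intro sets.sets_Collect_conj sets.sets_Collect_finite_Ex 1) auto
  qed
  then show ?thesis
    using assms unfolding chaos_density_def
    by (subst measurable_cong[OF arg_cong2[where f="(*)", OF refl eq]]) measurable
qed

text \<open>Tonelli's theorem reduces the claim to a fixed point \<open>y\<close>. There a deviation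
  belongs to the one-sided event for \<open>\<delta> = \<epsilon>\<close> or to the one for
  \<open>\<delta> = - \<epsilon>\<close>, and the maximal inequality applies to each; hence the
  factor 2.\<close>

lemma nn_integral_off_mass:
  assumes N: "1 \<le> N" and Mn: "M \<le> n" "1 \<le> n" and a: "\<And>k. N \<le> k \<Longrightarrow> a \<le> V k" and e: "0 < \<epsilon>"
  shows "(\<integral>\<^sup>+w. off_mass \<gamma> \<epsilon> R N M n w \<partial>PX) \<le>
    2 * ennreal (exp (- \<epsilon>\<^sup>2 * a / 2)) * emeasure (vol S) (pts S \<inter> ball 0 R)"
proof -
  interpret vol: sigma_finite_measure "vol S" by (rule sigma_finite_vol)
  interpret pair_sigma_finite PX "vol S" ..
  have ball: "pts S \<inter> ball 0 R \<in> sets (vol S)"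
    unfolding sets_vol sets_restrict_space by auto
  have at: "(\<integral>\<^sup>+w. ennreal (chaos_density \<gamma> n w y) * indicator (off_slope \<gamma> \<epsilon> N M w \<inter> ball 0 R) y \<partial>PX) \<le>
      2 * ennreal (exp (- \<epsilon>\<^sup>2 * a / 2)) * indicator (pts S \<inter> ball 0 R) y" if y: "y \<in> pts S" for y
  proof (cases "y \<in> ball 0 R")
    case True
    interpret gaussian_walk PX "\<lambda>k w. Xn k w y - (if k = 1 then 0 else Xn (k - 1) w y)" V
      by (rule gaussian_walk_at[OF y])
    note walk = gaussian_walk_at(2)[OF y]
    have em: "chaos_density \<gamma> n w y = exp_mart \<gamma> n w" for w
      unfolding exp_mart_def walk[OF Mn(2)] chaos_density_def ..
    define Q where "Q \<delta> = {w. \<exists>k\<in>{N..M}. \<delta>\<^sup>2 * V k \<le> \<delta> * (walk k w - \<gamma> * V k)}" for \<delta>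
    have bd: "(\<integral>\<^sup>+w. ennreal (exp_mart \<gamma> n w) * indicator (Q \<delta>) w \<partial>PX) \<le> ennreal (exp (- \<epsilon>\<^sup>2 * a / 2))"
      if "\<delta>\<^sup>2 = \<epsilon>\<^sup>2" for \<delta>
      using exp_mart_maximal[OF N Mn(1) a, of \<gamma> \<delta>] that by (simp only: Q_def)
    have Qm: "{w \<in> space PX. w \<in> Q \<delta>} \<in> sets PX" for \<delta>
      unfolding Q_def mem_Collect_eq
      by (rule sets.sets_Collect_finite_Ex) (auto simp del: One_nat_def)
    have Qm': "(\<lambda>w. indicator (Q \<delta>) w :: ennreal) \<in> borel_measurable PX" for \<delta>
      using Qm by (simp add: borel_measurable_indicator_iff Int_def conj_commute)
    have "(\<integral>\<^sup>+w. ennreal (chaos_density \<gamma> n w y) * indicator (off_slope \<gamma> \<epsilon> N M w \<inter> ball 0 R) y \<partial>PX) \<le>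
      (\<integral>\<^sup>+w. ennreal (exp_mart \<gamma> n w) * indicator (Q \<epsilon>) w + ennreal (exp_mart \<gamma> n w) * indicator (Q (- \<epsilon>)) w \<partial>PX)"
    proof (intro nn_integral_mono)
      fix w
      have "w \<in> Q \<epsilon> \<or> w \<in> Q (- \<epsilon>)" if yo: "y \<in> off_slope \<gamma> \<epsilon> N M w"
      proof -
        obtain k where k: "k \<in> {N..M}" "\<epsilon> * V k < \<bar>Xn k w y - \<gamma> * V k\<bar>"
          using yo by (auto simp: off_slope_def)
        then have wk: "walk k w = Xn k w y" using walk N by simp
        consider "\<epsilon> * V k \<le> Xn k w y - \<gamma> * V k" | "\<epsilon> * V k \<le> - (Xn k w y - \<gamma> * V k)"
          using k(2) by linarith
        then show ?thesis
        proof cases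
          case 1
          then have "\<epsilon> * (\<epsilon> * V k) \<le> \<epsilon> * (walk k w - \<gamma> * V k)"
            unfolding wk using e by (intro mult_left_mono) auto
          then show ?thesis using k(1) unfolding Q_def by (auto simp: power2_eq_square mult.assoc simp del: One_nat_def)
        next
          case 2
          then have "\<epsilon> * (\<epsilon> * V k) \<le> \<epsilon> * (- (walk k w - \<gamma> * V k))"
            unfolding wk using e by (intro mult_left_mono) auto
          then show ?thesis using k(1) unfolding Q_def
            by (intro disjI2 CollectI bexI[of _ k]) (simp_all add: power2_eq_square algebra_simps del: One_nat_def)
        qed
      qed
      then show "ennreal (chaos_density \<gamma> n w y) * indicator (off_slope \<gamma> \<epsilon> N M w \<inter> ball 0 R) y \<le>
        ennreal (exp_mart \<gamma> n w) * indicator (Q \<epsilon>) w + ennreal (exp_mart \<gamma> n w) * indicator (Q (- \<epsilon>)) w"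
        unfolding em by (auto simp: indicator_def)
    qed
    also have "\<dots> = (\<integral>\<^sup>+w. ennreal (exp_mart \<gamma> n w) * indicator (Q \<epsilon>) w \<partial>PX) +
        (\<integral>\<^sup>+w. ennreal (exp_mart \<gamma> n w) * indicator (Q (- \<epsilon>)) w \<partial>PX)"
      by (intro nn_integral_add borel_measurable_times_ennreal Qm'
          measurable_compose[OF measurable_exp_mart measurable_ennreal])
    also have "\<dots> \<le> ennreal (exp (- \<epsilon>\<^sup>2 * a / 2)) + ennreal (exp (- \<epsilon>\<^sup>2 * a / 2))"
      by (intro add_mono bd) auto
    finally show ?thesis using True y by (simp add: mult_2)
  qed simp
  have "(\<integral>\<^sup>+w. off_mass \<gamma> \<epsilon> R N M n w \<partial>PX) =
      (\<integral>\<^sup>+y. \<integral>\<^sup>+w. ennreal (chaos_density \<gamma> n w y) * indicator (off_slope \<gamma> \<epsilon> N M w \<inter> ball 0 R) y \<partial>PX \<partial>vol S)"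
    unfolding off_mass_def
    using Fubini'[of "\<lambda>w y. ennreal (chaos_density \<gamma> n w y) * indicator (off_slope \<gamma> \<epsilon> N M w \<inter> ball 0 R) y"]
      chaos_pair_measurable[OF N Mn(2), of \<gamma> \<epsilon> M R] by (simp add: case_prod_beta')
  also have "\<dots> \<le> (\<integral>\<^sup>+y. 2 * ennreal (exp (- \<epsilon>\<^sup>2 * a / 2)) * indicator (pts S \<inter> ball 0 R) y \<partial>vol S)"
    by (intro nn_integral_mono at)
  also have "\<dots> = 2 * ennreal (exp (- \<epsilon>\<^sup>2 * a / 2)) * emeasure (vol S) (pts S \<inter> ball 0 R)"
    using ball by (subst nn_integral_cmult) auto
  finally show ?thesis .
qed

text \<open>Fatou's lemma handles the limit in \<open>n\<close>, monotone convergence the supremum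
  over \<open>M\<close>, and the infimum is bounded by a single \<open>N\<close> beyond which
  \<open>V\<close> is at least \<open>a\<close>. The resulting bound on the integral tends to 0 with
  growing \<open>a\<close>.\<close>

lemma off_mass_vanishes:
  assumes e: "0 < \<epsilon>"
  shows "AE w in PX. (INF N\<in>{1..}. SUP M. liminf (\<lambda>n. off_mass \<gamma> \<epsilon> R N M n w)) = 0"
proof -
  interpret vol: sigma_finite_measure "vol S" by (rule sigma_finite_vol)
  \<comment> \<open>The shift by one avoids level 0, about which nothing is known; the lower limit
    does not change.\<close>
  let ?L = "\<lambda>N M w. liminf (\<lambda>n. off_mass \<gamma> \<epsilon> R N M (Suc n) w)"
  have L: "liminf (\<lambda>n. off_mass \<gamma> \<epsilon> R N M n w) = ?L N M w" for N M w
    using liminf_shift[of "\<lambda>n. off_mass \<gamma> \<epsilon> R N M n w"] by simp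
  have om: "off_mass \<gamma> \<epsilon> R N M (Suc n) \<in> borel_measurable PX" if "1 \<le> N" for N M n
    unfolding off_mass_def
    using vol.borel_measurable_nn_integral[of "\<lambda>w y. ennreal (chaos_density \<gamma> (Suc n) w y) * indicator (off_slope \<gamma> \<epsilon> N M w \<inter> ball 0 R) y" PX]
      chaos_pair_measurable[OF that, of "Suc n" \<gamma> \<epsilon> M R] by (simp add: case_prod_beta')
  have Lm: "?L N M \<in> borel_measurable PX" if "1 \<le> N" for N M
    using om[OF that] by measurable
  have Sm: "(\<lambda>w. SUP M. ?L N M w) \<in> borel_measurable PX" if "1 \<le> N" for N
    using Lm[OF that] by measurable
  have mono: "off_mass \<gamma> \<epsilon> R N M n w \<le> off_mass \<gamma> \<epsilon> R N M' n w" if "M \<le> M'" for N M M' n w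
    unfolding off_mass_def using that
    by (intro nn_integral_mono mult_left_mono) (auto simp: indicator_def off_slope_def intro: order_trans)
  have inc: "incseq (\<lambda>M w. ?L N M w)" for N
    using mono by (intro monoI le_funI Liminf_mono always_eventually) blast
  let ?c = "emeasure (vol S) (pts S \<inter> ball 0 R)"
  have int: "(\<integral>\<^sup>+w. (INF N\<in>{1..}. SUP M. ?L N M w) \<partial>PX) \<le> 2 * ennreal (exp (- \<epsilon>\<^sup>2 * a / 2)) * ?c" for a
  proof -
    obtain N0 where N0: "\<And>k. N0 \<le> k \<Longrightarrow> a \<le> V k"
      using V_top by (auto simp: filterlim_at_top eventually_sequentially)
    define N where "N = max 1 N0"
    have N: "1 \<le> N" "\<And>k. N \<le> k \<Longrightarrow> a \<le> V k" using N0 by (auto simp: N_def)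
    have "(\<integral>\<^sup>+w. (INF N\<in>{1..}. SUP M. ?L N M w) \<partial>PX) \<le> (\<integral>\<^sup>+w. (SUP M. ?L N M w) \<partial>PX)"
      using N by (intro nn_integral_mono INF_lower) auto
    also have "\<dots> = (SUP M. \<integral>\<^sup>+w. ?L N M w \<partial>PX)"
      using inc Lm N by (intro nn_integral_monotone_convergence_SUP) auto
    also have "\<dots> \<le> 2 * ennreal (exp (- \<epsilon>\<^sup>2 * a / 2)) * ?c"
    proof (rule SUP_least)
      fix M
      have "(\<integral>\<^sup>+w. ?L N M w \<partial>PX) \<le> liminf (\<lambda>n. \<integral>\<^sup>+w. off_mass \<gamma> \<epsilon> R N M (Suc n) w \<partial>PX)"
        using om N by (intro nn_integral_liminf) auto
      also have "\<dots> \<le> liminf (\<lambda>n. 2 * ennreal (exp (- \<epsilon>\<^sup>2 * a / 2)) * ?c)"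
        by (intro Liminf_mono eventually_sequentiallyI[of M] nn_integral_off_mass N e) auto
      finally show "(\<integral>\<^sup>+w. ?L N M w \<partial>PX) \<le> 2 * ennreal (exp (- \<epsilon>\<^sup>2 * a / 2)) * ?c"
        by (simp add: Liminf_const)
    qed
    finally show ?thesis .
  qed
  have "(\<integral>\<^sup>+w. (INF N\<in>{1..}. SUP M. ?L N M w) \<partial>PX) \<le> 0"
  proof (rule LIMSEQ_le_const)
    have "(\<lambda>a. exp (- \<epsilon>\<^sup>2 * real a / 2)) \<longlonglongrightarrow> 0"
      using e by real_asymp
    then have "(\<lambda>a. ennreal (exp (- \<epsilon>\<^sup>2 * real a / 2))) \<longlonglongrightarrow> ennreal 0"
      by (rule tendsto_ennrealI)
    then have "(\<lambda>a. (2 * ?c) * ennreal (exp (- \<epsilon>\<^sup>2 * real a / 2))) \<longlonglongrightarrow> (2 * ?c) * ennreal 0"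
      using finite_ball[of R] by (intro ennreal_tendsto_cmult) (auto simp: ennreal_mult_less_top)
    then show "(\<lambda>a. 2 * ennreal (exp (- \<epsilon>\<^sup>2 * real a / 2)) * ?c) \<longlonglongrightarrow> 0"
      by (simp add: mult_ac)
    show "\<exists>K. \<forall>a\<ge>K. (\<integral>\<^sup>+w. (INF N\<in>{1..}. SUP M. ?L N M w) \<partial>PX) \<le> 2 * ennreal (exp (- \<epsilon>\<^sup>2 * real a / 2)) * ?c"
      using int by blast
  qed
  moreover have "(\<lambda>w. INF N\<in>{1..}. SUP M. ?L N M w) \<in> borel_measurable PX"
    using Sm by (intro borel_measurable_INF) auto
  ultimately show ?thesis
    unfolding L by (subst (asm) le_zero_eq) (simp add: nn_integral_0_iff_AE)
qed

end

section \<open>Convergence of clocks\<close>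

text \<open>\<open>U\<close> is exhausted from inside by finite unions of disjoint dyadic cells, and
  limits pass through finite sums. This version of the portmanteau inequality allows infinite total
  mass, which clocks tending to infinity have.\<close>

lemma emeasure_open_le_liminf:
  fixes \<nu> :: "real measure" and \<mu> :: "nat \<Rightarrow> real measure"
  assumes sets: "sets \<nu> = sets borel" "\<And>n. sets (\<mu> n) = sets borel"
    and lim: "\<And>a b. 0 \<le> a \<Longrightarrow> a \<le> b \<Longrightarrow> (\<lambda>n. emeasure (\<mu> n) {a<..b}) \<longlonglongrightarrow> emeasure \<nu> {a<..b}"
    and U: "open U" "U \<subseteq> {0<..}"
  shows "emeasure \<nu> U \<le> liminf (\<lambda>n. emeasure (\<mu> n) U)"
proof -
  define I where "I k j = {real j / 2 ^ k <.. (real j + 1) / 2 ^ k}" for k j :: nat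
  define J where "J k = {j \<in> {..< k * 2 ^ k}. I k j \<subseteq> U}" for k
  define W where "W k = (\<Union>j\<in>J k. I k j)" for k
  have fin: "finite (J k)" for k by (auto simp: J_def)
  have W: "W k \<subseteq> U" for k by (auto simp: W_def J_def)
  have Is: "I k j \<in> sets borel" for k j by (auto simp: I_def)
  have ev: "eventually (\<lambda>k. x \<in> W k) sequentially" if x: "x \<in> U" for x
  proof -
    obtain e where e: "0 < e" "ball x e \<subseteq> U" using U x open_contains_ball by blast
    have x0: "0 < x" using x U by auto
    obtain K1 :: nat where K1: "x < real K1" using reals_Archimedean2 by blast
    have "(\<lambda>k. (1/2::real) ^ k) \<longlonglongrightarrow> 0" by (intro LIMSEQ_realpow_zero) auto
    then have "eventually (\<lambda>k. (1/2::real) ^ k < e) sequentially"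
      using e(1) by (rule order_tendstoD)
    then show ?thesis
      using eventually_ge_at_top[of K1]
    proof eventually_elim
      fix k assume k: "(1/2::real) ^ k < e" "K1 \<le> k"
      \<comment> \<open>The cells are open on the left and closed on the right, so the cell
        containing \<open>x\<close> is found by rounding up.\<close>
      define j where "j = nat (\<lceil>x * 2 ^ k\<rceil> - 1)"
      have p: "0 < x * 2 ^ k" using x0 by simp
      have j: "real j < x * 2 ^ k" "x * 2 ^ k \<le> real j + 1"
        using p unfolding j_def by linarith+
      have "x * 2 ^ k < real k * 2 ^ k" using K1 k(2) by (intro mult_strict_right_mono) auto
      with j(1) have "real j < real k * 2 ^ k" by (rule less_trans)
      also have "\<dots> = real (k * 2 ^ k)" by simp
      finally have jk: "j < k * 2 ^ k" by linarith
      have xI: "x \<in> I k j" using j by (simp add: I_def field_simps)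
      have "I k j \<subseteq> ball x e"
      proof
        fix y assume y: "y \<in> I k j"
        have "\<bar>x - y\<bar> < (real j + 1) / 2 ^ k - real j / 2 ^ k"
          using xI y unfolding I_def by auto
        also have "\<dots> = (1/2) ^ k" by (simp add: diff_divide_distrib[symmetric] power_divide)
        finally show "y \<in> ball x e" using k(1) by (simp add: dist_real_def)
      qed
      then show "x \<in> W k" using e jk xI by (auto simp: W_def J_def)
    qed
  qed
  have Wle: "emeasure \<nu> (W k) \<le> liminf (\<lambda>n. emeasure (\<mu> n) U)" for k
  proof -
    have "emeasure \<nu> (W k) \<le> (\<Sum>j\<in>J k. emeasure \<nu> (I k j))"
      unfolding W_def using Is sets fin by (intro emeasure_subadditive_finite) auto
    also have "(\<lambda>n. \<Sum>j\<in>J k. emeasure (\<mu> n) (I k j)) \<longlonglongrightarrow> (\<Sum>j\<in>J k. emeasure \<nu> (I k j))"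
      unfolding I_def by (intro tendsto_sum lim) (auto intro: divide_right_mono)
    then have "(\<Sum>j\<in>J k. emeasure \<nu> (I k j)) = liminf (\<lambda>n. \<Sum>j\<in>J k. emeasure (\<mu> n) (I k j))"
      by (simp add: lim_imp_Liminf)
    also have "\<dots> \<le> liminf (\<lambda>n. emeasure (\<mu> n) U)"
    proof (intro Liminf_mono always_eventually allI)
      fix n
      have disj: "disjoint_family_on (I k) (J k)"
        unfolding disjoint_family_on_def
      proof (intro ballI impI)
        fix i j :: nat assume "i \<noteq> j"
        have "False" if y: "y \<in> I k i" "y \<in> I k j" for y
        proof -
          have "real i < y * 2 ^ k" "y * 2 ^ k \<le> real i + 1" "real j < y * 2 ^ k" "y * 2 ^ k \<le> real j + 1"
            using y by (auto simp: I_def field_simps)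
          then show False using \<open>i \<noteq> j\<close> by linarith
        qed
        then show "I k i \<inter> I k j = {}" by blast
      qed
      have "(\<Sum>j\<in>J k. emeasure (\<mu> n) (I k j)) = emeasure (\<mu> n) (W k)"
        unfolding W_def by (rule sum_emeasure[OF _ disj]) (use Is sets fin in auto)
      also have "\<dots> \<le> emeasure (\<mu> n) U"
        using W U sets by (intro emeasure_mono) auto
      finally show "(\<Sum>j\<in>J k. emeasure (\<mu> n) (I k j)) \<le> emeasure (\<mu> n) U" .
    qed
    finally show ?thesis .
  qed
  have Wm: "W k \<in> sets \<nu>" for k unfolding W_def sets using Is fin by (intro sets.finite_UN) auto
  have "emeasure \<nu> U = (\<integral>\<^sup>+x. indicator U x \<partial>\<nu>)"
    by (rule nn_integral_indicator[symmetric]) (use U(1) sets(1) in simp)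
  \<comment> \<open>Each point of \<open>U\<close> lies in \<open>W k\<close> for all large
    \<open>k\<close>, so Fatou's lemma in \<open>k\<close> concludes.\<close>
  also have "\<dots> \<le> (\<integral>\<^sup>+x. liminf (\<lambda>k. indicator (W k) x) \<partial>\<nu>)"
  proof (intro nn_integral_mono)
    fix x
    show "indicator U x \<le> liminf (\<lambda>k. indicator (W k) x :: ennreal)"
    proof (cases "x \<in> U")
      case True
      have "eventually (\<lambda>k. 1 \<le> (indicator (W k) x :: ennreal)) sequentially"
        using ev[OF True] by (rule eventually_mono) simp
      then have "1 \<le> liminf (\<lambda>k. indicator (W k) x :: ennreal)"
        by (rule Liminf_bounded)
      then show ?thesis using True by simp
    qed simp
  qed
  also have "\<dots> \<le> liminf (\<lambda>k. \<integral>\<^sup>+x. indicator (W k) x \<partial>\<nu>)"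
    using Wm by (intro nn_integral_liminf) auto
  also have "\<dots> = liminf (\<lambda>k. emeasure \<nu> (W k))" using Wm by simp
  also have "\<dots> \<le> liminf (\<lambda>k. liminf (\<lambda>n. emeasure (\<mu> n) U))"
    using Wle by (intro Liminf_mono) auto
  finally show ?thesis by (simp add: Liminf_const)
qed

section \<open>Time changes and the measure of a clock\<close>

locale time_change =
  fixes \<phi> :: "real \<Rightarrow> real"
  assumes cont: "continuous_on {0..} \<phi>" and mono: "strict_mono_on {0..} \<phi>"
    and zero: "\<phi> 0 = 0" and top: "filterlim \<phi> at_top at_top"
begin

text \<open>The expression inside \<open>liouville_bm\<close>. Under the assumptions of the locale
  it is a genuine inverse of \<open>\<phi>\<close> on the half-line.\<close>

definition inv_clock :: "real \<Rightarrow> real" where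
  "inv_clock t = Inf {s. 0 < s \<and> t < \<phi> s}"

lemma less_iff: "0 \<le> s \<Longrightarrow> 0 \<le> s' \<Longrightarrow> \<phi> s < \<phi> s' \<longleftrightarrow> s < s'"
  using strict_mono_onD[OF mono, of s s'] strict_mono_onD[OF mono, of s' s]
  by (cases s s' rule: linorder_cases) auto

lemma le_iff: "0 \<le> s \<Longrightarrow> 0 \<le> s' \<Longrightarrow> \<phi> s \<le> \<phi> s' \<longleftrightarrow> s \<le> s'"
  using less_iff[of s' s] by linarith

lemma inv_clock: "0 \<le> s \<Longrightarrow> inv_clock (\<phi> s) = s"
proof -
  assume s: "0 \<le> s"
  have "0 < r \<and> \<phi> s < \<phi> r \<longleftrightarrow> s < r" for r
    using s less_iff[of s r] by (cases "0 \<le> r") auto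
  then have "{r. 0 < r \<and> \<phi> s < \<phi> r} = {s<..}" by auto
  then show ?thesis by (simp add: inv_clock_def)
qed

lemma ex_clock:
  assumes "0 \<le> t"
  obtains s where "0 \<le> s" "\<phi> s = t"
proof -
  have "eventually (\<lambda>s. t \<le> \<phi> s \<and> 0 \<le> s) at_top"
    using top by (intro eventually_conj eventually_ge_at_top) (auto simp: filterlim_at_top)
  then obtain b where b: "t \<le> \<phi> b" "0 \<le> b" by (auto simp: eventually_at_top_linorder)
  have "\<exists>s\<ge>0. s \<le> b \<and> \<phi> s = t"
    by (rule IVT') (use b assms zero cont in \<open>auto intro: continuous_on_subset\<close>)
  then show ?thesis using that by blast
qed

lemma inv_clock_vimage:
  assumes "0 \<le> a" "a \<le> b"
  shows "inv_clock -` {a<..b} \<inter> {0..} = {\<phi> a<..\<phi> b}"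
proof (intro set_eqI)
  fix t
  show "t \<in> inv_clock -` {a<..b} \<inter> {0..} \<longleftrightarrow> t \<in> {\<phi> a<..\<phi> b}"
  proof (cases "0 \<le> t")
    case True
    then obtain s where s: "0 \<le> s" "\<phi> s = t" by (rule ex_clock)
    have "inv_clock t = s" using inv_clock[OF s(1)] s(2) by simp
    moreover have "\<phi> a < t \<longleftrightarrow> a < s" "t \<le> \<phi> b \<longleftrightarrow> s \<le> b"
      using assms s less_iff[of a s] le_iff[of s b] by simp_all
    ultimately show ?thesis using True by simp
  next
    case False
    moreover have "0 \<le> \<phi> a" using less_iff[of a 0] assms zero by force
    ultimately show ?thesis by auto
  qed
qed

lemma inv_clock_pos: "0 < t \<Longrightarrow> 0 < inv_clock t"
proof -
  assume t: "0 < t"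
  then obtain s where s: "0 \<le> s" "\<phi> s = t" using ex_clock[of t] by auto
  then have "s \<noteq> 0" using t zero by auto
  with s inv_clock[of s] show ?thesis by simp
qed

lemma inv_clock_mono: "mono_on {0..} inv_clock"
proof (rule mono_onI)
  fix r t :: real assume rt: "r \<in> {0..}" "t \<in> {0..}" "r \<le> t"
  obtain u where "0 \<le> u" "\<phi> u = r" using ex_clock[of r] rt by auto
  moreover obtain v where "0 \<le> v" "\<phi> v = t" using ex_clock[of t] rt by auto
  ultimately show "inv_clock r \<le> inv_clock t"
    using inv_clock[of u] inv_clock[of v] le_iff[of u v] rt by simp
qed

lemma inv_clock_measurable[measurable]: "inv_clock \<in> borel_measurable (restrict_space lborel {0..})"
proof -
  have "inv_clock \<in> borel_measurable (restrict_space borel {0..})"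
    by (rule borel_measurable_mono_on_fnc[OF inv_clock_mono])
  moreover have "sets (restrict_space lborel {0::real..}) = sets (restrict_space borel {0..})"
    by (intro sets_restrict_space_cong) simp
  ultimately show ?thesis by (simp cong: measurable_cong_sets)
qed

text \<open>The Stieltjes measure of \<open>\<phi>\<close>, realised as an image of Lebesgue
  measure: the mass of \<open>E\<close> is then by construction the time that the Liouville motion
  spends while its Brownian time lies in \<open>E\<close>.\<close>

definition clock_measure :: "real measure" where
  "clock_measure = distr (restrict_space lborel {0..}) borel inv_clock"

lemma sets_clock_measure[simp]: "sets clock_measure = sets borel"
  by (simp add: clock_measure_def)

lemma emeasure_clock_measure:
  "E \<in> sets borel \<Longrightarrow> emeasure clock_measure E = emeasure lborel (inv_clock -` E \<inter> {0..})"
  unfolding clock_measure_def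
  by (subst emeasure_distr) (auto simp: space_restrict_space emeasure_restrict_space Int_commute)

lemma emeasure_clock_measure_Ioc:
  "0 \<le> a \<Longrightarrow> a \<le> b \<Longrightarrow> emeasure clock_measure {a<..b} = ennreal (\<phi> b - \<phi> a)"
proof -
  assume ab: "0 \<le> a" "a \<le> b"
  then have "\<phi> a \<le> \<phi> b" using le_iff[of a b] by simp
  then show ?thesis using ab by (simp add: emeasure_clock_measure inv_clock_vimage)
qed

end

text \<open>Borel-Cantelli: along the chosen subsequence the error exceeds
  \<open>1 / (i + 1)\<close> somewhere on \<open>[0, i]\<close> with probability below
  \<open>(1/2) ^ i\<close>. Starting from an arbitrary \<open>r\<close> allows the extraction to
  take place inside a subsequence selected for another purpose.\<close>

lemma (in prob_space) in_probability_AE_subseq: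
  fixes G :: "nat \<Rightarrow> real \<Rightarrow> 'a \<Rightarrow> real" and r :: "nat \<Rightarrow> nat"
  assumes G: "\<And>n t. 0 \<le> t \<Longrightarrow> G n t \<in> borel_measurable M"
      "\<And>n b. b \<in> space M \<Longrightarrow> continuous_on {0..} (\<lambda>t. G n t b)"
    and H: "\<And>t. 0 \<le> t \<Longrightarrow> H t \<in> borel_measurable M" "AE b in M. continuous_on {0..} (\<lambda>t. H t b)"
    and lim: "\<And>T \<epsilon>. 0 \<le> T \<Longrightarrow> 0 < \<epsilon> \<Longrightarrow>
      (\<lambda>n. measure (completion M) {b \<in> space M. \<exists>t\<in>{0..T}. \<epsilon> < \<bar>G n t b - H t b\<bar>}) \<longlonglongrightarrow> 0"
    and r: "strict_mono r"
  shows "\<exists>s. strict_mono s \<and> (AE b in M. \<forall>t\<ge>0. (\<lambda>i. G (r (s i)) t b) \<longlonglongrightarrow> H t b)"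
proof -
  \<comment> \<open>A countable dense set of times turns the existential quantifier over
    \<open>[0, T]\<close> into a measurable event; continuity in time shows that nothing is lost
    outside a null set.\<close>
  define C where "C T = (SOME C. countable C \<and> C \<subseteq> {0..T} \<and> {0..T} \<subseteq> closure C)" for T :: real
  have C: "countable (C T)" "C T \<subseteq> {0..T}" "{0..T} \<subseteq> closure (C T)" for T
  proof -
    obtain C' where "countable C'" "C' \<subseteq> {0..T}" "{0..T} \<subseteq> closure C'"
      using separable[of "{0..T}"] by blast
    then have "\<exists>C. countable C \<and> C \<subseteq> {0..T} \<and> {0..T} \<subseteq> closure C" by blast
    then have "countable (C T) \<and> C T \<subseteq> {0..T} \<and> {0..T} \<subseteq> closure (C T)"
      unfolding C_def by (rule someI_ex)
    then show "countable (C T)" "C T \<subseteq> {0..T}" "{0..T} \<subseteq> closure (C T)" by auto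
  qed
  define bad where "bad T \<epsilon> n = {b \<in> space M. \<exists>t\<in>C T. \<epsilon> < \<bar>G n t b - H t b\<bar>}" for T \<epsilon> n
  have bad[measurable]: "bad T \<epsilon> n \<in> sets M" for T \<epsilon> n
    unfolding bad_def
  proof (rule sets.sets_Collect_countable_Ex'[OF _ C(1)])
    fix t assume "t \<in> C T"
    then have "0 \<le> t" using C(2)[of T] by auto
    note G(1)[OF this, measurable] H(1)[OF this, measurable]
    show "{b \<in> space M. \<epsilon> < \<bar>G n t b - H t b\<bar>} \<in> sets M" by measurable
  qed
  have bad_iff: "b \<in> bad T \<epsilon> n \<longleftrightarrow> (\<exists>t\<in>{0..T}. \<epsilon> < \<bar>G n t b - H t b\<bar>)"
    if b: "b \<in> space M" "continuous_on {0..} (\<lambda>t. H t b)" for b T \<epsilon> n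
  proof
    assume "\<exists>t\<in>{0..T}. \<epsilon> < \<bar>G n t b - H t b\<bar>"
    then obtain t where t: "t \<in> {0..T}" "\<epsilon> < \<bar>G n t b - H t b\<bar>" by blast
    show "b \<in> bad T \<epsilon> n"
    proof (rule ccontr)
      assume "b \<notin> bad T \<epsilon> n"
      then have le: "\<bar>G n s b - H s b\<bar> \<le> \<epsilon>" if "s \<in> C T" for s using b that by (auto simp: bad_def)
      obtain q where q: "\<And>k. q k \<in> C T" "q \<longlonglongrightarrow> t"
        using t(1) C(3)[of T] closure_sequential by blast
      have q0: "\<And>k. q k \<in> {0..}" using q(1) C(2) by force
      have "continuous_on {0..} (\<lambda>t. \<bar>G n t b - H t b\<bar>)"
        using G(2)[OF b(1)] b(2) by (intro continuous_intros)
      then have "(\<lambda>k. \<bar>G n (q k) b - H (q k) b\<bar>) \<longlonglongrightarrow> \<bar>G n t b - H t b\<bar>"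
        using q(2) q0 t(1) unfolding continuous_on_sequentially by (auto simp: comp_def)
      then have "\<bar>G n t b - H t b\<bar> \<le> \<epsilon>"
        using le q(1) by (intro LIMSEQ_le_const2) auto
      then show False using t(2) by simp
    qed
  qed (use C(2) b in \<open>auto simp: bad_def\<close>)
  \<comment> \<open>The event with all times differs from \<open>bad\<close> by a null set only; so
    it is measurable for the completion, with the same probability.\<close>
  have meas: "measure (completion M) {b \<in> space M. \<exists>t\<in>{0..T}. \<epsilon> < \<bar>G n t b - H t b\<bar>} = prob (bad T \<epsilon> n)" for T \<epsilon> n
  proof -
    have ae: "AE b in completion M. b \<in> bad T \<epsilon> n \<longleftrightarrow> b \<in> {b \<in> space M. \<exists>t\<in>{0..T}. \<epsilon> < \<bar>G n t b - H t b\<bar>}"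
      using H(2) unfolding AE_completion_iff by (rule AE_mp) (intro AE_I2 impI, simp add: bad_iff)
    have "{b \<in> space M. \<exists>t\<in>{0..T}. \<epsilon> < \<bar>G n t b - H t b\<bar>} \<in> sets (completion M)"
      by (rule completion.in_sets_AE[OF ae]) auto
    then have "measure (completion M) {b \<in> space M. \<exists>t\<in>{0..T}. \<epsilon> < \<bar>G n t b - H t b\<bar>} = measure (completion M) (bad T \<epsilon> n)"
      using ae by (intro measure_eq_AE) auto
    then show ?thesis by simp
  qed
  have "\<exists>s. \<forall>i. prob (bad (real i) (1 / real (Suc i)) (r (s i))) < (1/2) ^ i \<and> s i < s (Suc i)"
  proof (rule dependent_nat_choice)
    have ex: "\<exists>m>k. prob (bad (real i) (1 / real (Suc i)) (r m)) < (1/2) ^ i" for i k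
    proof -
      have "(\<lambda>n. prob (bad (real i) (1 / real (Suc i)) (r n))) \<longlonglongrightarrow> 0"
        using LIMSEQ_subseq_LIMSEQ[OF lim[of "real i" "1 / real (Suc i)"] r] by (simp add: meas comp_def)
      then have "eventually (\<lambda>n. prob (bad (real i) (1 / real (Suc i)) (r n)) < (1/2) ^ i) sequentially"
        by (rule order_tendstoD) simp
      then have "eventually (\<lambda>n. prob (bad (real i) (1 / real (Suc i)) (r n)) < (1/2) ^ i \<and> k < n) sequentially"
        using eventually_gt_at_top[of k] by eventually_elim auto
      then show ?thesis by (auto dest!: eventually_happens)
    qed
    show "\<exists>x. prob (bad (real 0) (1 / real (Suc 0)) (r x)) < (1/2) ^ 0" using ex[of _ 0] by blast
    show "\<exists>y. prob (bad (real (Suc n)) (1 / real (Suc (Suc n))) (r y)) < (1/2) ^ Suc n \<and> x < y" for x n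
      using ex[of x "Suc n"] by blast
  qed
  then obtain s where s: "\<And>i. prob (bad (real i) (1 / real (Suc i)) (r (s i))) < (1/2) ^ i" "strict_mono s"
    by (auto simp: strict_mono_Suc_iff)
  have "AE b in M. eventually (\<lambda>i. b \<in> space M - bad (real i) (1 / real (Suc i)) (r (s i))) sequentially"
  proof (rule borel_cantelli_AE1)
    show "summable (\<lambda>i. prob (bad (real i) (1 / real (Suc i)) (r (s i))))"
      using s(1) by (intro summable_comparison_test'[OF summable_geometric[of "1/2"]]) (auto intro: less_imp_le)
  qed (auto simp: less_top[symmetric])
  then have "AE b in M. \<forall>t\<ge>0. (\<lambda>i. G (r (s i)) t b) \<longlonglongrightarrow> H t b"
    using H(2) AE_space
  proof eventually_elim
    fix b assume ev: "eventually (\<lambda>i. b \<in> space M - bad (real i) (1 / real (Suc i)) (r (s i))) sequentially"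
      and b: "b \<in> space M" "continuous_on {0..} (\<lambda>t. H t b)"
    show "\<forall>t\<ge>0. (\<lambda>i. G (r (s i)) t b) \<longlonglongrightarrow> H t b"
    proof (intro allI impI)
      fix t :: real assume t: "0 \<le> t"
      obtain T :: nat where T: "t \<le> real T" using real_arch_simple by blast
      have "(\<lambda>i. G (r (s i)) t b - H t b) \<longlonglongrightarrow> 0"
      proof (rule tendsto_rabs_zero_cancel, rule tendsto_sandwich[OF _ _ tendsto_const LIMSEQ_inverse_real_of_nat])
        show "eventually (\<lambda>i. \<bar>G (r (s i)) t b - H t b\<bar> \<le> inverse (real (Suc i))) sequentially"
          using ev eventually_ge_at_top[of T]
        proof eventually_elim
          fix i assume i: "b \<in> space M - bad (real i) (1 / real (Suc i)) (r (s i))" "T \<le> i"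
          then have "\<not> (\<exists>t\<in>{0..real i}. 1 / real (Suc i) < \<bar>G (r (s i)) t b - H t b\<bar>)"
            using bad_iff[OF b] by auto
          moreover have "t \<in> {0..real i}" using t T i(2) by auto
          ultimately show "\<bar>G (r (s i)) t b - H t b\<bar> \<le> inverse (real (Suc i))"
            by (auto simp: inverse_eq_divide not_less)
        qed
      qed auto
      then show "(\<lambda>i. G (r (s i)) t b) \<longlonglongrightarrow> H t b" by (simp add: LIM_zero_iff)
    qed
  qed
  with s(2) show ?thesis by blast
qed

section \<open>Liouville Brownian motion avoids null sets\<close>

text \<open>The approximate densities \<open>e n\<close> stand for \<open>exp (\<gamma> X\<^sub>n - \<gamma>\<^sup>2 E[X\<^sub>n\<^sup>2] / 2)\<close> in a fixed environment,
  \<open>H\<close> for the limiting clock.\<close>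

locale clock_limit = P: prob_space P
  for S :: "'a::euclidean_space surface" and P :: "'b measure" +
  fixes p :: "real \<Rightarrow> 'a \<Rightarrow> 'a \<Rightarrow> real" and x :: 'a and B :: "real \<Rightarrow> 'b \<Rightarrow> 'a"
    and e :: "nat \<Rightarrow> 'a \<Rightarrow> real" and H :: "real \<Rightarrow> 'b \<Rightarrow> real"
  assumes closed_pts: "closed (pts S)"
    and sets_vol: "sets (vol S) = sets (restrict_space borel (pts S))"
    and sigma_finite: "sigma_finite_measure (vol S)"
    and x: "x \<in> pts S"
    and heat: "heat_kernel S p"
    and bm: "brownian_motion S p x P B"
    and e_cont: "\<And>n. continuous_on (pts S) (e n)" and e_nonneg: "\<And>n y. 0 \<le> e n y"
    and H_measurable: "\<And>t. 0 \<le> t \<Longrightarrow> H t \<in> borel_measurable P"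
    and H_clock: "AE b in P. continuous_on {0..} (\<lambda>t. H t b) \<and> strict_mono_on {0..} (\<lambda>t. H t b) \<and>
        filterlim (\<lambda>t. H t b) at_top at_top"
    and lim: "\<And>T \<epsilon>. 0 \<le> T \<Longrightarrow> 0 < \<epsilon> \<Longrightarrow>
      (\<lambda>n. measure (completion P) {b \<in> space P. \<exists>t\<in>{0..T}.
        \<epsilon> < \<bar>(LINT r:{0..t}|lborel. e n (B r b)) - H t b\<bar>}) \<longlonglongrightarrow> 0"
begin

text \<open>Freezing the path at negative times makes it continuous on the whole line, so that joint
  measurability with \<open>lborel\<close> and openness of preimages can be used without restricting
  time.\<close>

definition path :: "real \<Rightarrow> 'b \<Rightarrow> 'a" where
  "path r b = B (max 0 r) b"

lemma path_eq: "0 \<le> r \<Longrightarrow> path r b = B r b"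
  by (simp add: path_def)

lemma B_measurable: "0 \<le> t \<Longrightarrow> B t \<in> measurable P (vol S)"
  using bm unfolding brownian_motion_def by blast

lemma B_cont: "b \<in> space P \<Longrightarrow> continuous_on {0..} (\<lambda>t. B t b)"
  using bm unfolding brownian_motion_def by blast

lemma path_measurable_vol: "path r \<in> measurable P (vol S)"
  unfolding path_def[abs_def] by (rule B_measurable) simp

lemma measurable_vol: "measurable (vol S) N = measurable (restrict_space borel (pts S)) N"
  "measurable N' (vol S) = measurable N' (restrict_space borel (pts S))"
  by (rule measurable_cong_sets[OF sets_vol refl], rule measurable_cong_sets[OF refl sets_vol])

lemma borel_vol_le: "f \<in> borel_measurable borel \<Longrightarrow> f \<in> borel_measurable (vol S)"
  unfolding measurable_vol by (rule measurable_restrict_space1)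

lemma e_measurable[measurable]: "e n \<in> borel_measurable (vol S)"
  unfolding measurable_vol by (rule borel_measurable_continuous_on_restrict[OF e_cont])

lemma path_in: "b \<in> space P \<Longrightarrow> path r b \<in> pts S"
  using measurable_space[OF path_measurable_vol] .

lemma path_cont: "b \<in> space P \<Longrightarrow> continuous_on UNIV (\<lambda>r. path r b)"
proof -
  assume "b \<in> space P"
  then have "continuous_on {0..} (\<lambda>t. B t b)" by (rule B_cont)
  then show ?thesis
    unfolding path_def by (rule continuous_on_compose2) (auto intro!: continuous_intros)
qed

lemma path_pair_measurable: "(\<lambda>z. path (snd z) (fst z)) \<in> measurable (P \<Otimes>\<^sub>M lborel) (vol S)"
proof -
  have "(\<lambda>b. path r b) \<in> borel_measurable P" for r
    by (rule measurable_compose[OF path_measurable_vol borel_vol_le]) simp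
  then have "(\<lambda>z. path (snd z) (fst z)) \<in> borel_measurable (P \<Otimes>\<^sub>M restrict_space borel UNIV)"
    by (intro measurable_pair_continuous[of UNIV "\<lambda>b r. path r b"] path_cont) auto
  moreover have "sets (P \<Otimes>\<^sub>M restrict_space borel UNIV) = sets (P \<Otimes>\<^sub>M lborel)"
    by (intro sets_pair_measure_cong) (auto simp: sets_restrict_space)
  ultimately have "(\<lambda>z. path (snd z) (fst z)) \<in> borel_measurable (P \<Otimes>\<^sub>M lborel)"
    by (simp cong: measurable_cong_sets)
  then have "(\<lambda>z. path (snd z) (fst z)) \<in> measurable (P \<Otimes>\<^sub>M lborel) (restrict_space borel (pts S))"
    by (intro measurable_restrict_space2) (auto simp: space_pair_measure path_in)
  then show ?thesis unfolding measurable_vol .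
qed

lemma e_path_cont: "b \<in> space P \<Longrightarrow> continuous_on A (\<lambda>r. e n (path r b))"
proof -
  assume b: "b \<in> space P"
  have "continuous_on A (\<lambda>r. path r b)"
    by (rule continuous_on_subset[OF path_cont[OF b]]) simp
  moreover have "(\<lambda>r. path r b) ` A \<subseteq> pts S" using path_in[OF b] by blast
  ultimately show ?thesis by (rule continuous_on_compose2[OF e_cont])
qed

definition clock :: "nat \<Rightarrow> real \<Rightarrow> 'b \<Rightarrow> real" where
  "clock n t b = (LINT r:{0..t}|lborel. e n (B r b))"

lemma clock_eq: "clock n t b = (LINT r:{0..t}|lborel. e n (path r b))"
  unfolding clock_def by (intro set_lebesgue_integral_cong) (auto simp: path_eq)

lemma e_path_integrable: "b \<in> space P \<Longrightarrow> set_integrable lborel {a..c} (\<lambda>r. e n (path r b))"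
  by (rule borel_integrable_atLeastAtMost'[OF e_path_cont])

lemma clock_measurable: "clock n t \<in> borel_measurable P"
proof -
  have "(\<lambda>z. indicator {0..t} (snd z) *\<^sub>R e n (path (snd z) (fst z))) \<in> borel_measurable (P \<Otimes>\<^sub>M lborel)"
    by (intro borel_measurable_scaleR measurable_compose[OF path_pair_measurable e_measurable]) measurable
  then show ?thesis
    unfolding clock_eq[abs_def] set_lebesgue_integral_def
    by (intro lborel.borel_measurable_lebesgue_integral) (simp add: case_prod_beta')
qed

lemma clock_cont: "b \<in> space P \<Longrightarrow> continuous_on {0..} (\<lambda>t. clock n t b)"
proof -
  assume b: "b \<in> space P"
  have eq: "clock n t b = integral {0..t} (\<lambda>r. e n (path r b))" for t
    unfolding clock_eq using e_path_integrable[OF b] by (rule set_borel_integral_eq_integral)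
  have "continuous_on {0..real T} (\<lambda>t. clock n t b)" for T :: nat
    unfolding eq
    by (intro indefinite_integral_continuous_1 integrable_continuous_real e_path_cont b)
  then have "isCont (\<lambda>t. clock n (max 0 t) b) t" for t :: real
  proof -
    obtain T :: nat where T: "t < real T" using reals_Archimedean2 by blast
    have "continuous_on {..<real T} (\<lambda>t. clock n (max 0 t) b)"
      by (rule continuous_on_compose2[OF \<open>\<And>T. continuous_on {0..real T} (\<lambda>t. clock n t b)\<close>[of T]])
        (auto intro!: continuous_intros)
    then show ?thesis using T by (simp add: continuous_on_eq_continuous_at)
  qed
  then have "continuous_on {0..} (\<lambda>t. clock n (max 0 t) b)"
    by (intro continuous_at_imp_continuous_on) auto
  then show ?thesis by (rule continuous_on_eq) auto
qed

definition approx_measure :: "nat \<Rightarrow> 'b \<Rightarrow> real measure" where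
  "approx_measure n b = density lborel (\<lambda>r. ennreal (e n (path r b)))"

lemma e_path_borel: "b \<in> space P \<Longrightarrow> (\<lambda>r. e n (path r b)) \<in> borel_measurable borel"
  by (rule borel_measurable_continuous_onI[OF e_path_cont])

lemma approx_measure_Ioc:
  assumes "b \<in> space P" "0 \<le> a" "a \<le> c"
  shows "emeasure (approx_measure n b) {a<..c} = ennreal (clock n c b - clock n a b)"
proof -
  let ?f = "\<lambda>r. e n (path r b)"
  note i = e_path_integrable[OF assms(1), of _ _ n]
  have i': "set_integrable lborel {a<..c} ?f"
    using i[of a c] by (rule set_integrable_subset) auto
  have "{0..c} = {0..a} \<union> {a<..c}" using assms by auto
  then have "clock n c b = clock n a b + (LINT r:{a<..c}|lborel. ?f r)"
    unfolding clock_eq using i i' by (simp only:) (subst set_integral_Un, auto)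
  moreover have "emeasure (approx_measure n b) {a<..c} = ennreal (LINT r:{a<..c}|lborel. ?f r)"
    unfolding approx_measure_def set_lebesgue_integral_def
    using i' e_path_borel[OF assms(1), of n] e_nonneg
    by (subst emeasure_density)
      (auto simp: set_integrable_def indicator_def nn_integral_eq_integral[symmetric] intro!: nn_integral_cong)
  ultimately show ?thesis by simp
qed

text \<open>That the limiting clock starts at 0 is not part of its description. It follows from
  almost sure convergence along a subsequence, as every approximate clock is 0 at time 0.\<close>

lemma time_change_AE: "AE b in P. time_change (\<lambda>t. H t b)"
proof -
  obtain s where s: "strict_mono s" "AE b in P. \<forall>t\<ge>0. (\<lambda>i. clock (s i) t b) \<longlonglongrightarrow> H t b"
    using P.in_probability_AE_subseq[of clock H id] clock_measurable clock_cont H_measurable H_clock lim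
    by (auto simp: clock_def[symmetric] strict_mono_def)
  from s(2) H_clock show ?thesis
  proof eventually_elim
    case (elim b)
    have "clock n 0 b = 0" for n
      unfolding clock_def set_lebesgue_integral_def
      by (intro integral_eq_zero_AE) (auto intro: AE_I'[of "{0}"] simp: null_sets_def)
    then have "H 0 b = 0" using elim by (auto simp: LIMSEQ_const_iff)
    with elim show ?case by unfold_locales auto
  qed
qed

text \<open>The continuous transition density is bounded on the compact set of times in
  \<open>[\<delta>, T]\<close> and points of a closed ball. The constant precedes \<open>r\<close>
  and \<open>f\<close>, so it survives integration over time and limits of functions.\<close>

lemma law_bound:
  assumes "0 < \<delta>"
  obtains C where "0 \<le> C" "\<And>r (f :: 'a \<Rightarrow> ennreal). \<delta> \<le> r \<Longrightarrow> r \<le> T \<Longrightarrow> f \<in> borel_measurable (vol S) \<Longrightarrow>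
    (\<And>y. y \<notin> ball 0 R \<Longrightarrow> f y = 0) \<Longrightarrow>
    (\<integral>\<^sup>+b. f (path r b) \<partial>P) \<le> ennreal C * (\<integral>\<^sup>+y. f y \<partial>vol S)"
proof -
  let ?K = "{\<delta>..T} \<times> {x} \<times> (pts S \<inter> cball 0 R)"
  have pc: "continuous_on ({0<..} \<times> pts S \<times> pts S) (\<lambda>(t, x, y). p t x y)"
    using heat by (simp add: heat_kernel_def)
  have "compact ?K"
    by (intro compact_Times compact_Icc closed_Int_compact closed_pts) auto
  moreover have "continuous_on ?K (\<lambda>(t, x, y). p t x y)"
    by (rule continuous_on_subset[OF pc]) (use assms x in auto)
  ultimately have "bounded ((\<lambda>(t, x, y). p t x y) ` ?K)"
    using compact_continuous_image compact_imp_bounded by blast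
  then obtain C where C: "0 < C" "\<And>z. z \<in> ?K \<Longrightarrow> \<bar>(\<lambda>(t, x, y). p t x y) z\<bar> \<le> C"
    unfolding bounded_pos by auto
  show ?thesis
  proof
    show "0 \<le> C" using C by simp
    fix r and f :: "'a \<Rightarrow> ennreal" assume r: "\<delta> \<le> r" "r \<le> T" and f[measurable]: "f \<in> borel_measurable (vol S)"
      and f0: "\<And>y. y \<notin> ball 0 R \<Longrightarrow> f y = 0"
    have r0: "0 < r" using assms r by simp
    have "continuous_on (pts S) (\<lambda>y. p r x y)"
    proof -
      have "continuous_on (pts S) (\<lambda>y. (\<lambda>(t, x, y). p t x y) (r, x, y))"
        by (rule continuous_on_compose2[OF pc]) (use r0 x in \<open>auto intro!: continuous_intros\<close>)
      then show ?thesis by simp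
    qed
    then have "(\<lambda>y. p r x y) \<in> borel_measurable (restrict_space borel (pts S))"
      by (rule borel_measurable_continuous_on_restrict)
    then have pm[measurable]: "(\<lambda>y. p r x y) \<in> borel_measurable (vol S)"
      unfolding measurable_vol .
    have law: "distr P (vol S) (path r) = density (vol S) (\<lambda>y. ennreal (p r x y))"
    proof (rule measure_eqI)
      fix A assume "A \<in> sets (distr P (vol S) (path r))"
      then have A: "A \<in> sets (vol S)" by simp
      \<comment> \<open>A list with a single entry extracts the law at time \<open>r\<close> from
        the finite-dimensional distributions.\<close>
      have "emeasure P {w \<in> space P. \<forall>i<length [(r, A)].
            B (\<Sum>j\<le>i. fst ([(r, A)] ! j)) w \<in> snd ([(r, A)] ! i)} = fdd S p x [(r, A)]"
        using bm A r0 unfolding brownian_motion_def by (elim conjE allE[of _ "[(r, A)]"]) simp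
      then have "emeasure P {w \<in> space P. path r w \<in> A} = (\<integral>\<^sup>+y. ennreal (p r x y) * indicator A y \<partial>vol S)"
        using r0 by (simp add: path_eq)
      then show "emeasure (distr P (vol S) (path r)) A = emeasure (density (vol S) (\<lambda>y. ennreal (p r x y))) A"
        using A by (simp add: emeasure_distr path_measurable_vol emeasure_density vimage_def Int_def conj_commute)
    qed simp
    have "(\<integral>\<^sup>+b. f (path r b) \<partial>P) = (\<integral>\<^sup>+y. f y \<partial>distr P (vol S) (path r))"
      by (subst nn_integral_distr[OF path_measurable_vol]) auto
    also have "\<dots> = (\<integral>\<^sup>+y. ennreal (p r x y) * f y \<partial>vol S)"
      unfolding law by (rule nn_integral_density) auto
    also have "\<dots> \<le> (\<integral>\<^sup>+y. ennreal C * f y \<partial>vol S)"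
    proof (intro nn_integral_mono)
      fix y assume y: "y \<in> pts S"
      show "ennreal (p r x y) * f y \<le> ennreal C * f y"
      proof (cases "y \<in> ball 0 R")
        case True
        then have "p r x y \<le> C" using C(2)[of "(r, x, y)"] r y by auto
        then show ?thesis by (intro mult_right_mono ennreal_leI) auto
      qed (simp add: f0)
    qed
    also have "\<dots> = ennreal C * (\<integral>\<^sup>+y. f y \<partial>vol S)" by (intro nn_integral_cmult) auto
    finally show "(\<integral>\<^sup>+b. f (path r b) \<partial>P) \<le> ennreal C * (\<integral>\<^sup>+y. f y \<partial>vol S)" .
  qed
qed

text \<open>The time window is open, so that the visits to a relatively open set form an open set of
  times.\<close>

definition visits :: "real \<Rightarrow> real \<Rightarrow> 'a set \<Rightarrow> 'b \<Rightarrow> real set" where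
  "visits \<delta> T A b = {r \<in> {\<delta><..<T}. path r b \<in> A}"

lemma open_visits:
  assumes "b \<in> space P" "openin (top_of_set (pts S)) A"
  shows "open (visits \<delta> T A b)"
proof -
  obtain U where U: "open U" "A = pts S \<inter> U" using assms(2) by (auto simp: openin_open)
  have "visits \<delta> T A b = {\<delta><..<T} \<inter> ((\<lambda>r. path r b) -` U)"
    using assms(1) U by (auto simp: visits_def path_in)
  then show ?thesis
    using open_vimage[OF U(1) path_cont[OF assms(1)]] by auto
qed

text \<open>\<open>Y\<close> is a measurable majorant of the clock mass, which spares a proof that
  the latter is measurable in \<open>b\<close>. It is the lower limit of the approximate clock
  masses along a subsequence; Fatou's lemma, Tonelli's theorem and the density bound control its
  mean. The constant precedes \<open>A\<close>, as infinitely many sets are going to be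
  inserted.\<close>

lemma visits_bound:
  assumes "0 < \<delta>"
  obtains C where "0 \<le> C" "\<And>A. openin (top_of_set (pts S)) A \<Longrightarrow> A \<subseteq> ball 0 R \<Longrightarrow>
    \<exists>Y\<in>borel_measurable P.
      (AE b in P. emeasure (time_change.clock_measure (\<lambda>t. H t b)) (visits \<delta> T A b) \<le> Y b) \<and>
      (\<integral>\<^sup>+b. Y b \<partial>P) \<le> ennreal C * liminf (\<lambda>n. \<integral>\<^sup>+y. ennreal (e n y) * indicator A y \<partial>vol S)"
proof -
  obtain C0 where C0: "0 \<le> C0" "\<And>r (f :: 'a \<Rightarrow> ennreal). \<delta> \<le> r \<Longrightarrow> r \<le> T \<Longrightarrow> f \<in> borel_measurable (vol S) \<Longrightarrow>
    (\<And>y. y \<notin> ball 0 R \<Longrightarrow> f y = 0) \<Longrightarrow>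
    (\<integral>\<^sup>+b. f (path r b) \<partial>P) \<le> ennreal C0 * (\<integral>\<^sup>+y. f y \<partial>vol S)"
    using law_bound[OF assms] by blast
  show ?thesis
  proof
    \<comment> \<open>The density bound times the length of the time window, the maximum covering an
      empty window.\<close>
    let ?C = "C0 * max 0 (T - \<delta>)"
    show "0 \<le> ?C" using C0 by simp
    fix A assume A: "openin (top_of_set (pts S)) A" "A \<subseteq> ball 0 R"
    then have AD: "A \<subseteq> pts S" using openin_imp_subset by blast
    have Am[measurable]: "A \<in> sets (vol S)"
      using A unfolding sets_vol sets_restrict_space openin_open by auto
    define c where "c n = (\<integral>\<^sup>+y. ennreal (e n y) * indicator A y \<partial>vol S)" for n
    \<comment> \<open>The first subsequence realises the lower limit of the masses; only inside it
      is a further one extracted for almost sure convergence. This is why the final bound involves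
      the lower limit of the whole sequence.\<close>
    obtain r where r: "strict_mono r" "(c \<circ> r) \<longlonglongrightarrow> liminf c" using liminf_subseq_lim by auto
    obtain s where s: "strict_mono s" "AE b in P. \<forall>t\<ge>0. (\<lambda>i. clock (r (s i)) t b) \<longlonglongrightarrow> H t b"
      using P.in_probability_AE_subseq[of clock H r] clock_measurable clock_cont H_measurable H_clock lim r(1)
      by (auto simp: clock_def[symmetric])
    define g where "g n b t = ennreal (e n (path t b)) * indicator A (path t b) * indicator {\<delta><..<T} t" for n b t
    define Y where "Y b = liminf (\<lambda>i. \<integral>\<^sup>+t. g (r (s i)) b t \<partial>lborel)" for b
    have gm: "(\<lambda>z. g n (fst z) (snd z)) \<in> borel_measurable (P \<Otimes>\<^sub>M lborel)" for n
      unfolding g_def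
      by (intro borel_measurable_times_ennreal measurable_compose[OF path_pair_measurable]) measurable
    have gim[measurable]: "(\<lambda>b. \<integral>\<^sup>+t. g n b t \<partial>lborel) \<in> borel_measurable P" for n
      using gm by (intro lborel.borel_measurable_nn_integral) (simp add: case_prod_beta')
    have Ym: "Y \<in> borel_measurable P" unfolding Y_def by measurable
    have gi: "(\<integral>\<^sup>+t. g n b t \<partial>lborel) = emeasure (approx_measure n b) (visits \<delta> T A b)" if b: "b \<in> space P" for n b
      unfolding approx_measure_def using open_visits[OF b A(1)] e_path_borel[OF b, of n]
      by (subst emeasure_density) (auto simp: g_def visits_def indicator_def intro!: nn_integral_cong)
    have le: "AE b in P. emeasure (time_change.clock_measure (\<lambda>t. H t b)) (visits \<delta> T A b) \<le> Y b"
      using s(2) time_change_AE AE_space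
    proof eventually_elim
      case (elim b)
      interpret time_change "\<lambda>t. H t b" by (rule elim(2))
      have "emeasure clock_measure (visits \<delta> T A b) \<le> liminf (\<lambda>i. emeasure (approx_measure (r (s i)) b) (visits \<delta> T A b))"
      proof (rule emeasure_open_le_liminf)
        show "sets (approx_measure (r (s n)) b) = sets borel" for n by (simp add: approx_measure_def)
        show "open (visits \<delta> T A b)" by (rule open_visits[OF elim(3) A(1)])
        show "visits \<delta> T A b \<subseteq> {0<..}" using assms by (auto simp: visits_def)
        fix a b' :: real assume ab: "0 \<le> a" "a \<le> b'"
        show "(\<lambda>n. emeasure (approx_measure (r (s n)) b) {a<..b'}) \<longlonglongrightarrow> emeasure clock_measure {a<..b'}"
          unfolding approx_measure_Ioc[OF elim(3) ab] emeasure_clock_measure_Ioc[OF ab]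
          using elim(1) ab by (intro tendsto_ennrealI tendsto_diff) auto
      qed simp
      also have "\<dots> = Y b" unfolding Y_def gi[OF elim(3)] ..
      finally show ?case .
    qed
    have gb: "(\<integral>\<^sup>+b. \<integral>\<^sup>+t. g n b t \<partial>lborel \<partial>P) \<le> ennreal ?C * c n" for n
    proof -
      interpret pair_sigma_finite P lborel ..
      have "(\<integral>\<^sup>+b. \<integral>\<^sup>+t. g n b t \<partial>lborel \<partial>P) = (\<integral>\<^sup>+t. \<integral>\<^sup>+b. g n b t \<partial>P \<partial>lborel)"
        using gm by (intro Fubini'[symmetric]) (simp add: case_prod_beta')
      also have "\<dots> \<le> (\<integral>\<^sup>+t. ennreal C0 * c n * indicator {\<delta><..<T} t \<partial>lborel)"
      proof (intro nn_integral_mono)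
        fix t :: real
        show "(\<integral>\<^sup>+b. g n b t \<partial>P) \<le> ennreal C0 * c n * indicator {\<delta><..<T} t"
        proof (cases "t \<in> {\<delta><..<T}")
          case True
          then have "(\<integral>\<^sup>+b. g n b t \<partial>P) = (\<integral>\<^sup>+b. (\<lambda>y. ennreal (e n y) * indicator A y) (path t b) \<partial>P)"
            by (simp add: g_def)
          also have "\<dots> \<le> ennreal C0 * c n"
            unfolding c_def using True A(2) by (intro C0(2)) (auto simp: indicator_def)
          finally show ?thesis using True by simp
        qed (simp add: g_def)
      qed
      also have "\<dots> = ennreal C0 * c n * emeasure lborel {\<delta><..<T}"
        by (rule nn_integral_cmult_indicator) simp
      also have "emeasure lborel {\<delta><..<T} = ennreal (max 0 (T - \<delta>))"
        by (cases "\<delta> \<le> T") auto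
      finally show ?thesis using C0 by (simp add: ennreal_mult mult_ac)
    qed
    have "(\<integral>\<^sup>+b. Y b \<partial>P) \<le> liminf (\<lambda>i. \<integral>\<^sup>+b. \<integral>\<^sup>+t. g (r (s i)) b t \<partial>lborel \<partial>P)"
      unfolding Y_def by (intro nn_integral_liminf) measurable
    also have "\<dots> \<le> liminf (\<lambda>i. ennreal ?C * c (r (s i)))"
      by (intro Liminf_mono always_eventually allI gb)
    also have "\<dots> = ennreal ?C * liminf c"
    proof (rule lim_imp_Liminf)
      have "(\<lambda>i. c (r (s i))) \<longlonglongrightarrow> liminf c"
        using LIMSEQ_subseq_LIMSEQ[OF r(2) s(1)] by (simp add: comp_def)
      then show "(\<lambda>i. ennreal ?C * c (r (s i))) \<longlonglongrightarrow> ennreal ?C * liminf c"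
        by (intro ennreal_tendsto_cmult) auto
    qed simp
    finally show "\<exists>Y\<in>borel_measurable P.
      (AE b in P. emeasure (time_change.clock_measure (\<lambda>t. H t b)) (visits \<delta> T A b) \<le> Y b) \<and>
      (\<integral>\<^sup>+b. Y b \<partial>P) \<le> ennreal ?C * liminf (\<lambda>n. \<integral>\<^sup>+y. ennreal (e n y) * indicator A y \<partial>vol S)"
      using Ym le unfolding c_def[abs_def] by blast
  qed
qed

text \<open>For each \<open>k\<close> pick an \<open>N\<close> whose masses stay below
  \<open>1 / (k + 1)\<close> for all \<open>M\<close>. The sets increase with \<open>M\<close>, so
  the clock mass of their union is at most the lower limit \<open>W k\<close> of the majorants,
  whose mean is at most \<open>C / (k + 1)\<close>. A second use of Fatou's lemma, in
  \<open>k\<close>, shows that the lower limit of the \<open>W k\<close> is almost surely 0.\<close>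

lemma visits_null:
  fixes A :: "nat \<Rightarrow> nat \<Rightarrow> 'a set"
  assumes A: "\<And>N M. openin (top_of_set (pts S)) (A N M)" "\<And>N M M'. M \<le> M' \<Longrightarrow> A N M \<subseteq> A N M'"
    and "0 < \<delta>"
    and zero: "(INF N\<in>{1::nat..}. SUP M. liminf (\<lambda>n. \<integral>\<^sup>+y. ennreal (e n y) * indicator (A N M \<inter> ball 0 R) y \<partial>vol S)) = 0"
  shows "AE b in P. emeasure (time_change.clock_measure (\<lambda>t. H t b))
    (visits \<delta> T (\<Inter>N\<in>{1..}. \<Union>M. A N M \<inter> ball 0 R) b) = 0"
proof -
  let ?\<Lambda> = "\<lambda>N M. liminf (\<lambda>n. \<integral>\<^sup>+y. ennreal (e n y) * indicator (A N M \<inter> ball 0 R) y \<partial>vol S)"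
  let ?\<nu> = "\<lambda>b. time_change.clock_measure (\<lambda>t. H t b)"
  have A': "openin (top_of_set (pts S)) (A N M \<inter> ball 0 R)" for N M
    using A(1) by (intro openin_Int_open) auto
  obtain C where C: "0 \<le> C" "\<And>A. openin (top_of_set (pts S)) A \<Longrightarrow> A \<subseteq> ball 0 R \<Longrightarrow>
    \<exists>Y\<in>borel_measurable P. (AE b in P. emeasure (?\<nu> b) (visits \<delta> T A b) \<le> Y b) \<and>
      (\<integral>\<^sup>+b. Y b \<partial>P) \<le> ennreal C * liminf (\<lambda>n. \<integral>\<^sup>+y. ennreal (e n y) * indicator A y \<partial>vol S)"
    using visits_bound[OF \<open>0 < \<delta>\<close>] by blast
  define Q where "Q N M Y \<longleftrightarrow> Y \<in> borel_measurable P \<and>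
    (AE b in P. emeasure (?\<nu> b) (visits \<delta> T (A N M \<inter> ball 0 R) b) \<le> Y b) \<and>
    (\<integral>\<^sup>+b. Y b \<partial>P) \<le> ennreal C * ?\<Lambda> N M" for N M Y
  have "\<exists>Y. Q N M Y" for N M
    using C(2)[OF A', of N M] unfolding Q_def by auto
  then obtain Y where Y: "Q N M (Y N M)" for N M by metis
  have Ym[measurable]: "Y N M \<in> borel_measurable P"
    and Yle: "AE b in P. emeasure (?\<nu> b) (visits \<delta> T (A N M \<inter> ball 0 R) b) \<le> Y N M b"
    and Yint: "(\<integral>\<^sup>+b. Y N M b \<partial>P) \<le> ennreal C * ?\<Lambda> N M" for N M
    using Y[of N M] unfolding Q_def by blast+
  have "\<forall>k. \<exists>N. 1 \<le> N \<and> (SUP M. ?\<Lambda> N M) < ennreal (1 / real (Suc k))"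
  proof
    fix k
    have "(INF N\<in>{1::nat..}. SUP M. ?\<Lambda> N M) < ennreal (1 / real (Suc k))" unfolding zero by simp
    then show "\<exists>N. 1 \<le> N \<and> (SUP M. ?\<Lambda> N M) < ennreal (1 / real (Suc k))"
      unfolding INF_less_iff by auto
  qed
  from choice[OF this] obtain Nk
    where Nk': "\<forall>k. 1 \<le> Nk k \<and> (SUP M. ?\<Lambda> (Nk k) M) < ennreal (1 / real (Suc k))" ..
  then have Nk: "1 \<le> Nk k" "(SUP M. ?\<Lambda> (Nk k) M) < ennreal (1 / real (Suc k))" for k
    by (rule allE[of _ k], simp)+
  define W where "W k b = liminf (\<lambda>M. Y (Nk k) M b)" for k b
  have Wm[measurable]: "W k \<in> borel_measurable P" for k unfolding W_def by measurable
  have Wint: "(\<integral>\<^sup>+b. W k b \<partial>P) \<le> ennreal C * ennreal (1 / real (Suc k))" for k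
  proof -
    have "(\<integral>\<^sup>+b. W k b \<partial>P) \<le> liminf (\<lambda>M. \<integral>\<^sup>+b. Y (Nk k) M b \<partial>P)"
      unfolding W_def by (intro nn_integral_liminf) measurable
    also have "\<dots> \<le> liminf (\<lambda>M::nat. ennreal C * ennreal (1 / real (Suc k)))"
    proof (intro Liminf_mono always_eventually allI)
      fix M
      have "?\<Lambda> (Nk k) M \<le> (SUP M. ?\<Lambda> (Nk k) M)" by (rule SUP_upper) simp
      then have "?\<Lambda> (Nk k) M \<le> ennreal (1 / real (Suc k))" using Nk(2)[of k] by (meson le_less_trans less_imp_le)
      then show "(\<integral>\<^sup>+b. Y (Nk k) M b \<partial>P) \<le> ennreal C * ennreal (1 / real (Suc k))"
        using Yint[of "Nk k" M] by (meson mult_left_mono order_trans zero_le)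
    qed
    finally show ?thesis by (simp add: Liminf_const)
  qed
  have "(\<integral>\<^sup>+b. liminf (\<lambda>k. W k b) \<partial>P) \<le> liminf (\<lambda>k. \<integral>\<^sup>+b. W k b \<partial>P)"
    by (intro nn_integral_liminf) measurable
  also have "\<dots> \<le> liminf (\<lambda>k. ennreal C * ennreal (1 / real (Suc k)))"
    by (intro Liminf_mono always_eventually allI Wint)
  also have "\<dots> = 0"
  proof (rule lim_imp_Liminf)
    have "(\<lambda>k. ennreal (C * (1 / real (Suc k)))) \<longlonglongrightarrow> ennreal (C * 0)"
      using LIMSEQ_inverse_real_of_nat by (intro tendsto_ennrealI tendsto_mult tendsto_const) (simp add: inverse_eq_divide)
    then show "(\<lambda>k. ennreal C * ennreal (1 / real (Suc k))) \<longlonglongrightarrow> 0"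
      using C(1) by (simp add: ennreal_mult'[symmetric])
  qed simp
  finally have "(\<integral>\<^sup>+b. liminf (\<lambda>k. W k b) \<partial>P) = 0" by simp
  moreover have "(\<lambda>b. liminf (\<lambda>k. W k b)) \<in> borel_measurable P" by measurable
  ultimately have "AE b in P. liminf (\<lambda>k. W k b) = 0"
    by (simp add: nn_integral_0_iff_AE)
  moreover have "AE b in P. \<forall>N M. emeasure (?\<nu> b) (visits \<delta> T (A N M \<inter> ball 0 R) b) \<le> Y N M b"
    unfolding AE_all_countable by (intro allI Yle)
  ultimately show ?thesis using time_change_AE AE_space
  proof eventually_elim
    case (elim b)
    interpret time_change "\<lambda>t. H t b" by (rule elim(3))
    let ?O = "\<lambda>N M. visits \<delta> T (A N M \<inter> ball 0 R) b"
    have Om: "?O N M \<in> sets clock_measure" for N M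
      using open_visits[OF elim(4) A'] by simp
    have "emeasure clock_measure (visits \<delta> T (\<Inter>N\<in>{1..}. \<Union>M. A N M \<inter> ball 0 R) b) \<le> W k b" for k
    proof -
      have inc: "incseq (?O (Nk k))"
      proof (rule incseq_SucI)
        fix n
        show "?O (Nk k) n \<subseteq> ?O (Nk k) (Suc n)"
          using A(2)[of n "Suc n" "Nk k"] unfolding visits_def by auto
      qed
      have "emeasure clock_measure (visits \<delta> T (\<Inter>N\<in>{1..}. \<Union>M. A N M \<inter> ball 0 R) b) \<le>
          emeasure clock_measure (\<Union>M. ?O (Nk k) M)"
      proof (rule emeasure_mono)
        show "visits \<delta> T (\<Inter>N\<in>{1..}. \<Union>M. A N M \<inter> ball 0 R) b \<subseteq> (\<Union>M. ?O (Nk k) M)"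
          using Nk(1)[of k] unfolding visits_def by blast
        show "(\<Union>M. ?O (Nk k) M) \<in> sets clock_measure"
          using Om by (intro sets.countable_UN) blast
      qed
      also have "\<dots> = liminf (\<lambda>M. emeasure clock_measure (?O (Nk k) M))"
      proof (rule lim_imp_Liminf[symmetric])
        show "(\<lambda>M. emeasure clock_measure (?O (Nk k) M)) \<longlonglongrightarrow> emeasure clock_measure (\<Union>M. ?O (Nk k) M)"
          using Om by (intro Lim_emeasure_incseq inc) blast
      qed simp
      also have "\<dots> \<le> W k b"
        unfolding W_def using elim(2) by (intro Liminf_mono always_eventually allI) blast
      finally show ?thesis .
    qed
    then have "emeasure clock_measure (visits \<delta> T (\<Inter>N\<in>{1..}. \<Union>M. A N M \<inter> ball 0 R) b) \<le> liminf (\<lambda>k. W k b)"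
      by (intro Liminf_bounded always_eventually allI)
    with elim(1) show ?case by simp
  qed
qed

text \<open>Time windows from \<open>1 / (i + 1)\<close> to \<open>i\<close> and balls of radius
  \<open>i\<close> exhaust the positive times and the surface. Since the inverse clock carries
  Lebesgue measure to the clock measure, a set of Brownian times without clock mass pulls back to a
  null set of Liouville times.\<close>

theorem liouville_bm_avoids:
  fixes A :: "nat \<Rightarrow> nat \<Rightarrow> 'a set"
  assumes A: "\<And>N M. openin (top_of_set (pts S)) (A N M)" "\<And>N M M'. M \<le> M' \<Longrightarrow> A N M \<subseteq> A N M'"
    and zero: "\<And>R::nat. (INF N\<in>{1::nat..}. SUP M. liminf (\<lambda>n. \<integral>\<^sup>+y. ennreal (e n y) * indicator (A N M \<inter> ball 0 (real R)) y \<partial>vol S)) = 0"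
  shows "AE b in P. {t \<in> {0..}. liouville_bm (\<lambda>s. H s b) (\<lambda>s. B s b) t \<in> (\<Inter>N\<in>{1..}. \<Union>M. A N M)}
    \<in> null_sets (lebesgue_on {0..})"
proof -
  let ?Z = "\<lambda>i b. visits (1 / real (Suc i)) (real i) (\<Inter>N\<in>{1..}. \<Union>M. A N M \<inter> ball 0 (real i)) b"
  have "AE b in P. \<forall>i. emeasure (time_change.clock_measure (\<lambda>t. H t b)) (?Z i b) = 0"
    unfolding AE_all_countable using visits_null[OF A _ zero] by simp
  then show ?thesis using time_change_AE AE_space
  proof eventually_elim
    case (elim b)
    interpret time_change "\<lambda>t. H t b" by (rule elim(2))
    have Zm: "?Z i b \<in> sets borel" for i
    proof -
      have "?Z i b = {1 / real (Suc i)<..<real i} \<inter> (\<Inter>N\<in>{1..}. \<Union>M. visits (1 / real (Suc i)) (real i) (A N M \<inter> ball 0 (real i)) b)"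
        by (auto simp: visits_def)
      moreover have "(\<Union>M. visits (1 / real (Suc i)) (real i) (A N M \<inter> ball 0 (real i)) b) \<in> sets borel" for N
        using open_visits[OF elim(3) openin_Int_open[OF A(1) open_ball]] by (intro borel_open open_UN) auto
      ultimately show ?thesis
        by (simp only:) (intro sets.Int sets.countable_INT'; auto simp del: of_nat_Suc)
    qed
    have "emeasure lborel (inv_clock -` ?Z i b \<inter> {0..}) = 0" for i
      unfolding emeasure_clock_measure[OF Zm, symmetric] using elim(1) by (rule spec)
    moreover have "inv_clock -` ?Z i b \<inter> {0..} \<in> sets lborel" for i
      using measurable_sets[OF inv_clock_measurable Zm[of i]]
      by (simp add: space_restrict_space sets_restrict_space_iff)
    ultimately have "(\<Union>i. inv_clock -` ?Z i b \<inter> {0..}) \<in> null_sets lborel"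
      by (intro null_sets_UN) (auto simp: null_sets_def)
    \<comment> \<open>Liouville time 0 corresponds to Brownian time 0, which lies in no window; it
      is added separately.\<close>
    then have N: "(\<Union>i. inv_clock -` ?Z i b \<inter> {0..}) \<union> {0} \<in> null_sets lborel"
      by (intro null_sets.Un) (auto simp: null_sets_def)
    have "{t \<in> {0..}. liouville_bm (\<lambda>s. H s b) (\<lambda>s. B s b) t \<in> (\<Inter>N\<in>{1..}. \<Union>M. A N M)} \<subseteq>
        (\<Union>i. inv_clock -` ?Z i b \<inter> {0..}) \<union> {0}"
    proof
      fix t assume t: "t \<in> {t \<in> {0..}. liouville_bm (\<lambda>s. H s b) (\<lambda>s. B s b) t \<in> (\<Inter>N\<in>{1..}. \<Union>M. A N M)}"
      show "t \<in> (\<Union>i. inv_clock -` ?Z i b \<inter> {0..}) \<union> {0}"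
      proof (cases "t = 0")
        case False
        then have t0: "0 < t" using t by auto
        define s where "s = inv_clock t"
        have s: "0 < s" using inv_clock_pos[OF t0] by (simp add: s_def)
        have Bs: "path s b \<in> (\<Inter>N\<in>{1..}. \<Union>M. A N M)"
          using t s by (simp add: liouville_bm_def inv_clock_def[symmetric] s_def[symmetric] path_eq)
        obtain i0 where i0: "1 / real (Suc i0) < s" using nat_approx_posE[OF s] by metis
        obtain i1 :: nat where i1: "s < real i1" using reals_Archimedean2 by blast
        obtain i2 :: nat where i2: "norm (path s b) < real i2" using reals_Archimedean2 by blast
        define i where "i = max i0 (max i1 i2)"
        have "1 / real (Suc i) \<le> 1 / real (Suc i0)" by (simp add: i_def field_simps)
        then have "s \<in> ?Z i b"
          using Bs i0 i1 i2 by (auto simp: visits_def i_def)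
        then show ?thesis using t0 by (auto simp: s_def)
      qed simp
    qed
    moreover have "negligible ((\<Union>i. inv_clock -` ?Z i b \<inter> {0..}) \<union> {0})"
      using null_sets_completionI[OF N] by (simp add: negligible_iff_null_sets)
    ultimately have "negligible {t \<in> {0..}. liouville_bm (\<lambda>s. H s b) (\<lambda>s. B s b) t \<in> (\<Inter>N\<in>{1..}. \<Union>M. A N M)}"
      by (meson negligible_subset)
    then show ?case
      by (auto simp: negligible_iff_null_sets null_sets_restrict_space)
  qed
qed

end

section \<open>Thick points under diagonal asymptotics\<close>

lemma ln_cutoff_at_top:
  assumes c: "cutoff_sequence c"
  shows "filterlim (\<lambda>n. ln (c (n + 1))) at_top sequentially"
proof -
  have c1: "c 1 = 1" and cmono: "strict_mono_on {1..} c" and cunb: "\<not> bdd_above (c ` {1..})"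
    using c unfolding cutoff_sequence_def by blast+
  have ctop: "filterlim (\<lambda>n. c (n + 1)) at_top sequentially"
    unfolding filterlim_at_top_gt[of _ _ 0]
  proof (intro allI impI)
    fix Z :: real
    obtain k where k: "1 \<le> k" "Z < c k"
      using cunb unfolding bdd_above_def by (auto simp: not_le)
    show "eventually (\<lambda>n. Z \<le> c (n + 1)) sequentially"
    proof (rule eventually_sequentiallyI)
      fix n assume "k \<le> n"
      then have "c k < c (n + 1)" using k by (intro strict_mono_onD[OF cmono]) auto
      then show "Z \<le> c (n + 1)" using k by simp
    qed
  qed
  then show ?thesis
    by (rule filterlim_compose[OF ln_at_top])
qed

text \<open>One null set of environments serves all starting points: it is determined by the
  hypothesis on the clock and by countably many tolerances \<open>1 / (j + 1)\<close> and radii,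
  before any \<open>x\<close> is chosen. The rest is deterministic: at a point outside the
  exceptional sets of all tolerances \<open>Xn k w y / V k\<close> tends to \<open>\<gamma>\<close>,
  and \<open>V\<close> may be exchanged for the logarithm.\<close>

theorem thick_points_of_setting:
  fixes S :: "'a::euclidean_space surface" and c :: "nat \<Rightarrow> real" and PX :: "'w measure" and PB :: "'a \<Rightarrow> 'b measure"
  assumes c: "cutoff_sequence c"
    and closed: "closed (pts S)" and sets_vol: "sets (vol S) = sets (restrict_space borel (pts S))"
    and fin: "\<And>R. emeasure (vol S) (pts S \<inter> ball 0 R) < \<infinity>"
    and setting: "liouville_setting S p G Gn \<gamma> PX X Xn PB B F"
    and diag: "\<And>n y. 1 \<le> n \<Longrightarrow> y \<in> pts S \<Longrightarrow> Gn n y y = V n"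
    and V: "(\<lambda>n. V n / ln (c (n + 1))) \<longlonglongrightarrow> 1"
  shows "AE w in PX. \<forall>x\<in>pts S. AE b in PB x.
    {t \<in> {0..}. liouville_bm (\<lambda>s. F w x s b) (\<lambda>s. B x s b) t \<in> pts S - thick_points S c Xn \<gamma> w}
      \<in> null_sets (lebesgue_on {0..})"
proof -
  have heat: "heat_kernel S p" and field: "field_with_cutoffs S G Gn PX X Xn"
    and bm: "\<And>x. x \<in> pts S \<Longrightarrow> brownian_motion S p x (PB x) (B x)"
    and clock: "liouville_clock S PX Xn \<gamma> PB B F"
    using setting unfolding liouville_setting_def by blast+
  note lntop = ln_cutoff_at_top[OF c]
  have Vtop: "filterlim V at_top sequentially"
  proof -
    have "filterlim (\<lambda>n. V n / ln (c (n + 1)) * ln (c (n + 1))) at_top sequentially"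
      by (rule filterlim_tendsto_pos_mult_at_top[OF V _ lntop]) simp
    moreover have "eventually (\<lambda>n. V n / ln (c (n + 1)) * ln (c (n + 1)) = V n) sequentially"
      using filterlim_at_top_dense[THEN iffD1, OF lntop, rule_format, of 0]
      by eventually_elim simp
    ultimately show ?thesis by (simp cong: filterlim_cong)
  qed
  interpret cutoff_field S PX Xn V Gn
    using field unfolding field_with_cutoffs_def
    by (intro cutoff_field.intro closed sets_vol fin diag Vtop) blast+
  let ?\<epsilon> = "\<lambda>j::nat. 1 / real (Suc j)"
  have "AE w in PX. \<forall>j R. (INF N\<in>{1..}. SUP M. liminf (\<lambda>n. off_mass \<gamma> (?\<epsilon> j) (real R) N M n w)) = 0"
    for R :: nat
    unfolding AE_all_countable by (intro allI off_mass_vanishes) simp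
  then have vanish: "AE w in PX. \<forall>j R. (INF N\<in>{1..}. SUP M. liminf (\<lambda>n. off_mass \<gamma> (?\<epsilon> j) (real R) N M n w)) = 0" .
  show ?thesis
    using vanish clock[unfolded liouville_clock_def] AE_space
  proof eventually_elim
    fix w
    assume van: "\<forall>j R. (INF N\<in>{1..}. SUP M. liminf (\<lambda>n. off_mass \<gamma> (?\<epsilon> j) (real R) N M n w)) = 0"
      and clk: "\<forall>x\<in>pts S.
        (\<forall>t\<ge>0. F w x t \<in> borel_measurable (PB x)) \<and>
        (AE b in PB x. continuous_on {0..} (\<lambda>t. F w x t b) \<and>
                       strict_mono_on {0..} (\<lambda>t. F w x t b) \<and>
                       filterlim (\<lambda>t. F w x t b) at_top at_top) \<and>
        (\<forall>T\<ge>0. \<forall>\<epsilon>>0.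
           (\<lambda>n. measure (completion (PB x))
                  {b \<in> space (PB x). \<exists>t\<in>{0..T}.
                     \<epsilon> < \<bar>approx_clock PX Xn \<gamma> n w (\<lambda>r. B x r b) t - F w x t b\<bar>}) \<longlonglongrightarrow> 0)"
      and w: "w \<in> space PX"
    show "\<forall>x\<in>pts S. AE b in PB x.
      {t \<in> {0..}. liouville_bm (\<lambda>s. F w x s b) (\<lambda>s. B x s b) t \<in> pts S - thick_points S c Xn \<gamma> w}
        \<in> null_sets (lebesgue_on {0..})"
    proof
      fix x assume x: "x \<in> pts S"
      note clkx = bspec[OF clk x]
      have pb: "prob_space (PB x)" using bm[OF x] by (simp add: brownian_motion_def)
      \<comment> \<open>Levels are shifted by one so that every \<open>e n\<close> comes from an
        actual cutoff; in the clock the expectation is \<open>V (Suc n)\<close> at every point of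
        the path.\<close>
      define e where "e n y = chaos_density \<gamma> (Suc n) w y" for n y
      interpret clock_limit S "PB x" p x "B x" e "F w x"
      proof (intro clock_limit.intro clock_limit_axioms.intro pb closed sets_vol sigma_finite_vol x heat bm[OF x])
        show "continuous_on (pts S) (e n)" for n
          unfolding e_def chaos_density_def using cont[OF _ w, of "Suc n"] by (intro continuous_intros) simp
        show "0 \<le> e n y" for n y by (simp add: e_def chaos_density_def)
        show "0 \<le> t \<Longrightarrow> F w x t \<in> borel_measurable (PB x)" for t using clkx by blast
        show "AE b in PB x. continuous_on {0..} (\<lambda>t. F w x t b) \<and> strict_mono_on {0..} (\<lambda>t. F w x t b) \<and>
            filterlim (\<lambda>t. F w x t b) at_top at_top" using clkx by blast
        fix T \<epsilon> :: real assume T: "0 \<le> T" "0 < \<epsilon>"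
        have Bin: "B x r b \<in> pts S" if "b \<in> space (PB x)" "0 \<le> r" for r b
          using bm[OF x] that unfolding brownian_motion_def by (meson measurable_space)
        have eq: "approx_clock PX Xn \<gamma> (Suc n) w (\<lambda>r. B x r b) t = (LINT r:{0..t}|lborel. e n (B x r b))"
          if "b \<in> space (PB x)" for n b t
          unfolding approx_clock_def e_def chaos_density_def
          by (intro set_lebesgue_integral_cong) (auto simp: gaussian_walk_at(3)[OF Bin[OF that]])
        have "(\<lambda>n. measure (completion (PB x)) {b \<in> space (PB x). \<exists>t\<in>{0..T}.
            \<epsilon> < \<bar>approx_clock PX Xn \<gamma> (Suc n) w (\<lambda>r. B x r b) t - F w x t b\<bar>}) \<longlonglongrightarrow> 0"
          using clkx T by (intro LIMSEQ_Suc) blast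
        then show "(\<lambda>n. measure (completion (PB x)) {b \<in> space (PB x). \<exists>t\<in>{0..T}.
            \<epsilon> < \<bar>(LINT r:{0..t}|lborel. e n (B x r b)) - F w x t b\<bar>}) \<longlonglongrightarrow> 0"
          by (simp add: eq cong: conj_cong)
      qed
      \<comment> \<open>\<open>max 1 N\<close> keeps level 0 out of the window, so that the sets are
        relatively open for every \<open>N\<close>.\<close>
      define A where "A j N M = off_slope \<gamma> (?\<epsilon> j) (max 1 N) M w" for j N M
      have "AE b in PB x. {t \<in> {0..}. liouville_bm (\<lambda>s. F w x s b) (\<lambda>s. B x s b) t \<in> (\<Inter>N\<in>{1..}. \<Union>M. A j N M)}
          \<in> null_sets (lebesgue_on {0..})" for j
      proof (rule liouville_bm_avoids)
        fix N M
        have "openin (top_of_set (pts S)) {y \<in> pts S. ?\<epsilon> j * V k < \<bar>Xn k w y - \<gamma> * V k\<bar>}" if "1 \<le> k" for k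
        proof -
          have "continuous_on (pts S) (\<lambda>y. \<bar>Xn k w y - \<gamma> * V k\<bar>)"
            using cont[OF that w] by (intro continuous_intros)
          from continuous_openin_preimage_gen[OF this open_greaterThan, of "?\<epsilon> j * V k"]
          show ?thesis by (simp add: vimage_def Int_def)
        qed
        then have "openin (top_of_set (pts S)) (\<Union>k\<in>{max 1 N..M}. {y \<in> pts S. ?\<epsilon> j * V k < \<bar>Xn k w y - \<gamma> * V k\<bar>})"
          by (intro openin_Union) auto
        moreover have "A j N M = (\<Union>k\<in>{max 1 N..M}. {y \<in> pts S. ?\<epsilon> j * V k < \<bar>Xn k w y - \<gamma> * V k\<bar>})"
          unfolding A_def off_slope_def by blast
        ultimately show "openin (top_of_set (pts S)) (A j N M)" by simp
      next
        fix N M M' :: nat assume "M \<le> M'"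
        then have "{max 1 N..M} \<subseteq> {max 1 N..M'}" by auto
        then show "A j N M \<subseteq> A j N M'" unfolding A_def off_slope_def by blast
      next
        fix R :: nat
        have "liminf (\<lambda>n. \<integral>\<^sup>+y. ennreal (e n y) * indicator (A j N M \<inter> ball 0 (real R)) y \<partial>vol S) =
            liminf (\<lambda>n. off_mass \<gamma> (?\<epsilon> j) (real R) N M n w)" if "N \<in> {1..}" for N M
        proof -
          have "max 1 N = N" using that by simp
          then show ?thesis
            using liminf_shift[of "\<lambda>n. off_mass \<gamma> (?\<epsilon> j) (real R) N M n w"]
            by (simp only: off_mass_def A_def e_def Suc_eq_plus1)
        qed
        then have "(INF N\<in>{1..}. SUP M. liminf (\<lambda>n. \<integral>\<^sup>+y. ennreal (e n y) * indicator (A j N M \<inter> ball 0 (real R)) y \<partial>vol S)) =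
            (INF N\<in>{1..}. SUP M. liminf (\<lambda>n. off_mass \<gamma> (?\<epsilon> j) (real R) N M n w))"
          by (intro INF_cong SUP_cong refl)
        also have "\<dots> = 0" using van by blast
        finally show "(INF N\<in>{1..}. SUP M. liminf (\<lambda>n. \<integral>\<^sup>+y. ennreal (e n y) * indicator (A j N M \<inter> ball 0 (real R)) y \<partial>vol S)) = 0" .
      qed
      then have "AE b in PB x. \<forall>j. {t \<in> {0..}. liouville_bm (\<lambda>s. F w x s b) (\<lambda>s. B x s b) t \<in> (\<Inter>N\<in>{1..}. \<Union>M. A j N M)}
          \<in> null_sets (lebesgue_on {0..})"
        unfolding AE_all_countable by blast
      then show "AE b in PB x. {t \<in> {0..}. liouville_bm (\<lambda>s. F w x s b) (\<lambda>s. B x s b) t \<in> pts S - thick_points S c Xn \<gamma> w}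
          \<in> null_sets (lebesgue_on {0..})"
      proof eventually_elim
        case (elim b)
        let ?Y = "liouville_bm (\<lambda>s. F w x s b) (\<lambda>s. B x s b)"
        have thick: "\<exists>j. y \<in> (\<Inter>N\<in>{1..}. \<Union>M. A j N M)" if y: "y \<in> pts S - thick_points S c Xn \<gamma> w" for y
        proof (rule ccontr)
          assume "\<not> (\<exists>j. y \<in> (\<Inter>N\<in>{1..}. \<Union>M. A j N M))"
          then have no: "\<exists>N\<ge>1. \<forall>M. y \<notin> A j N M" for j by (auto simp: Bex_def)
          have le: "\<exists>N. \<forall>k\<ge>N. \<bar>Xn k w y - \<gamma> * V k\<bar> \<le> ?\<epsilon> j * V k" for j
          proof -
            obtain N where N: "1 \<le> N" "\<And>M. y \<notin> A j N M" using no by blast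
            have "\<bar>Xn k w y - \<gamma> * V k\<bar> \<le> ?\<epsilon> j * V k" if "N \<le> k" for k
            proof (rule ccontr)
              assume "\<not> \<bar>Xn k w y - \<gamma> * V k\<bar> \<le> ?\<epsilon> j * V k"
              moreover have "k \<in> {max 1 N..k}" using that N(1) by simp
              ultimately have "y \<in> A j N k"
                using y unfolding A_def off_slope_def by (intro CollectI conjI bexI[of _ k]) (auto simp only: not_le)
              then show False using N(2) by blast
            qed
            then show ?thesis by blast
          qed
          have "(\<lambda>k. Xn k w y / V k) \<longlonglongrightarrow> \<gamma>"
          proof (rule LIMSEQ_I)
            fix r :: real assume "0 < r"
            then obtain j where j: "?\<epsilon> j < r" using nat_approx_posE by metis
            obtain N where N: "\<And>k. N \<le> k \<Longrightarrow> \<bar>Xn k w y - \<gamma> * V k\<bar> \<le> ?\<epsilon> j * V k" using le by blast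
            obtain N' where N': "\<And>k. N' \<le> k \<Longrightarrow> 1 \<le> V k"
              using Vtop unfolding filterlim_at_top eventually_sequentially by blast
            show "\<exists>no. \<forall>n\<ge>no. norm (Xn n w y / V n - \<gamma>) < r"
            proof (intro exI allI impI)
              fix n assume n: "max N N' \<le> n"
              then have v: "1 \<le> V n" using N' by simp
              have "\<bar>Xn n w y - \<gamma> * V n\<bar> < r * V n"
                using N[of n] n mult_strict_right_mono[OF j, of "V n"] v by simp
              moreover have "norm (Xn n w y / V n - \<gamma>) = \<bar>Xn n w y - \<gamma> * V n\<bar> / V n"
                using v by (simp add: field_simps abs_divide)
              ultimately show "norm (Xn n w y / V n - \<gamma>) < r" using v by (simp add: field_simps)
            qed
          qed
          then have "(\<lambda>k. Xn k w y / V k * (V k / ln (c (k + 1)))) \<longlonglongrightarrow> \<gamma> * 1"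
            using V by (intro tendsto_mult)
          moreover have "eventually (\<lambda>k. Xn k w y / V k * (V k / ln (c (k + 1))) = Xn k w y / ln (c (k + 1))) sequentially"
            using filterlim_at_top_dense[THEN iffD1, OF Vtop, rule_format, of 0]
            by eventually_elim simp
          ultimately have "(\<lambda>k. Xn k w y / ln (c (k + 1))) \<longlonglongrightarrow> \<gamma> * 1"
            by (rule Lim_transform_eventually)
          then show False using y by (simp add: thick_points_def)
        qed
        have neg: "negligible {t \<in> {0..}. ?Y t \<in> (\<Inter>N\<in>{1..}. \<Union>M. A j N M)}" for j
          using elim[rule_format, of j] by (simp add: negligible_iff_null_sets null_sets_restrict_space)
        have "negligible (\<Union>j. {t \<in> {0..}. ?Y t \<in> (\<Inter>N\<in>{1..}. \<Union>M. A j N M)})"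
          using neg by (intro negligible_countable_Union) auto
        moreover have "{t \<in> {0..}. ?Y t \<in> pts S - thick_points S c Xn \<gamma> w} \<subseteq>
            (\<Union>j. {t \<in> {0..}. ?Y t \<in> (\<Inter>N\<in>{1..}. \<Union>M. A j N M)})"
          using thick by blast
        ultimately have "negligible {t \<in> {0..}. ?Y t \<in> pts S - thick_points S c Xn \<gamma> w}"
          by (rule negligible_subset)
        then show ?case
          by (auto simp: negligible_iff_null_sets null_sets_restrict_space)
      qed
    qed
  qed
qed

section \<open>Heat kernels on compact surfaces\<close>

lemma set_integral_atLeast_FTC:
  fixes f F :: "real \<Rightarrow> real"
  assumes f: "f \<in> borel_measurable borel"
    and F: "\<And>x. a \<le> x \<Longrightarrow> (F has_real_derivative f x) (at x)"
    and nonneg: "\<And>x. a \<le> x \<Longrightarrow> 0 \<le> f x"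
    and lim: "(F \<longlongrightarrow> T) at_top"
  shows "set_integrable lborel {a..} f" "(LINT x:{a..}|lborel. f x) = T - F a"
proof -
  let ?g = "\<lambda>x. indicator {a..} x * f x"
  have nn: "(\<integral>\<^sup>+x. ennreal (?g x) \<partial>lborel) = ennreal (T - F a)"
  proof -
    have "(\<integral>\<^sup>+x. ennreal (?g x) \<partial>lborel) = (\<integral>\<^sup>+x. ennreal (f x) * indicator {a..} x \<partial>lborel)"
      by (rule nn_integral_cong) (auto simp: indicator_def)
    also have "\<dots> = ennreal (T - F a)" by (rule nn_integral_FTC_atLeast[OF f F nonneg lim])
    finally show ?thesis .
  qed
  have g0: "0 \<le> ?g x" for x using nonneg[of x] by (auto simp: indicator_def)
  have mono: "F a \<le> F x" if "a \<le> x" for x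
    by (rule DERIV_nonneg_imp_nondecreasing[OF that]) (use F nonneg in blast)
  have T: "0 \<le> T - F a"
  proof -
    have "F a \<le> T"
      by (rule tendsto_lowerbound[OF lim]) (use mono in \<open>auto simp: eventually_at_top_linorder\<close>)
    then show ?thesis by simp
  qed
  have gm: "?g \<in> borel_measurable lborel" using f by simp
  have "has_bochner_integral lborel ?g (T - F a)"
    by (rule has_bochner_integral_nn_integral[OF gm _ T nn]) (use g0 in auto)
  then show "set_integrable lborel {a..} f" "(LINT x:{a..}|lborel. f x) = T - F a"
    by (auto simp: set_integrable_def set_lebesgue_integral_def has_bochner_integral_iff)
qed

text \<open>The comparison function is \<open>pi\<close> times the planar diagonal value
  \<open>1 / (2 * pi * t)\<close>. Over \<open>[\<epsilon>, 1]\<close> it integrates to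
  \<open>ln (1 / \<epsilon>) / 2\<close>, which is \<open>ln c\<close> when
  \<open>\<epsilon> = 1 / c\<^sup>2\<close>. The error \<open>K / sqrt t\<close> is integrable at 0,
  and the part beyond 1 is a constant.\<close>

lemma tail_integral_asymp:
  fixes h :: "real \<Rightarrow> real"
  assumes cont: "continuous_on {0<..} h"
    and small: "\<And>t. 0 < t \<Longrightarrow> t \<le> 1 \<Longrightarrow> \<bar>h t - 1 / (2 * t)\<bar> \<le> K / sqrt t"
    and int: "set_integrable lborel {1..} h"
  shows "\<exists>C. \<forall>\<epsilon>\<in>{0<..1}. \<bar>(LINT t:{\<epsilon>..}|lborel. h t) - ln (1 / \<epsilon>) / 2\<bar> \<le> C"
proof (intro exI ballI)
  fix \<epsilon> :: real assume "\<epsilon> \<in> {0<..1}"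
  then have e: "0 < \<epsilon>" "\<epsilon> \<le> 1" by auto
  have K: "0 \<le> K" using small[of 1] by (simp add: abs_le_iff)
  have ch: "continuous_on {\<epsilon>..1} h"
    by (rule continuous_on_subset[OF cont]) (use e in auto)
  have ih: "set_integrable lborel {\<epsilon>..1} h"
    by (rule borel_integrable_atLeastAtMost'[OF ch])
  have ih': "set_integrable lborel {\<epsilon>..<1} h"
    by (rule set_integrable_subset[OF ih]) auto
  have "{\<epsilon>..} = {\<epsilon>..<1} \<union> {1..}" using e by auto
  then have 1: "(LINT t:{\<epsilon>..}|lborel. h t) = (LINT t:{\<epsilon>..<1}|lborel. h t) + (LINT t:{1..}|lborel. h t)"
    by (simp only:) (rule set_integral_Un[OF _ ih' int], auto)
  have "{\<epsilon>..1} = {\<epsilon>..<1} \<union> {1}" using e by auto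
  moreover have s1: "set_integrable lborel {1} h"
    by (rule set_integrable_subset[OF int]) auto
  ultimately have "(LINT t:{\<epsilon>..1}|lborel. h t) = (LINT t:{\<epsilon>..<1}|lborel. h t) + (LINT t:{1}|lborel. h t)"
    by (simp only:) (rule set_integral_Un[OF _ ih' s1], auto)
  moreover have "(LINT t:{1}|lborel. h t) = 0"
    unfolding set_lebesgue_integral_def
    by (rule integral_eq_zero_AE, rule AE_I'[of "{1}"]) (auto simp: null_sets_def indicator_def)
  ultimately have 2: "(LINT t:{\<epsilon>..<1}|lborel. h t) = (LINT t:{\<epsilon>..1}|lborel. h t)" by simp
  have c2: "continuous_on {\<epsilon>..1} (\<lambda>t. 1 / (2 * t))"
    using e by (intro continuous_intros) auto
  have i2: "set_integrable lborel {\<epsilon>..1} (\<lambda>t. 1 / (2 * t))"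
    by (rule borel_integrable_atLeastAtMost'[OF c2])
  have v2: "(LINT t:{\<epsilon>..1}|lborel. 1 / (2 * t)) = ln (1 / \<epsilon>) / 2"
  proof -
    have "(LINT t:{\<epsilon>..1}|lborel. 1 / (2 * t)) = ln 1 / 2 - ln \<epsilon> / 2"
      unfolding set_lebesgue_integral_def
      by (rule integral_FTC_atLeastAtMost[OF e(2) _ c2])
        (use e in \<open>auto intro!: derivative_eq_intros simp: has_real_derivative_iff_has_vector_derivative[symmetric] field_simps\<close>)
    then show ?thesis using e by (simp add: ln_div)
  qed
  have c3: "continuous_on {\<epsilon>..1} (\<lambda>t. K / sqrt t)"
    using e by (intro continuous_intros) auto
  have i3: "set_integrable lborel {\<epsilon>..1} (\<lambda>t. K / sqrt t)"
    by (rule borel_integrable_atLeastAtMost'[OF c3])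
  have v3: "(LINT t:{\<epsilon>..1}|lborel. K / sqrt t) = 2 * K * sqrt 1 - 2 * K * sqrt \<epsilon>"
    unfolding set_lebesgue_integral_def
    by (rule integral_FTC_atLeastAtMost[OF e(2) _ c3])
      (use e in \<open>auto intro!: derivative_eq_intros simp: has_real_derivative_iff_has_vector_derivative[symmetric] field_simps\<close>)
  have "\<bar>(LINT t:{\<epsilon>..1}|lborel. h t) - (LINT t:{\<epsilon>..1}|lborel. 1 / (2 * t))\<bar> =
      \<bar>LINT t:{\<epsilon>..1}|lborel. h t - 1 / (2 * t)\<bar>"
    by (simp only: set_integral_diff(2)[OF ih i2])
  also have "\<dots> \<le> (LINT t:{\<epsilon>..1}|lborel. \<bar>h t - 1 / (2 * t)\<bar>)"
    using set_integral_norm_bound[OF set_integral_diff(1)[OF ih i2]] by simp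
  also have "\<dots> \<le> (LINT t:{\<epsilon>..1}|lborel. K / sqrt t)"
    by (rule set_integral_mono[OF set_integrable_abs[OF set_integral_diff(1)[OF ih i2]] i3])
      (use small e in auto)
  also have "\<dots> \<le> 2 * K" unfolding v3 using K e by simp
  finally show "\<bar>(LINT t:{\<epsilon>..}|lborel. h t) - ln (1 / \<epsilon>) / 2\<bar> \<le> 2 * K + \<bar>LINT t:{1..}|lborel. h t\<bar>"
    unfolding 1 2 v2 by linarith
qed

locale compact_heat =
  fixes S :: "'a::euclidean_space surface" and p :: "real \<Rightarrow> 'a \<Rightarrow> 'a \<Rightarrow> real"
  assumes compact_pts: "compact (pts S)"
    and sets_vol: "sets (vol S) = sets (restrict_space borel (pts S))"
    and finite_vol: "finite_measure (vol S)"
    and heat: "heat_kernel S p"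
begin

sublocale finite_measure "vol S" by (rule finite_vol)

definition avg :: "real \<Rightarrow> 'a \<Rightarrow> ('a \<Rightarrow> real) \<Rightarrow> real" where
  "avg t x f = (LINT y|vol S. p t x y * f y)"

lemma p_cont: "continuous_on ({0<..} \<times> pts S \<times> pts S) (\<lambda>(t, x, y). p t x y)"
  using heat unfolding heat_kernel_def by blast

lemma p_nonneg: "0 < t \<Longrightarrow> x \<in> pts S \<Longrightarrow> y \<in> pts S \<Longrightarrow> 0 \<le> p t x y"
  using heat unfolding heat_kernel_def by blast

lemma p_mass: "0 < t \<Longrightarrow> x \<in> pts S \<Longrightarrow> (\<integral>\<^sup>+y. ennreal (p t x y) \<partial>vol S) = 1"
  using heat unfolding heat_kernel_def by blast

lemma heat_equation: "f \<in> test S \<Longrightarrow> x \<in> pts S \<Longrightarrow> 0 < t \<Longrightarrow>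
    avg t x f = f x + 1 / 2 * (LINT s:{0<..t}|lborel. avg s x (laplacian S f))"
  using heat unfolding heat_kernel_def avg_def by blast

lemma continuous_measurable: "continuous_on (pts S) f \<Longrightarrow> (f :: 'a \<Rightarrow> real) \<in> borel_measurable (vol S)"
  using borel_measurable_continuous_on_restrict[of "pts S" f] measurable_cong_sets[OF sets_vol refl] by blast

lemma continuous_bounded:
  assumes "continuous_on (pts S) (f :: 'a \<Rightarrow> real)"
  obtains C where "0 < C" "\<And>y. y \<in> pts S \<Longrightarrow> \<bar>f y\<bar> \<le> C"
  using compact_imp_bounded[OF compact_continuous_image[OF assms compact_pts]]
  unfolding bounded_pos by (auto simp: image_iff)

lemma continuous_integrable:
  assumes "continuous_on (pts S) (f :: 'a \<Rightarrow> real)"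
  shows "integrable (vol S) f"
proof -
  obtain C where C: "0 < C" "\<And>y. y \<in> pts S \<Longrightarrow> \<bar>f y\<bar> \<le> C" using continuous_bounded[OF assms] by blast
  show ?thesis
    by (rule integrable_const_bound[of _ C, OF AE_I2 continuous_measurable[OF assms]]) (use C in auto)
qed

lemma p_slice_cont: "0 < t \<Longrightarrow> x \<in> pts S \<Longrightarrow> continuous_on (pts S) (\<lambda>y. p t x y)"
proof -
  assume a: "0 < t" "x \<in> pts S"
  have "continuous_on (pts S) (\<lambda>y. (\<lambda>(t, x, y). p t x y) (t, x, y))"
    by (rule continuous_on_compose2[OF p_cont]) (use a in \<open>auto intro!: continuous_intros\<close>)
  then show ?thesis by simp
qed

lemma p_diag_cont: "x \<in> pts S \<Longrightarrow> continuous_on {0<..} (\<lambda>t. p t x x)"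
proof -
  assume a: "x \<in> pts S"
  have "continuous_on {0<..} (\<lambda>t. (\<lambda>(t, x, y). p t x y) (t, x, x))"
    by (rule continuous_on_compose2[OF p_cont]) (use a in \<open>auto intro!: continuous_intros\<close>)
  then show ?thesis by simp
qed

lemma avg_integrable: "0 < t \<Longrightarrow> x \<in> pts S \<Longrightarrow> continuous_on (pts S) f \<Longrightarrow> integrable (vol S) (\<lambda>y. p t x y * f y)"
  by (rule continuous_integrable[OF continuous_on_mult[OF p_slice_cont]])

lemma avg_cong: "(\<And>y. y \<in> pts S \<Longrightarrow> f y = g y) \<Longrightarrow> avg t x f = avg t x g"
  unfolding avg_def by (rule Bochner_Integration.integral_cong) auto

lemma avg_one: "0 < t \<Longrightarrow> x \<in> pts S \<Longrightarrow> avg t x (\<lambda>_. 1) = 1"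
proof -
  assume a: "0 < t" "x \<in> pts S"
  have "(LINT y|vol S. p t x y) = enn2real (\<integral>\<^sup>+y. ennreal (p t x y) \<partial>vol S)"
    by (rule integral_eq_nn_integral[OF continuous_measurable[OF p_slice_cont[OF a]]])
      (use p_nonneg[OF a] in auto)
  then show ?thesis by (simp add: avg_def p_mass[OF a])
qed

lemma avg_mono:
  assumes a: "0 < t" "x \<in> pts S" and c: "continuous_on (pts S) f" "continuous_on (pts S) g"
    and le: "\<And>y. y \<in> pts S \<Longrightarrow> f y \<le> g y"
  shows "avg t x f \<le> avg t x g"
  unfolding avg_def
  by (rule integral_mono[OF avg_integrable[OF a c(1)] avg_integrable[OF a c(2)]])
    (use le p_nonneg[OF a] in \<open>auto intro: mult_left_mono\<close>)

lemma avg_const: "0 < t \<Longrightarrow> x \<in> pts S \<Longrightarrow> avg t x (\<lambda>_. C) = C"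
  using avg_one[of t x] by (simp add: avg_def)

lemma avg_bound:
  assumes a: "0 < t" "x \<in> pts S" and c: "continuous_on (pts S) f"
    and le: "\<And>y. y \<in> pts S \<Longrightarrow> \<bar>f y\<bar> \<le> C"
  shows "\<bar>avg t x f\<bar> \<le> C"
proof -
  have "avg t x f \<le> avg t x (\<lambda>_. C)" "avg t x (\<lambda>_. - C) \<le> avg t x f"
    using le by (auto intro!: avg_mono[OF a] c simp: abs_le_iff continuous_on_const) (metis minus_le_iff)
  then show ?thesis by (simp add: avg_const[OF a])
qed

lemma avg_cont:
  assumes x: "x \<in> pts S" and c: "continuous_on (pts S) f"
  shows "continuous_on {0<..} (\<lambda>t. avg t x f)"
proof (rule continuous_on_sequentiallyI)
  fix u :: "nat \<Rightarrow> real" and a :: real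
  assume u: "\<forall>n. u n \<in> {0<..}" "a \<in> {0<..}" "u \<longlonglongrightarrow> a"
  \<comment> \<open>A convergent sequence of times together with its limit is compact, which bounds
    the kernel uniformly in \<open>n\<close> for dominated convergence.\<close>
  let ?K = "insert a (range u) \<times> {x} \<times> pts S"
  have "compact ?K"
    by (intro compact_Times compact_sequence_with_limit u compact_pts) auto
  moreover have "continuous_on ?K (\<lambda>(t, x, y). p t x y)"
    by (rule continuous_on_subset[OF p_cont]) (use u x in auto)
  ultimately have "bounded ((\<lambda>(t, x, y). p t x y) ` ?K)"
    using compact_continuous_image compact_imp_bounded by blast
  then obtain C where C: "0 < C" "\<And>z. z \<in> ?K \<Longrightarrow> \<bar>(\<lambda>(t, x, y). p t x y) z\<bar> \<le> C"
    unfolding bounded_pos by auto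
  obtain C' where C': "0 < C'" "\<And>y. y \<in> pts S \<Longrightarrow> \<bar>f y\<bar> \<le> C'" using continuous_bounded[OF c] by blast
  show "(\<lambda>n. avg (u n) x f) \<longlonglongrightarrow> avg a x f"
    unfolding avg_def
  proof (rule integral_dominated_convergence[where w="\<lambda>_. C * C'"])
    show "(\<lambda>y. p a x y * f y) \<in> borel_measurable (vol S)"
      "(\<lambda>y. p (u n) x y * f y) \<in> borel_measurable (vol S)" for n
      using u x by (auto intro!: borel_measurable_integrable avg_integrable c)
    show "AE y in vol S. (\<lambda>n. p (u n) x y * f y) \<longlonglongrightarrow> p a x y * f y"
    proof (intro AE_I2 tendsto_mult tendsto_const)
      fix y assume y: "y \<in> pts S"
      have "(\<lambda>n. (u n, x, y)) \<longlonglongrightarrow> (a, x, y)" by (intro tendsto_intros u)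
      then have "(\<lambda>n. (\<lambda>(t, x, y). p t x y) (u n, x, y)) \<longlonglongrightarrow> (\<lambda>(t, x, y). p t x y) (a, x, y)"
        using u x y by (intro continuous_on_tendsto_compose[OF p_cont]) auto
      then show "(\<lambda>n. p (u n) x y) \<longlonglongrightarrow> p a x y" by simp
    qed
    show "AE y in vol S. norm (p (u n) x y * f y) \<le> C * C'" for n
    proof (rule AE_I2)
      fix y assume y: "y \<in> pts S"
      have "\<bar>p (u n) x y\<bar> \<le> C" using C(2)[of "(u n, x, y)"] y by auto
      then show "norm (p (u n) x y * f y) \<le> C * C'"
        using C'(2)[OF y] C(1) by (simp add: abs_mult mult_mono)
    qed
  qed simp
qed

text \<open>The heat semigroup prolonged by its initial value: the initial condition becomes
  continuity at 0, and differential inequalities can be integrated from there.\<close>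

definition flow :: "'a \<Rightarrow> ('a \<Rightarrow> real) \<Rightarrow> real \<Rightarrow> real" where
  "flow x f t = (if t \<le> 0 then f x else avg t x f)"

lemma flow_pos: "0 < t \<Longrightarrow> flow x f t = avg t x f"
  by (simp add: flow_def)

text \<open>The integrated heat equation makes the flow an indefinite integral of
  \<open>avg s x g\<close>, which is bounded and continuous at positive times. \<open>g\<close>
  stands in for the Laplacian because formulas for the latter hold on \<open>pts S\<close>
  only.\<close>

lemma
  assumes x: "x \<in> pts S" and f: "f \<in> test S"
    and lap: "\<And>y. y \<in> pts S \<Longrightarrow> laplacian S f y = g y" and g: "continuous_on (pts S) g"
  shows flow_cont: "continuous_on {0..} (flow x f)"
    and flow_deriv: "0 < t \<Longrightarrow> (flow x f has_real_derivative avg t x g / 2) (at t)"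
proof -
  let ?H = "\<lambda>s. avg s x g"
  obtain C where C: "0 < C" "\<And>y. y \<in> pts S \<Longrightarrow> \<bar>g y\<bar> \<le> C" using continuous_bounded[OF g] by blast
  have si: "set_integrable lborel {0<..T} ?H" for T
  proof (rule set_integrable_bound[of _ _ "\<lambda>_. C"])
    show "set_integrable lborel {0<..T} (\<lambda>_. C)"
      by (rule set_integrable_subset[OF borel_integrable_atLeastAtMost'[of 0 T]]) (auto intro: continuous_intros)
    show "set_borel_measurable lborel {0<..T} ?H"
    proof -
      have "continuous_on {0<..T} ?H" by (rule continuous_on_subset[OF avg_cont[OF x g]]) auto
      from borel_measurable_continuous_on_indicator[OF _ this] show ?thesis
        by (simp add: set_borel_measurable_def)
    qed
    show "AE s in lborel. s \<in> {0<..T} \<longrightarrow> norm (?H s) \<le> norm C"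
      using avg_bound[OF _ x g C(2)] C(1) by (intro AE_I2) auto
  qed
  have hi: "?H integrable_on {0..T}" for T
    by (rule integrable_spike_set[OF set_borel_integral_eq_integral(1)[OF si[of T]]])
      (auto intro: negligible_subset[of "{0}"])
  have eq: "flow x f t = f x + 1 / 2 * integral {0..t} ?H" if "0 \<le> t" for t
  proof (cases "t = 0")
    case True
    then show ?thesis by (simp add: flow_def)
  next
    case False
    then have t: "0 < t" using that by simp
    have "(LINT s:{0<..t}|lborel. avg s x (laplacian S f)) = (LINT s:{0<..t}|lborel. ?H s)"
      by (intro set_lebesgue_integral_cong) (auto intro: avg_cong lap)
    also have "\<dots> = integral {0<..t} ?H" by (rule set_borel_integral_eq_integral(2)[OF si])
    also have "\<dots> = integral {0..t} ?H"
      by (rule integral_spike_set) (auto intro: negligible_subset[of "{0}"])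
    finally show ?thesis using heat_equation[OF f x t] t by (simp add: flow_pos)
  qed
  have cT: "continuous_on {0..T} (flow x f)" for T
  proof -
    have "continuous_on {0..T} (\<lambda>t. f x + 1 / 2 * integral {0..t} ?H)"
      by (intro continuous_intros indefinite_integral_continuous_1 hi)
    then show ?thesis by (rule continuous_on_eq) (simp add: eq)
  qed
  show "continuous_on {0..} (flow x f)"
  proof (rule continuous_on_sequentiallyI)
    fix u :: "nat \<Rightarrow> real" and a :: real
    assume u: "\<forall>n. u n \<in> {0..}" "a \<in> {0..}" "u \<longlonglongrightarrow> a"
    have "Bseq u" using u(3) by (intro convergent_imp_Bseq convergentI)
    then obtain T where T: "\<forall>n. norm (u n) \<le> T" unfolding Bseq_def by blast
    have "u n \<in> {0..max T a}" for n using u(1) T[rule_format, of n] by (auto simp: le_max_iff_disj)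
    then show "(\<lambda>n. flow x f (u n)) \<longlonglongrightarrow> flow x f a"
      using u by (intro continuous_on_tendsto_compose[OF cT[of "max T a"]]) auto
  qed
  show "(flow x f has_real_derivative avg t x g / 2) (at t)" if t: "0 < t" for t
  proof -
    have ct: "continuous (at t within {0..t+1} - {}) ?H"
      using avg_cont[OF x g] t
      by (simp add: continuous_on_eq_continuous_at continuous_at_imp_continuous_within)
    have "((\<lambda>u. integral {0..u} ?H) has_vector_derivative ?H t) (at t within {0..t+1} - {})"
      by (rule integral_has_vector_derivative_continuous_at[OF hi _ _ ct]) (use t in auto)
    then have "((\<lambda>u. integral {0..u} ?H) has_real_derivative ?H t) (at t within {0..t+1})"
      by (simp add: has_real_derivative_iff_has_vector_derivative)
    then have "((\<lambda>u. f x + 1 / 2 * integral {0..u} ?H) has_real_derivative avg t x g / 2) (at t within {0..t+1})"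
      by (auto intro!: derivative_eq_intros)
    then have "(flow x f has_real_derivative avg t x g / 2) (at t within {0..t+1})"
      by (rule has_field_derivative_transform_within[of _ _ _ _ 1]) (use t eq in auto)
    moreover have "at t within {0..t+1} = at t"
      using t by (intro at_within_interior) auto
    ultimately show ?thesis by simp
  qed
qed

text \<open>Laplace's method: away from \<open>x\<close> the powers of \<open>b\<close> decay at
  least like \<open>\<rho> ^ n\<close> for some \<open>\<rho> < 1\<close>, while by
  \<open>small\<close> their total mass decays more slowly than any geometric sequence. The
  normalised powers thus concentrate at \<open>x\<close>.\<close>

lemma approximate_identity:
  fixes b f :: "'a \<Rightarrow> real"
  assumes x: "x \<in> pts S" and b: "continuous_on (pts S) b"
      "\<And>y. y \<in> pts S \<Longrightarrow> 0 \<le> b y" "\<And>y. y \<in> pts S \<Longrightarrow> y \<noteq> x \<Longrightarrow> b y < 1" "b x = 1"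
    and I: "\<And>n. 0 < (LINT y|vol S. b y ^ n)"
    and small: "\<And>\<rho>. 0 < \<rho> \<Longrightarrow> \<rho> < 1 \<Longrightarrow> (\<lambda>n. \<rho> ^ n / (LINT y|vol S. b y ^ n)) \<longlonglongrightarrow> 0"
    and f: "continuous_on (pts S) f"
  shows "(\<lambda>n. (LINT y|vol S. f y * b y ^ n) / (LINT y|vol S. b y ^ n)) \<longlonglongrightarrow> f x"
proof (rule LIMSEQ_I)
  fix e :: real assume e: "0 < e"
  let ?I = "\<lambda>n. LINT y|vol S. b y ^ n"
  obtain C where C: "0 < C" "\<And>y. y \<in> pts S \<Longrightarrow> \<bar>f y\<bar> \<le> C" using continuous_bounded[OF f] by blast
  obtain d where d: "0 < d" "\<And>y. y \<in> pts S \<Longrightarrow> dist y x < d \<Longrightarrow> dist (f y) (f x) < e / 2"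
    using f x e unfolding continuous_on_iff by (metis half_gt_zero)
  \<comment> \<open>The maximum of \<open>b\<close> outside the ball, raised to at least
    \<open>1/2\<close> to keep it positive.\<close>
  have "\<exists>\<rho>. 0 < \<rho> \<and> \<rho> < 1 \<and> (\<forall>y\<in>pts S - ball x d. b y \<le> \<rho>)"
  proof (cases "pts S - ball x d = {}")
    case True
    then show ?thesis by (intro exI[of _ "1/2"]) auto
  next
    case False
    have "compact (pts S - ball x d)" using compact_pts by (intro compact_diff) auto
    moreover have "continuous_on (pts S - ball x d) b" by (rule continuous_on_subset[OF b(1)]) auto
    ultimately obtain z where z: "z \<in> pts S - ball x d" "\<forall>y\<in>pts S - ball x d. b y \<le> b z"
      using continuous_attains_sup False by blast
    moreover have "z \<noteq> x" using z(1) d(1) by auto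
    ultimately have "b z < 1" using b(3)[of z] by auto
    then show ?thesis using z(2) by (intro exI[of _ "max (1/2) (b z)"]) (auto simp: le_max_iff_disj)
  qed
  then obtain \<rho> where \<rho>: "0 < \<rho>" "\<rho> < 1" "\<And>y. y \<in> pts S \<Longrightarrow> d \<le> dist x y \<Longrightarrow> b y \<le> \<rho>"
    by (auto simp: not_less)
  let ?m = "measure (vol S) (pts S)"
  have cb: "continuous_on (pts S) (\<lambda>y. b y ^ n)" for n by (intro continuous_intros b)
  have ptw: "\<bar>(f y - f x) * b y ^ n\<bar> \<le> e / 2 * b y ^ n + 2 * C * \<rho> ^ n" if y: "y \<in> pts S" for y n
  proof (cases "dist y x < d")
    case True
    then have "\<bar>f y - f x\<bar> * b y ^ n \<le> e / 2 * b y ^ n"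
      using d(2)[OF y] b(2)[OF y] by (intro mult_right_mono) (auto simp: dist_real_def)
    moreover have "0 \<le> 2 * C * \<rho> ^ n" using C \<rho> by simp
    ultimately show ?thesis using b(2)[OF y] by (simp add: abs_mult)
  next
    case False
    then have "b y ^ n \<le> \<rho> ^ n" using \<rho>(3)[OF y] b(2)[OF y] by (intro power_mono) (auto simp: dist_commute)
    moreover have "\<bar>f y - f x\<bar> \<le> 2 * C" using C(2)[OF y] C(2)[OF x] by linarith
    ultimately have "\<bar>f y - f x\<bar> * b y ^ n \<le> 2 * C * \<rho> ^ n"
      using b(2)[OF y] C by (intro mult_mono) auto
    moreover have "0 \<le> e / 2 * b y ^ n" using e b(2)[OF y] by simp
    ultimately show ?thesis using b(2)[OF y] by (simp add: abs_mult)
  qed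
  have bound: "\<bar>(LINT y|vol S. f y * b y ^ n) / ?I n - f x\<bar> \<le> e / 2 + 2 * C * ?m * (\<rho> ^ n / ?I n)" for n
  proof -
    have i1: "integrable (vol S) (\<lambda>y. f y * b y ^ n)" "integrable (vol S) (\<lambda>y. b y ^ n)"
      by (intro continuous_integrable continuous_intros f cb)+
    have i2: "integrable (vol S) (\<lambda>y. (f y - f x) * b y ^ n)"
      by (intro continuous_integrable continuous_intros f cb)
    have "(LINT y|vol S. (f y - f x) * b y ^ n) = (LINT y|vol S. f y * b y ^ n) - f x * ?I n"
      using i1 by (simp add: left_diff_distrib)
    then have "\<bar>(LINT y|vol S. f y * b y ^ n) - f x * ?I n\<bar> = \<bar>LINT y|vol S. (f y - f x) * b y ^ n\<bar>" by simp
    also have "\<dots> \<le> (LINT y|vol S. \<bar>(f y - f x) * b y ^ n\<bar>)" by (rule integral_abs_bound)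
    also have "\<dots> \<le> (LINT y|vol S. e / 2 * b y ^ n + 2 * C * \<rho> ^ n)"
      by (rule integral_mono[OF integrable_abs[OF i2]]) (use ptw i1 in auto)
    also have "\<dots> = e / 2 * ?I n + 2 * C * \<rho> ^ n * ?m"
      using i1 by simp
    finally have "\<bar>(LINT y|vol S. f y * b y ^ n) - f x * ?I n\<bar> / ?I n \<le> (e / 2 * ?I n + 2 * C * \<rho> ^ n * ?m) / ?I n"
      using I[of n] by (intro divide_right_mono) auto
    moreover have "\<bar>(LINT y|vol S. f y * b y ^ n) / ?I n - f x\<bar> = \<bar>(LINT y|vol S. f y * b y ^ n) - f x * ?I n\<bar> / ?I n"
      using I[of n] by (simp add: field_simps abs_divide)
    moreover have "(e / 2 * ?I n + 2 * C * \<rho> ^ n * ?m) / ?I n = e / 2 + 2 * C * ?m * (\<rho> ^ n / ?I n)"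
      using I[of n] by (simp add: field_simps)
    ultimately show ?thesis by simp
  qed
  have "(\<lambda>n. 2 * C * ?m * (\<rho> ^ n / ?I n)) \<longlonglongrightarrow> 2 * C * ?m * 0"
    by (intro tendsto_intros small \<rho>)
  then have "eventually (\<lambda>n. 2 * C * ?m * (\<rho> ^ n / ?I n) < e / 2) sequentially"
    using e by (intro order_tendstoD(2)) auto
  then obtain N where N: "\<And>n. N \<le> n \<Longrightarrow> 2 * C * ?m * (\<rho> ^ n / ?I n) < e / 2"
    by (auto simp: eventually_sequentially)
  show "\<exists>no. \<forall>n\<ge>no. norm ((LINT y|vol S. f y * b y ^ n) / ?I n - f x) < e"
  proof (intro exI allI impI)
    fix n assume "N \<le> n"
    then show "norm ((LINT y|vol S. f y * b y ^ n) / ?I n - f x) < e"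
      using bound[of n] N[of n] by simp
  qed
qed

end

section \<open>The plane\<close>

lemma mff_k_0: "mff_k m 0 = 1"
proof -
  have "(LINT v:{0..}|lborel. exp (- v / 2)) = 0 - (- 2 * exp (- 0 / 2 :: real))"
  proof (rule set_integral_atLeast_FTC(2))
    show "((\<lambda>v::real. - 2 * exp (- v / 2)) \<longlongrightarrow> 0) at_top" by real_asymp
  qed (auto intro!: derivative_eq_intros)
  then show ?thesis by (simp add: mff_k_def)
qed

text \<open>On the diagonal the integrand is \<open>1 / u\<close>, as \<open>mff_k\<close> equals 1
  at the origin for every mass; the variance is the logarithm of the cutoff without error
  term.\<close>

lemma mff_cutoff_cov_diag:
  assumes "1 \<le> c (n + 1)"
  shows "mff_cutoff_cov m c n y y = ln (c (n + 1))"
proof -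
  have "mff_cutoff_cov m c n y y = (LINT u:{1..c (n + 1)}|lborel. 1 / u)"
    by (simp add: mff_cutoff_cov_def mff_k_0)
  also have "\<dots> = ln (c (n + 1)) - ln 1"
    unfolding set_lebesgue_integral_def
  proof (rule integral_FTC_atLeastAtMost[OF assms])
    fix u :: real assume "1 \<le> u"
    then have "(ln has_real_derivative 1 / u) (at u within {1..c (n + 1)})"
      by (auto intro!: derivative_eq_intros)
    then show "(ln has_vector_derivative 1 / u) (at u within {1..c (n + 1)})"
      by (simp add: has_real_derivative_iff_has_vector_derivative)
  next
    show "continuous_on {1..c (n + 1)} (\<lambda>u. 1 / u)" by (intro continuous_intros) auto
  qed
  finally show ?thesis by simp
qed

lemma thick_points_plane:
  fixes c :: "nat \<Rightarrow> real" and PX :: "'w measure" and PB :: "real ^ 2 \<Rightarrow> 'b measure"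
  assumes c: "cutoff_sequence c"
    and setting: "liouville_setting plane p (mff_cov m) (mff_cutoff_cov m c) \<gamma> PX X Xn PB B F"
  shows "AE w in PX. \<forall>x\<in>pts plane. AE b in PB x.
    {t \<in> {0..}. liouville_bm (\<lambda>s. F w x s b) (\<lambda>s. B x s b) t \<in> pts plane - thick_points plane c Xn \<gamma> w}
      \<in> null_sets (lebesgue_on {0..})"
proof (rule thick_points_of_setting[OF c _ _ _ setting, where V = "\<lambda>n. ln (c (n + 1))"])
  have pts: "pts plane = UNIV" by (simp add: plane_def)
  show "closed (pts plane)" by (simp add: pts)
  show "sets (vol plane) = sets (restrict_space borel (pts plane))"
    unfolding pts by (simp add: plane_def sets_restrict_space)
  show "emeasure (vol plane) (pts plane \<inter> ball 0 R) < \<infinity>" for R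
    unfolding pts by (simp only: plane_def surface.simps Int_UNIV_left) (rule emeasure_bounded_finite[OF bounded_ball])
  show "mff_cutoff_cov m c n y y = ln (c (n + 1))" if "1 \<le> n" for n y
  proof (rule mff_cutoff_cov_diag)
    show "1 \<le> c (n + 1)"
      using c that strict_mono_onD[of "{1..}" c 1 "n + 1"] by (auto simp: cutoff_sequence_def)
  qed
  have "eventually (\<lambda>n. 1 = ln (c (n + 1)) / ln (c (n + 1))) sequentially"
    using filterlim_at_top_dense[THEN iffD1, OF ln_cutoff_at_top[OF c], rule_format, of 0]
    by eventually_elim simp
  then show "(\<lambda>n. ln (c (n + 1)) / ln (c (n + 1))) \<longlonglongrightarrow> 1"
    by (rule Lim_transform_eventually[OF tendsto_const])
qed

section \<open>The sphere\<close>

text \<open>The integrating factor \<open>exp (a * t)\<close> makes \<open>exp (a * t) * g t\<close>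
  nondecreasing. Applied to differences of two functions, this is the comparison principle behind
  all barrier and uniqueness arguments below.\<close>

lemma ode_nonneg:
  fixes g g' :: "real \<Rightarrow> real"
  assumes cont: "continuous_on {0..} g"
    and deriv: "\<And>t. 0 < t \<Longrightarrow> (g has_real_derivative g' t) (at t)"
    and le: "\<And>t. 0 < t \<Longrightarrow> 0 \<le> g' t + a * g t"
    and zero: "0 \<le> g 0" and t: "0 \<le> t"
  shows "0 \<le> g t"
proof (cases "t = 0")
  case False
  with t have t: "0 < t" by simp
  have "exp (a * 0) * g 0 \<le> exp (a * t) * g t"
  proof (rule DERIV_nonneg_imp_increasing_open[of 0 t "\<lambda>t. exp (a * t) * g t"])
    fix s :: real assume s: "0 < s" "s < t"
    have "((\<lambda>t. exp (a * t) * g t) has_real_derivative exp (a * s) * (g' s + a * g s)) (at s)"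
      using deriv[OF s(1)] by (auto intro!: derivative_eq_intros simp: algebra_simps)
    then show "\<exists>y. ((\<lambda>t. exp (a * t) * g t) has_real_derivative y) (at s) \<and> 0 \<le> y"
      using le[OF s(1)] by (intro exI[of _ "exp (a * s) * (g' s + a * g s)"] conjI mult_nonneg_nonneg) auto
  next
    show "continuous_on {0..t} (\<lambda>t. exp (a * t) * g t)"
      by (intro continuous_intros continuous_on_subset[OF cont]) auto
  qed (use t in simp)
  with zero have "0 \<le> exp (a * t) * g t" by simp
  then show ?thesis by (simp add: zero_le_mult_iff)
qed (use zero in simp)

text \<open>The tail estimate at \<open>\<epsilon> = 1 / (c (n + 1))\<^sup>2\<close> puts the
  variance within a constant of \<open>ln (c (n + 1))\<close>, so their ratio tends to 1. For both
  compact surfaces it remains to show that the diagonal value does not depend on the point and to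
  bound it near 0 and at infinity.\<close>

lemma (in compact_heat) thick_points_of_diagonal:
  fixes c :: "nat \<Rightarrow> real" and PX :: "'w measure" and PB :: "'a \<Rightarrow> 'b measure"
  assumes c: "cutoff_sequence c"
    and setting: "liouville_setting S p (gff_cov S p) (gff_cutoff_cov S p c) \<gamma> PX X Xn PB B F"
    and q: "\<And>t x. 0 < t \<Longrightarrow> x \<in> pts S \<Longrightarrow> p t x x = q t"
    and cont: "continuous_on {0<..} q"
    and small: "\<And>t. 0 < t \<Longrightarrow> t \<le> 1 \<Longrightarrow>
      \<bar>pi * (q t - 1 / measure (vol S) (pts S)) - 1 / (2 * t)\<bar> \<le> K / sqrt t"
    and int: "set_integrable lborel {1..} (\<lambda>t. pi * (q t - 1 / measure (vol S) (pts S)))"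
  shows "AE w in PX. \<forall>x\<in>pts S. AE b in PB x.
    {t \<in> {0..}. liouville_bm (\<lambda>s. F w x s b) (\<lambda>s. B x s b) t \<in> pts S - thick_points S c Xn \<gamma> w}
      \<in> null_sets (lebesgue_on {0..})"
proof -
  define h where "h t = pi * (q t - 1 / measure (vol S) (pts S))" for t
  define V where "V n = (LINT t:{1 / (c (n + 1))\<^sup>2..}|lborel. h t)" for n
  have "\<exists>C. \<forall>\<epsilon>\<in>{0<..1}. \<bar>(LINT t:{\<epsilon>..}|lborel. h t) - ln (1 / \<epsilon>) / 2\<bar> \<le> C"
    by (rule tail_integral_asymp[of h K])
      (use small int in \<open>auto simp: h_def[abs_def] intro!: continuous_intros cont\<close>)
  then obtain C where "\<forall>\<epsilon>\<in>{0<..1}. \<bar>(LINT t:{\<epsilon>..}|lborel. h t) - ln (1 / \<epsilon>) / 2\<bar> \<le> C" ..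
  then have C: "\<bar>(LINT t:{\<epsilon>..}|lborel. h t) - ln (1 / \<epsilon>) / 2\<bar> \<le> C" if "0 < \<epsilon>" "\<epsilon> \<le> 1" for \<epsilon>
    using that by simp
  have cgt: "1 < c (n + 1)" if "1 \<le> n" for n
    using c that strict_mono_onD[of "{1..}" c 1 "n + 1"] by (auto simp: cutoff_sequence_def)
  have close: "\<bar>V n / ln (c (n + 1)) - 1\<bar> \<le> C / ln (c (n + 1))" if n: "1 \<le> n" for n
  proof -
    note g = cgt[OF n]
    then have l: "0 < ln (c (n + 1))" by simp
    have "\<bar>V n - ln (1 / (1 / (c (n + 1))\<^sup>2)) / 2\<bar> \<le> C"
      unfolding V_def using g by (intro C) (auto simp: field_simps intro!: one_le_power)
    moreover have "ln (1 / (1 / (c (n + 1))\<^sup>2)) / 2 = ln (c (n + 1))"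
      using g by (simp add: ln_realpow)
    ultimately have "\<bar>V n - ln (c (n + 1))\<bar> / ln (c (n + 1)) \<le> C / ln (c (n + 1))"
      using l by (intro divide_right_mono) auto
    moreover have "\<bar>V n / ln (c (n + 1)) - 1\<bar> = \<bar>V n - ln (c (n + 1))\<bar> / ln (c (n + 1))"
      using l by (simp add: field_simps abs_divide)
    ultimately show ?thesis by simp
  qed
  have "(\<lambda>n. V n / ln (c (n + 1)) - 1) \<longlonglongrightarrow> 0"
  proof (rule tendsto_rabs_zero_cancel, rule tendsto_sandwich[OF _ _ tendsto_const])
    show "(\<lambda>n. C / ln (c (n + 1))) \<longlonglongrightarrow> 0"
      by (rule real_tendsto_divide_at_top[OF tendsto_const ln_cutoff_at_top[OF c]])
    show "eventually (\<lambda>n. \<bar>V n / ln (c (n + 1)) - 1\<bar> \<le> C / ln (c (n + 1))) sequentially"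
      using close by (auto simp: eventually_sequentially)
  qed auto
  then have V: "(\<lambda>n. V n / ln (c (n + 1))) \<longlonglongrightarrow> 1" by (simp add: LIM_zero_iff)
  show ?thesis
  proof (rule thick_points_of_setting[OF c _ sets_vol _ setting _ V])
    show "closed (pts S)" by (rule compact_imp_closed[OF compact_pts])
    show "emeasure (vol S) (pts S \<inter> ball 0 R) < \<infinity>" for R
      using emeasure_finite[of "pts S \<inter> ball 0 R"] by (simp add: less_top[symmetric])
    fix n :: nat and y assume n: "1 \<le> n" and y: "y \<in> pts S"
    have pq: "p t y y = q t" if "t \<in> {1 / (c (n + 1))\<^sup>2..}" for t
    proof -
      have "0 < 1 / (c (n + 1))\<^sup>2" using cgt[OF n] by simp
      also have "\<dots> \<le> t" using that by simp
      finally have "0 < t" .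
      then show ?thesis using y by (rule q)
    qed
    have "gff_cutoff_cov S p c n y y =
        pi * (LINT t:{1 / (c (n + 1))\<^sup>2..}|lborel. q t - 1 / measure (vol S) (pts S))"
      unfolding gff_cutoff_cov_def
      by (rule arg_cong2[where f="(*)", OF refl], rule set_lebesgue_integral_cong) (simp_all add: pq)
    also have "\<dots> = V n"
      by (simp only: V_def h_def set_integral_mult_right)
    finally show "gff_cutoff_cov S p c n y y = V n" .
  qed
qed

text \<open>A coordinate form of \<open>C2_on\<close>: \<open>g b\<close> is the partial derivative
  of \<open>f\<close> along \<open>b\<close>, and \<open>H b c\<close> that of \<open>g b\<close>
  along \<open>c\<close>. Carrying explicit formulas through products and compositions yields
  membership in \<open>test\<close> together with the second derivatives that enter the
  Laplacian.\<close>

definition C2_data :: "'a::euclidean_space set \<Rightarrow> ('a \<Rightarrow> real) \<Rightarrow> ('a \<Rightarrow> 'a \<Rightarrow> real) \<Rightarrow> ('a \<Rightarrow> 'a \<Rightarrow> 'a \<Rightarrow> real) \<Rightarrow> bool" where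
  "C2_data U f g H \<longleftrightarrow>
    (\<forall>x\<in>U. (f has_derivative (\<lambda>h. \<Sum>b\<in>Basis. g b x * (h \<bullet> b))) (at x)) \<and>
    (\<forall>b\<in>Basis. \<forall>x\<in>U. (g b has_derivative (\<lambda>h. \<Sum>c\<in>Basis. H b c x * (h \<bullet> c))) (at x)) \<and>
    (\<forall>b\<in>Basis. \<forall>c\<in>Basis. continuous_on U (H b c))"

lemma C2_dataI:
  assumes "\<And>x. x \<in> U \<Longrightarrow> (f has_derivative (\<lambda>h. \<Sum>b\<in>Basis. g b x * (h \<bullet> b))) (at x)"
    "\<And>b x. b \<in> Basis \<Longrightarrow> x \<in> U \<Longrightarrow> (g b has_derivative (\<lambda>h. \<Sum>c\<in>Basis. H b c x * (h \<bullet> c))) (at x)"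
    "\<And>b c. b \<in> Basis \<Longrightarrow> c \<in> Basis \<Longrightarrow> continuous_on U (H b c)"
  shows "C2_data U f g H"
  unfolding C2_data_def using assms by (intro conjI ballI)

lemma C2_dataD:
  assumes d: "C2_data U f g H"
  shows "x \<in> U \<Longrightarrow> (f has_derivative (\<lambda>h. \<Sum>b\<in>Basis. g b x * (h \<bullet> b))) (at x)"
    "b \<in> Basis \<Longrightarrow> x \<in> U \<Longrightarrow> (g b has_derivative (\<lambda>h. \<Sum>c\<in>Basis. H b c x * (h \<bullet> c))) (at x)"
    "b \<in> Basis \<Longrightarrow> c \<in> Basis \<Longrightarrow> continuous_on U (H b c)"
    "continuous_on U f" "b \<in> Basis \<Longrightarrow> continuous_on U (g b)"
proof -
  note d' = d[unfolded C2_data_def]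
  show f: "(f has_derivative (\<lambda>h. \<Sum>b\<in>Basis. g b x * (h \<bullet> b))) (at x)" if "x \<in> U" for x
    using d'[THEN conjunct1] that by (rule bspec)
  show g: "(g b has_derivative (\<lambda>h. \<Sum>c\<in>Basis. H b c x * (h \<bullet> c))) (at x)" if "b \<in> Basis" "x \<in> U" for b x
    using d'[THEN conjunct2, THEN conjunct1, THEN bspec, OF that(1)] that(2) by (rule bspec)
  show "continuous_on U (H b c)" if "b \<in> Basis" "c \<in> Basis"
    using d'[THEN conjunct2, THEN conjunct2, THEN bspec, OF that(1)] that(2) by (rule bspec)
  show "continuous_on U f"
    by (rule continuous_at_imp_continuous_on) (use f in \<open>blast intro: has_derivative_continuous\<close>)
  show "continuous_on U (g b)" if "b \<in> Basis"
    by (rule continuous_at_imp_continuous_on) (use g[OF that] in \<open>blast intro: has_derivative_continuous\<close>)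
qed

lemma C2_on_of_data:
  assumes d: "C2_data U f g H"
  shows "C2_on U f"
proof -
  define E :: "'a \<Rightarrow> 'a \<Rightarrow> 'a \<Rightarrow>\<^sub>L ('a \<Rightarrow>\<^sub>L real)"
    where "E b c = blinfun_scaleR_left (blinfun_inner_left b) o\<^sub>L blinfun_inner_left c" for b c
  have E: "blinfun_apply (E b c) h = (h \<bullet> c) *\<^sub>R blinfun_inner_left b" for b c h
    by (simp add: E_def)
  define f' where "f' x = (\<Sum>b\<in>Basis. g b x *\<^sub>R blinfun_inner_left b)" for x
  define f'' where "f'' x = (\<Sum>b\<in>Basis. \<Sum>c\<in>Basis. H b c x *\<^sub>R E b c)" for x
  have "(f has_derivative blinfun_apply (f' x)) (at x)" if "x \<in> U" for x
  proof -
    have "blinfun_apply (f' x) = (\<lambda>h. \<Sum>b\<in>Basis. g b x * (h \<bullet> b))"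
      by (rule ext) (simp add: f'_def blinfun.sum_left blinfun.scaleR_left)
    with C2_dataD(1)[OF d that] show ?thesis by simp
  qed
  moreover have "(f' has_derivative blinfun_apply (f'' x)) (at x)" if x: "x \<in> U" for x
  proof -
    have "((\<lambda>x. \<Sum>b\<in>Basis. g b x *\<^sub>R blinfun_inner_left b) has_derivative
        (\<lambda>h. \<Sum>b\<in>Basis. (\<Sum>c\<in>Basis. H b c x * (h \<bullet> c)) *\<^sub>R blinfun_inner_left b)) (at x)"
      by (intro has_derivative_sum has_derivative_scaleR_left C2_dataD(2)[OF d _ x])
    moreover have "blinfun_apply (f'' x) = (\<lambda>h. \<Sum>b\<in>Basis. (\<Sum>c\<in>Basis. H b c x * (h \<bullet> c)) *\<^sub>R blinfun_inner_left b)"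
      by (rule ext) (simp add: f''_def blinfun.sum_left blinfun.scaleR_left E scaleR_sum_left)
    ultimately show ?thesis
      unfolding f'_def[abs_def] by simp
  qed
  moreover have "continuous_on U f''"
    unfolding f''_def by (intro continuous_intros C2_dataD(3)[OF d])
  ultimately show ?thesis unfolding C2_on_def by blast
qed

lemma second_deriv0_of_data:
  assumes d: "C2_data U f g H" and U: "open U" "y \<in> U" and b: "b \<in> Basis"
  shows "second_deriv0 (\<lambda>s. f (y + s *\<^sub>R b)) = H b b y"
proof -
  have line: "((\<lambda>s. y + s *\<^sub>R b) has_derivative (\<lambda>t. t *\<^sub>R b)) (at s)" for s :: real
    by (auto intro!: derivative_eq_intros)
  have pick: "(\<Sum>c\<in>Basis. k c * ((t *\<^sub>R b) \<bullet> c)) = k b * t" for k and t :: real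
    using b by (simp add: inner_Basis if_distrib[of "(*) _"] sum.delta cong: if_cong)
  have d1: "((\<lambda>s. f (y + s *\<^sub>R b)) has_real_derivative g b (y + s *\<^sub>R b)) (at s)" if "y + s *\<^sub>R b \<in> U" for s
    using has_derivative_compose[OF line C2_dataD(1)[OF d that]]
    unfolding pick has_field_derivative_def by (simp add: mult_commute_abs)
  have d2: "((\<lambda>s. g b (y + s *\<^sub>R b)) has_real_derivative H b b (y + s *\<^sub>R b)) (at s)" if "y + s *\<^sub>R b \<in> U" for s
    using has_derivative_compose[OF line C2_dataD(2)[OF d b that]]
    unfolding pick has_field_derivative_def by (simp add: mult_commute_abs)
  have "open ((\<lambda>s. y + s *\<^sub>R b) -` U)"
    by (rule open_vimage[OF U(1)]) (intro continuous_intros)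
  then have "eventually (\<lambda>s. s \<in> (\<lambda>s. y + s *\<^sub>R b) -` U) (nhds 0)"
    using U(2) by (intro eventually_nhds_in_open) auto
  then have "eventually (\<lambda>s. deriv (\<lambda>s. f (y + s *\<^sub>R b)) s = g b (y + s *\<^sub>R b)) (nhds 0)"
    by eventually_elim (use d1 in \<open>auto intro: DERIV_imp_deriv\<close>)
  then have "second_deriv0 (\<lambda>s. f (y + s *\<^sub>R b)) = deriv (\<lambda>s. g b (y + s *\<^sub>R b)) 0"
    unfolding second_deriv0_def by (intro deriv_cong_ev) auto
  also have "\<dots> = H b b y"
    using DERIV_imp_deriv[OF d2[of 0]] U(2) by simp
  finally show ?thesis .
qed

lemma inner_eq_sum_Basis: "a \<bullet> h = (\<Sum>b\<in>Basis. (a \<bullet> b) * (h \<bullet> b))" for a h :: "'a::euclidean_space"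
  by (rule euclidean_inner)

lemma C2_data_inner: "C2_data U (\<lambda>y. a \<bullet> y) (\<lambda>b y. a \<bullet> b) (\<lambda>b c y. 0)"
proof (rule C2_dataI)
  show "((\<bullet>) a has_derivative (\<lambda>h. \<Sum>b\<in>Basis. (a \<bullet> b) * (h \<bullet> b))) (at x)" for x
    unfolding inner_eq_sum_Basis[symmetric] by (auto intro!: derivative_eq_intros)
qed (auto intro!: derivative_eq_intros continuous_intros)

lemma C2_data_inner_self: "C2_data U (\<lambda>y. y \<bullet> y) (\<lambda>b y. 2 * (y \<bullet> b)) (\<lambda>b c y. 2 * (b \<bullet> c))"
proof (rule C2_dataI)
  fix x :: 'a
  have "((\<lambda>y. y \<bullet> y) has_derivative (\<lambda>h. 2 * (x \<bullet> h))) (at x)"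
    by (auto intro!: derivative_eq_intros simp: inner_commute)
  moreover have "(\<lambda>h. 2 * (x \<bullet> h)) = (\<lambda>h. \<Sum>b\<in>Basis. 2 * (x \<bullet> b) * (h \<bullet> b))"
    by (rule ext, subst inner_eq_sum_Basis) (simp only: sum_distrib_left mult.assoc)
  ultimately show "((\<lambda>y. y \<bullet> y) has_derivative (\<lambda>h. \<Sum>b\<in>Basis. 2 * (x \<bullet> b) * (h \<bullet> b))) (at x)"
    by (simp only:)
next
  fix b x :: 'a
  have "((\<lambda>y. 2 * (y \<bullet> b)) has_derivative (\<lambda>h. 2 * (b \<bullet> h))) (at x)"
    by (auto intro!: derivative_eq_intros simp: inner_commute)
  moreover have "(\<lambda>h. 2 * (b \<bullet> h)) = (\<lambda>h. \<Sum>c\<in>Basis. 2 * (b \<bullet> c) * (h \<bullet> c))"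
    by (rule ext, subst inner_eq_sum_Basis) (simp only: sum_distrib_left mult.assoc)
  ultimately show "((\<lambda>y. 2 * (y \<bullet> b)) has_derivative (\<lambda>h. \<Sum>c\<in>Basis. 2 * (b \<bullet> c) * (h \<bullet> c))) (at x)"
    by (simp only:)
qed (auto intro!: continuous_intros)

lemma C2_data_mult:
  assumes d1: "C2_data U f1 g1 H1" and d2: "C2_data U f2 g2 H2"
  shows "C2_data U (\<lambda>y. f1 y * f2 y) (\<lambda>b y. g1 b y * f2 y + f1 y * g2 b y)
    (\<lambda>b c y. H1 b c y * f2 y + g1 b y * g2 c y + (g1 c y * g2 b y + f1 y * H2 b c y))"
proof (rule C2_dataI)
  fix x assume x: "x \<in> U"
  note D1 = C2_dataD(1,2)[OF d1] and D2 = C2_dataD(1,2)[OF d2]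
  have eq: "u * (\<Sum>b\<in>Basis. k b * (h \<bullet> b)) + (\<Sum>b\<in>Basis. l b * (h \<bullet> b)) * v =
      (\<Sum>b\<in>Basis. (l b * v + u * k b) * (h \<bullet> b))" for u v :: real and k l and h :: 'a
    by (simp add: sum_distrib_left sum_distrib_right sum.distrib[symmetric] algebra_simps)
  show "((\<lambda>y. f1 y * f2 y) has_derivative (\<lambda>h. \<Sum>b\<in>Basis. (g1 b x * f2 x + f1 x * g2 b x) * (h \<bullet> b))) (at x)"
    using has_derivative_mult[OF D1(1)[OF x] D2(1)[OF x]] unfolding eq .
  fix b :: 'a assume b: "b \<in> Basis"
  have "((\<lambda>y. g1 b y * f2 y + f1 y * g2 b y) has_derivative
      (\<lambda>h. (\<Sum>c\<in>Basis. (H1 b c x * f2 x + g1 b x * g2 c x) * (h \<bullet> c)) +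
        (\<Sum>c\<in>Basis. (g1 c x * g2 b x + f1 x * H2 b c x) * (h \<bullet> c)))) (at x)"
    using has_derivative_add[OF has_derivative_mult[OF D1(2)[OF b x] D2(1)[OF x]]
      has_derivative_mult[OF D1(1)[OF x] D2(2)[OF b x]]] unfolding eq .
  then show "((\<lambda>y. g1 b y * f2 y + f1 y * g2 b y) has_derivative (\<lambda>h. \<Sum>c\<in>Basis.
      (H1 b c x * f2 x + g1 b x * g2 c x + (g1 c x * g2 b x + f1 x * H2 b c x)) * (h \<bullet> c))) (at x)"
    by (simp only: sum.distrib[symmetric] distrib_right)
qed (intro continuous_intros C2_dataD(3-5)[OF d1] C2_dataD(3-5)[OF d2]; assumption)

lemma C2_data_compose:
  fixes \<phi> :: "real \<Rightarrow> real"
  assumes d: "C2_data U f g H"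
    and \<phi>: "\<And>x. x \<in> U \<Longrightarrow> (\<phi> has_real_derivative \<phi>1 (f x)) (at (f x))"
      "\<And>x. x \<in> U \<Longrightarrow> (\<phi>1 has_real_derivative \<phi>2 (f x)) (at (f x))"
      "continuous_on (f ` U) \<phi>2"
  shows "C2_data U (\<lambda>y. \<phi> (f y)) (\<lambda>b y. \<phi>1 (f y) * g b y)
    (\<lambda>b c y. \<phi>2 (f y) * g c y * g b y + \<phi>1 (f y) * H b c y)"
proof (rule C2_dataI)
  fix x assume x: "x \<in> U"
  have c0: "((\<lambda>y. \<phi> (f y)) has_derivative (\<lambda>h. \<phi>1 (f x) * (\<Sum>b\<in>Basis. g b x * (h \<bullet> b)))) (at x)"
    using has_derivative_compose[OF C2_dataD(1)[OF d x] \<phi>(1)[OF x, unfolded has_field_derivative_def]] .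
  have c1: "((\<lambda>y. \<phi>1 (f y)) has_derivative (\<lambda>h. \<phi>2 (f x) * (\<Sum>b\<in>Basis. g b x * (h \<bullet> b)))) (at x)"
    using has_derivative_compose[OF C2_dataD(1)[OF d x] \<phi>(2)[OF x, unfolded has_field_derivative_def]] .
  show "((\<lambda>y. \<phi> (f y)) has_derivative (\<lambda>h. \<Sum>b\<in>Basis. \<phi>1 (f x) * g b x * (h \<bullet> b))) (at x)"
    using c0 by (simp only: sum_distrib_left mult.assoc)
  fix b :: 'a assume b: "b \<in> Basis"
  have eq: "\<phi>1 (f x) * (\<Sum>c\<in>Basis. H b c x * (h \<bullet> c)) + \<phi>2 (f x) * (\<Sum>c\<in>Basis. g c x * (h \<bullet> c)) * g b x =
      (\<Sum>c\<in>Basis. (\<phi>2 (f x) * g c x * g b x + \<phi>1 (f x) * H b c x) * (h \<bullet> c))" for h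
    by (simp add: sum_distrib_left sum_distrib_right sum.distrib[symmetric] algebra_simps)
  show "((\<lambda>y. \<phi>1 (f y) * g b y) has_derivative
      (\<lambda>h. \<Sum>c\<in>Basis. (\<phi>2 (f x) * g c x * g b x + \<phi>1 (f x) * H b c x) * (h \<bullet> c))) (at x)"
    using has_derivative_mult[OF c1 C2_dataD(2)[OF d b x]] unfolding eq .
next
  have "continuous_on U (\<lambda>y. \<phi>2 (f y))"
    by (rule continuous_on_compose2[OF \<phi>(3) C2_dataD(4)[OF d]]) simp
  moreover have "continuous_on U (\<lambda>y. \<phi>1 (f y))"
  proof -
    have "continuous (at x) (\<lambda>y. \<phi>1 (f y))" if x: "x \<in> U" for x
      using has_derivative_compose[OF C2_dataD(1)[OF d x] \<phi>(2)[OF x, unfolded has_field_derivative_def]]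
      by (rule has_derivative_continuous)
    then show ?thesis by (intro continuous_at_imp_continuous_on) blast
  qed
  ultimately show "continuous_on U (\<lambda>y. \<phi>2 (f y) * g c y * g b y + \<phi>1 (f y) * H b c y)"
    if "b \<in> Basis" "c \<in> Basis" for b c
    using that by (intro continuous_intros C2_dataD(3-5)[OF d])
qed

section \<open>Surface measure and moments on the sphere\<close>

lemma distr_lborel_orthogonal:
  fixes R :: "real ^ 3 \<Rightarrow> real ^ 3"
  assumes R: "orthogonal_transformation R"
  shows "distr lborel borel R = lborel"
proof (rule lborel_eqI[symmetric])
  fix l u :: "real ^ 3" assume lu: "\<And>b. b \<in> Basis \<Longrightarrow> l \<bullet> b \<le> u \<bullet> b"
  have lin: "linear R" and bij: "bij R"
    using R by (auto simp: orthogonal_transformation_linear orthogonal_transformation_bij)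
  have Rc: "continuous_on UNIV R"
    using lin by (simp add: linear_continuous_on linear_conv_bounded_linear)
  then have Rm: "R \<in> borel_measurable borel" by (rule borel_measurable_continuous_onI)
  have iR: "orthogonal_transformation (inv R)" by (rule orthogonal_transformation_inv[OF R])
  have eq: "R -` box l u = inv R ` box l u" by (rule bij_vimage_eq_inv_image[OF bij])
  have bl: "box l u \<in> lmeasurable" by simp
  have "open (R -` box l u)"
    by (rule open_vimage[OF open_box Rc])
  then have sb: "inv R ` box l u \<in> sets borel" using eq by simp
  have "emeasure (distr lborel borel R) (box l u) = emeasure lebesgue (inv R ` box l u)"
    using Rm sb by (simp add: emeasure_distr eq)
  also have "\<dots> = ennreal (measure lebesgue (inv R ` box l u))"
    using measurable_orthogonal_image[OF iR bl] by (intro emeasure_eq_measure2) auto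
  also have "\<dots> = ennreal (measure lebesgue (box l u))"
    by (simp add: measure_orthogonal_image[OF iR bl])
  also have "\<dots> = ennreal (\<Prod>b\<in>Basis. (u - l) \<bullet> b)"
    using lu by (simp add: measure_lborel_box_eq inner_diff_left)
  finally show "emeasure (distr lborel borel R) (box l u) = (\<Prod>b\<in>Basis. (u - l) \<bullet> b)" .
qed simp

lemma space_round_sphere: "space (vol round_sphere) = sphere 0 1"
  and sets_round_sphere: "sets (vol round_sphere) = sets (restrict_space borel (sphere 0 1))"
  by (simp_all add: round_sphere_def space_scale_measure space_restrict_space)

lemma norm_radial_proj: "y \<noteq> 0 \<Longrightarrow> norm (y /\<^sub>R norm y) = 1"
  by (simp add: sgn_div_norm[symmetric] norm_sgn)

lemma radial_proj_measurable:
  "(\<lambda>y :: real ^ 3. y /\<^sub>R norm y) \<in> measurable (restrict_space lborel (ball 0 1 - {0})) (restrict_space borel (sphere 0 1))"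
proof (rule measurable_restrict_space2)
  show "(\<lambda>y :: real ^ 3. y /\<^sub>R norm y) \<in> space (restrict_space lborel (ball 0 1 - {0})) \<rightarrow> sphere (0::real ^ 3) 1"
    by (auto simp: space_restrict_space norm_radial_proj simp del: norm_scaleR)
  have "(\<lambda>y::real ^ 3. y /\<^sub>R norm y) \<in> borel_measurable lborel" by measurable
  then show "(\<lambda>y::real ^ 3. y /\<^sub>R norm y) \<in> borel_measurable (restrict_space lborel (ball 0 1 - {0}))"
    by (rule measurable_restrict_space1)
qed

lemma emeasure_round_sphere: "emeasure (vol round_sphere) (sphere 0 1) = ennreal (4 * pi)"
proof -
  have v: "emeasure lborel (ball (0 :: real ^ 3) 1) = ennreal (4 / 3 * pi)"
    by (subst emeasure_ball) (simp_all add: unit_ball_vol_numeral eval_nat_numeral)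
  have "emeasure lborel (ball (0 :: real ^ 3) 1 - {0}) = emeasure lborel (ball (0 :: real ^ 3) 1)"
    by (rule emeasure_Diff_null_set) (auto simp: null_sets_def)
  moreover have "(\<lambda>y::real ^ 3. y /\<^sub>R norm y) -` sphere 0 1 \<inter> (ball 0 1 - {0}) = ball 0 1 - {0}"
    by (auto simp: norm_radial_proj simp del: norm_scaleR)
  ultimately have "emeasure (distr (restrict_space lborel (ball 0 1 - {0})) (restrict_space borel (sphere 0 1))
      (\<lambda>y. y /\<^sub>R norm y)) (sphere (0 :: real ^ 3) 1) = ennreal (4 / 3 * pi)"
    using v by (subst emeasure_distr[OF radial_proj_measurable])
      (simp_all add: sets_restrict_space_iff space_restrict_space emeasure_restrict_space)
  then show ?thesis
    by (simp add: round_sphere_def ennreal_mult'[symmetric] flip: ennreal_numeral)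
qed

lemma measure_round_sphere: "measure (vol round_sphere) (sphere 0 1) = 4 * pi"
  by (simp only: measure_def emeasure_round_sphere) simp

lemma integral_round_sphere:
  assumes f: "continuous_on (sphere 0 1) f"
  shows "(LINT y|vol round_sphere. f y) = 3 * (LINT y:ball 0 1 - {0}|lborel. f (y /\<^sub>R norm y) :: real)"
proof -
  have fm: "f \<in> borel_measurable (restrict_space borel (sphere 0 1))"
    by (rule borel_measurable_continuous_on_restrict[OF f])
  let ?D = "distr (restrict_space lborel (ball 0 1 - {0})) (restrict_space borel (sphere 0 1)) (\<lambda>y::real ^ 3. y /\<^sub>R norm y)"
  have "vol round_sphere = density ?D (\<lambda>_. ennreal 3)"
  proof (rule measure_eqI)
    fix A assume "A \<in> sets (vol round_sphere)"
    then have "A \<in> sets ?D" by (simp add: sets_round_sphere)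
    then show "emeasure (vol round_sphere) A = emeasure (density ?D (\<lambda>_. ennreal 3)) A"
      by (subst emeasure_density) (simp_all add: round_sphere_def nn_integral_cmult_indicator)
  qed (simp add: sets_round_sphere)
  then have "(LINT y|vol round_sphere. f y) = (LINT y|density ?D (\<lambda>_. ennreal 3). f y)" by simp
  also have "\<dots> = (LINT y|?D. 3 *\<^sub>R f y)"
    by (rule integral_density) (use fm in auto)
  also have "\<dots> = 3 * (LINT y|?D. f y)" by simp
  also have "(LINT y|?D. f y) = (LINT y|restrict_space lborel (ball 0 1 - {0}). f (y /\<^sub>R norm y))"
    by (rule integral_distr[OF radial_proj_measurable fm])
  also have "\<dots> = (LINT y:ball 0 1 - {0}|lborel. f (y /\<^sub>R norm y))"
    unfolding set_lebesgue_integral_def by (rule integral_restrict_space) auto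
  finally show ?thesis .
qed

lemma integral_round_sphere_rotate:
  assumes f: "continuous_on (sphere 0 1) f" and R: "orthogonal_transformation R"
  shows "(LINT y|vol round_sphere. f (R y)) = (LINT y|vol round_sphere. f y :: real)"
proof -
  have lin: "linear R" and nR: "norm (R y) = norm y" for y
    using R by (auto simp: orthogonal_transformation)
  have Rc: "continuous_on A R" for A
    using lin by (simp add: linear_continuous_on linear_conv_bounded_linear)
  have fR: "continuous_on (sphere 0 1) (\<lambda>y. f (R y))"
    by (rule continuous_on_compose2[OF f Rc]) (auto simp: nR)
  let ?F = "\<lambda>y. indicator (ball 0 1 - {0}) y *\<^sub>R f (y /\<^sub>R norm y)"
  have Fm: "?F \<in> borel_measurable borel"
  proof (rule borel_measurable_continuous_on_indicator)
    have "y /\<^sub>R norm y \<in> sphere 0 1" if "y \<in> ball 0 1 - {0}" for y :: "real ^ 3"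
      using norm_radial_proj[of y] that by (simp del: norm_scaleR)
    then have sub: "(\<lambda>y::real ^ 3. y /\<^sub>R norm y) ` (ball 0 1 - {0}) \<subseteq> sphere 0 1"
      by (rule image_subsetI)
    show "continuous_on (ball 0 1 - {0}) (\<lambda>y. f (y /\<^sub>R norm y))"
      by (rule continuous_on_compose2[OF f _ sub]) (intro continuous_intros, auto)
  qed simp
  have "(LINT y|lborel. ?F y) = (LINT y|distr lborel borel R. ?F y)"
    by (simp add: distr_lborel_orthogonal[OF R])
  also have "\<dots> = (LINT y|lborel. ?F (R y))"
    by (rule integral_distr) (use Fm borel_measurable_continuous_onI[OF Rc] in auto)
  also have "\<dots> = (LINT y|lborel. indicator (ball 0 1 - {0}) y *\<^sub>R f (R (y /\<^sub>R norm y)))"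
  proof (rule Bochner_Integration.integral_cong)
    fix y
    have "R y = 0 \<longleftrightarrow> y = 0" using nR[of y] by (metis norm_eq_zero)
    then show "?F (R y) = indicator (ball 0 1 - {0}) y *\<^sub>R f (R (y /\<^sub>R norm y))"
      by (simp add: nR linear_cmul[OF lin] indicator_def)
  qed simp
  finally show ?thesis
    unfolding integral_round_sphere[OF f] integral_round_sphere[OF fR] set_lebesgue_integral_def by simp
qed

definition sphere_moment :: "nat \<Rightarrow> real" where
  "sphere_moment k = (LINT y|vol round_sphere. (y $ 1) ^ k)"

lemma finite_round_sphere: "finite_measure (vol round_sphere)"
  by (rule finite_measureI) (simp only: space_round_sphere emeasure_round_sphere, simp)

lemma round_sphere_integrable:
  assumes "continuous_on (sphere 0 1) (f :: _ \<Rightarrow> real)"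
  shows "integrable (vol round_sphere) f"
proof -
  interpret finite_measure "vol round_sphere" by (rule finite_round_sphere)
  have "bounded (f ` sphere 0 1)"
    by (rule compact_imp_bounded[OF compact_continuous_image[OF assms compact_sphere]])
  then obtain C where C: "\<forall>z\<in>f ` sphere 0 1. norm z \<le> C" unfolding bounded_iff by (rule exE)
  have "f \<in> borel_measurable (vol round_sphere)"
    unfolding measurable_cong_sets[OF sets_round_sphere refl]
    by (rule borel_measurable_continuous_on_restrict[OF assms])
  moreover have "AE y in vol round_sphere. norm (f y) \<le> C"
    by (rule AE_I2, rule C[THEN bspec], rule imageI) (simp only: space_round_sphere)
  ultimately show ?thesis by (intro integrable_const_bound)
qed

text \<open>An orthogonal map takes the direction of \<open>a\<close> to the first axis and
  preserves the surface measure. That only the norm of \<open>a\<close> matters is what the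
  coefficient comparison for mixed moments exploits.\<close>

lemma sphere_moment_inner:
  fixes a :: "real ^ 3"
  shows "(LINT y|vol round_sphere. (a \<bullet> y) ^ k) = norm a ^ k * sphere_moment k"
proof (cases "a = 0")
  case True
  then show ?thesis
    by (cases k) (simp_all add: sphere_moment_def)
next
  case False
  define u where "u = a /\<^sub>R norm a"
  have "norm u = norm (axis 1 1 :: real ^ 3)" using False by (simp add: u_def)
  then obtain R where R: "orthogonal_transformation R" "R u = (axis 1 1 :: real ^ 3)"
    by (rule orthogonal_transformation_exists)
  have "u \<bullet> y = (R y) $ 1" for y
  proof -
    have "u \<bullet> y = R u \<bullet> R y" using R(1) by (simp add: orthogonal_transformation_def)
    then show ?thesis unfolding R(2) by (simp add: inner_axis')
  qed
  moreover have "a \<bullet> y = norm a * (u \<bullet> y)" for y using False by (simp add: u_def)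
  ultimately have "(LINT y|vol round_sphere. (a \<bullet> y) ^ k) = (LINT y|vol round_sphere. norm a ^ k * ((R y) $ 1) ^ k)"
    by (simp add: power_mult_distrib)
  also have "\<dots> = norm a ^ k * (LINT y|vol round_sphere. ((R y) $ 1) ^ k)" by simp
  also have "(LINT y|vol round_sphere. ((R y) $ 1) ^ k) = sphere_moment k"
    unfolding sphere_moment_def
    by (rule integral_round_sphere_rotate[OF _ R(1)]) (intro continuous_intros)
  finally show ?thesis .
qed

text \<open>Integrating \<open>(y $ i + \<theta> * y $ j) ^ (2 * m)\<close> gives
  \<open>(1 + \<theta>\<^sup>2) ^ m * sphere_moment (2 * m)\<close>, as the vector of coefficients
  has squared norm \<open>1 + \<theta>\<^sup>2\<close>. The relation is the comparison of the
  coefficients of \<open>\<theta>\<^sup>2\<close>, with \<open>2 * m choose 2\<close> equal to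
  \<open>m * (2 * m - 1)\<close>.\<close>

lemma sphere_moment_cross:
  fixes i j :: 3
  assumes ij: "i \<noteq> j" and m: "1 \<le> m"
  shows "(2 * real m - 1) * (LINT y|vol round_sphere. (y $ i) ^ (2 * m - 2) * (y $ j)\<^sup>2) = sphere_moment (2 * m)"
proof -
  define C where "C l = (LINT y|vol round_sphere. (y $ i) ^ (2 * m - l) * (y $ j) ^ l)" for l
  define d where "d l = (if even l then real (m choose (l div 2)) * sphere_moment (2 * m) else 0)" for l
  have "(\<Sum>l\<le>2 * m. (real (2 * m choose l) * C l) * \<theta> ^ l) = (\<Sum>l\<le>2 * m. d l * \<theta> ^ l)" for \<theta> :: real
  proof -
    let ?a = "axis i 1 + \<theta> *\<^sub>R axis j 1 :: real ^ 3"
    have "norm ?a ^ 2 = 1 + \<theta>\<^sup>2"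
      unfolding power2_norm_eq_inner
      using ij by (simp add: inner_add_left inner_add_right inner_axis_axis power2_eq_square)
    then have na: "norm ?a ^ (2 * m) = (1 + \<theta>\<^sup>2) ^ m" by (simp add: power_mult)
    have "(?a \<bullet> y) ^ (2 * m) = (\<Sum>l\<le>2 * m. real (2 * m choose l) * \<theta> ^ l * ((y $ i) ^ (2 * m - l) * (y $ j) ^ l))" for y
    proof -
      have "?a \<bullet> y = \<theta> * y $ j + y $ i" by (simp add: inner_add_left inner_axis')
      then show ?thesis
        by (simp add: binomial_ring power_mult_distrib mult_ac)
    qed
    then have "(LINT y|vol round_sphere. (?a \<bullet> y) ^ (2 * m)) =
        (LINT y|vol round_sphere. (\<Sum>l\<le>2 * m. real (2 * m choose l) * \<theta> ^ l * ((y $ i) ^ (2 * m - l) * (y $ j) ^ l)))"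
      by simp
    also have "\<dots> = (\<Sum>l\<le>2 * m. LINT y|vol round_sphere. real (2 * m choose l) * \<theta> ^ l * ((y $ i) ^ (2 * m - l) * (y $ j) ^ l))"
      by (rule Bochner_Integration.integral_sum) (intro round_sphere_integrable continuous_intros)
    also have "\<dots> = (\<Sum>l\<le>2 * m. (real (2 * m choose l) * C l) * \<theta> ^ l)"
      by (intro sum.cong refl, subst integral_mult_right_zero) (simp only: C_def mult_ac)
    finally have lhs: "(\<Sum>l\<le>2 * m. (real (2 * m choose l) * C l) * \<theta> ^ l) = (1 + \<theta>\<^sup>2) ^ m * sphere_moment (2 * m)"
      unfolding sphere_moment_inner na by simp
    have "(\<Sum>l\<le>2 * m. d l * \<theta> ^ l) = (\<Sum>l\<in>(\<lambda>k. 2 * k) ` {..m}. d l * \<theta> ^ l)"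
    proof (rule sum.mono_neutral_right)
      show "\<forall>l\<in>{..2 * m} - (\<lambda>k. 2 * k) ` {..m}. d l * \<theta> ^ l = 0"
        by (auto simp: d_def elim!: evenE)
    qed auto
    also have "\<dots> = (\<Sum>k\<le>m. d (2 * k) * \<theta> ^ (2 * k))"
      by (subst sum.reindex) (auto simp: inj_on_def)
    also have "\<dots> = (\<Sum>k\<le>m. real (m choose k) * (\<theta>\<^sup>2) ^ k) * sphere_moment (2 * m)"
      unfolding sum_distrib_right by (rule sum.cong) (simp_all add: d_def power_mult)
    also have "(\<Sum>k\<le>m. real (m choose k) * (\<theta>\<^sup>2) ^ k) = (\<theta>\<^sup>2 + 1) ^ m"
      by (simp add: binomial_ring)
    finally show ?thesis using lhs by (simp add: add.commute)
  qed
  then have "\<forall>l\<le>2 * m. real (2 * m choose l) * C l = d l"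
    by (subst polyfun_eq_coeffs[symmetric]) blast
  then have "real (2 * m choose 2) * C 2 = real m * sphere_moment (2 * m)"
    using m by (auto simp: d_def dest!: spec[of _ 2])
  moreover have "real (2 * m choose 2) = real m * (2 * real m - 1)"
    using m by (simp add: choose_two of_nat_diff)
  ultimately show ?thesis using m by (simp add: C_def power2_eq_square)
qed

text \<open>Multiplying the equation of the sphere by \<open>(y $ 1) ^ (2 * m)\<close> and
  integrating expresses each even moment through the next one: the two mixed moments contribute
  \<open>1 / (2 * m + 1)\<close> of it each, so the ratio of consecutive even moments is
  \<open>(2 * m + 3) / (2 * m + 1)\<close>.\<close>

lemma sphere_moment_even: "sphere_moment (2 * m) = 4 * pi / (2 * real m + 1)"
proof (induction m)
  case 0
  then show ?case by (simp add: sphere_moment_def space_round_sphere measure_round_sphere)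
next
  case (Suc m)
  let ?n = "2 * m"
  have s: "(y $ 1)\<^sup>2 + (y $ 2)\<^sup>2 + (y $ 3)\<^sup>2 = 1" if "y \<in> sphere 0 1" for y :: "real ^ 3"
  proof -
    have "y \<bullet> y = 1" using that by (simp add: norm_eq_1)
    then show ?thesis by (simp add: inner_vec_def sum_3 power2_eq_square)
  qed
  have i: "integrable (vol round_sphere) (\<lambda>y. (y $ 1) ^ ?n * (y $ j)\<^sup>2)" for j
    by (intro round_sphere_integrable continuous_intros)
  have "sphere_moment ?n = (LINT y|vol round_sphere. (y $ 1) ^ ?n * (y $ 1)\<^sup>2 + (y $ 1) ^ ?n * (y $ 2)\<^sup>2 + (y $ 1) ^ ?n * (y $ 3)\<^sup>2)"
    unfolding sphere_moment_def
    by (rule Bochner_Integration.integral_cong)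
      (simp_all add: space_round_sphere s distrib_left[symmetric])
  also have "\<dots> = (LINT y|vol round_sphere. (y $ 1) ^ ?n * (y $ 1)\<^sup>2) +
      (LINT y|vol round_sphere. (y $ 1) ^ ?n * (y $ 2)\<^sup>2) + (LINT y|vol round_sphere. (y $ 1) ^ ?n * (y $ 3)\<^sup>2)"
    using i[of 1] i[of 2] i[of 3] by simp
  also have "(LINT y|vol round_sphere. (y $ 1) ^ ?n * (y $ 1)\<^sup>2) = sphere_moment (2 * Suc m)"
    by (simp add: sphere_moment_def power2_eq_square mult_ac)
  also have "(LINT y|vol round_sphere. (y $ 1) ^ ?n * (y $ 2)\<^sup>2) = sphere_moment (2 * Suc m) / (2 * real m + 1)"
    using sphere_moment_cross[of 1 2 "Suc m"] by (simp add: field_simps)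
  also have "(LINT y|vol round_sphere. (y $ 1) ^ ?n * (y $ 3)\<^sup>2) = sphere_moment (2 * Suc m) / (2 * real m + 1)"
    using sphere_moment_cross[of 1 3 "Suc m"] by (simp add: field_simps)
  finally have eq: "sphere_moment ?n = sphere_moment (2 * Suc m) + sphere_moment (2 * Suc m) / (2 * real m + 1) +
      sphere_moment (2 * Suc m) / (2 * real m + 1)" .
  define q D where "q = sphere_moment (2 * Suc m)" and "D = 2 * real m + 1"
  have D: "0 < D" by (simp add: D_def)
  have "q + q / D + q / D = 4 * pi / D" using eq Suc by (simp only: q_def D_def)
  then have "q * D + 2 * q = 4 * pi" using D by (simp add: field_simps)
  then have "q = 4 * pi / (D + 2)" using D by (simp add: field_simps)
  then show ?case by (simp add: q_def D_def algebra_simps)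
qed

lemma sphere_moment_odd: "odd k \<Longrightarrow> sphere_moment k = 0"
proof -
  assume k: "odd k"
  have "(LINT y|vol round_sphere. (y $ 1) ^ k) = (LINT y|vol round_sphere. ((- y) $ 1) ^ k)"
    by (rule integral_round_sphere_rotate[symmetric, of "\<lambda>y. (y $ 1) ^ k"])
      (auto intro!: continuous_intros orthogonal_transformation_neg[THEN iffD2] orthogonal_transformation_id simp: orthogonal_transformation_def linear_uminus inner_minus_left linear_iff)
  also have "\<dots> = - (LINT y|vol round_sphere. (y $ 1) ^ k)" using k by simp
  finally show ?thesis by (simp add: sphere_moment_def)
qed

text \<open>By Archimedes' theorem \<open>(1 + x \<bullet> y) / 2\<close> is uniform on
  \<open>[0, 1]\<close>. Here this is recovered from the moments: the denominator
  \<open>l + 1\<close> turns \<open>n choose l\<close> into \<open>Suc n choose Suc l\<close>, and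
  the binomial coefficients of \<open>Suc n\<close> with odd lower index add up to
  \<open>2 ^ n\<close>.\<close>

lemma integral_sphere_zonal_power:
  assumes x: "norm x = 1"
  shows "(LINT y|vol round_sphere. ((1 + x \<bullet> y) / 2) ^ n) = 4 * pi / (real n + 1)"
proof -
  have "((1 + x \<bullet> y) / 2) ^ n = (\<Sum>l\<le>n. real (n choose l) / 2 ^ n * (x \<bullet> y) ^ l)" for y :: "real ^ 3"
    by (simp add: power_divide binomial_ring[of "x \<bullet> y" 1 n] add.commute[of 1] sum_divide_distrib)
  then have "(LINT y|vol round_sphere. ((1 + x \<bullet> y) / 2) ^ n) =
      (LINT y|vol round_sphere. (\<Sum>l\<le>n. real (n choose l) / 2 ^ n * (x \<bullet> y) ^ l))" by simp
  also have "\<dots> = (\<Sum>l\<le>n. LINT y|vol round_sphere. real (n choose l) / 2 ^ n * (x \<bullet> y) ^ l)"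
    by (rule Bochner_Integration.integral_sum) (intro round_sphere_integrable continuous_intros)
  also have "\<dots> = (\<Sum>l\<le>n. real (n choose l) / 2 ^ n * sphere_moment l)"
    by (simp add: sphere_moment_inner x)
  also have "\<dots> = (\<Sum>l\<le>n. 4 * pi / 2 ^ n / (real n + 1) * (if odd (Suc l) then real (Suc n choose Suc l) else 0))"
  proof (rule sum.cong[OF refl])
    fix l
    show "real (n choose l) / 2 ^ n * sphere_moment l =
        4 * pi / 2 ^ n / (real n + 1) * (if odd (Suc l) then real (Suc n choose Suc l) else 0)"
    proof (cases "even l")
      case True
      then obtain j where "l = 2 * j" by (elim evenE)
      then have sm: "sphere_moment l = 4 * pi / (real l + 1)"
        using sphere_moment_even[of j] by simp
      have "real (Suc l) * real (Suc n choose Suc l) = real (Suc n) * real (n choose l)"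
        using Suc_times_binomial_eq[of n l] by (metis mult.commute of_nat_mult)
      then have "real (Suc n choose Suc l) = (real n + 1) * real (n choose l) / (real l + 1)"
        by (simp add: field_simps)
      then show ?thesis using True unfolding sm by simp
    next
      case False
      then show ?thesis by (simp add: sphere_moment_odd)
    qed
  qed
  also have "\<dots> = 4 * pi / 2 ^ n / (real n + 1) * (\<Sum>l\<le>n. if odd (Suc l) then real (Suc n choose Suc l) else 0)"
    by (simp only: sum_distrib_left)
  also have "(\<Sum>l\<le>n. if odd (Suc l) then real (Suc n choose Suc l) else 0) =
      (\<Sum>l\<le>Suc n. if odd l then real (Suc n choose l) else 0)"
    by (simp only: sum.atMost_Suc_shift) simp
  also have "\<dots> = 2 ^ n"
    using choose_odd_sum[of "Suc n", where 'a=real] by simp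
  finally show ?thesis by simp
qed

text \<open>For a unit vector \<open>x\<close> the function is the cosine of the angle with
  \<open>x\<close>, constant along rays; on the sphere its gradient is the tangential part of
  \<open>x\<close>. The inverse norm is written as a power of \<open>y \<bullet> y\<close> so that
  the chain rule starts from a polynomial.\<close>

lemma C2_data_sphere_angle:
  fixes x :: "real ^ 3"
  shows "\<exists>g H. C2_data (- {0}) (\<lambda>y. (x \<bullet> y) * (y \<bullet> y) powr (- 1 / 2)) g H \<and>
    (\<forall>y b. norm y = 1 \<longrightarrow> g b y = x \<bullet> b - (x \<bullet> y) * (y \<bullet> b)) \<and>
    (\<forall>y b. norm y = 1 \<longrightarrow> b \<in> Basis \<longrightarrow>
      H b b y = - 2 * (x \<bullet> b) * (y \<bullet> b) + (x \<bullet> y) * (3 * (y \<bullet> b)\<^sup>2 - 1))"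
proof -
  have pos: "0 < y \<bullet> y" if "y \<in> - {0}" for y :: "real ^ 3" using that by simp
  have r: "C2_data (- {0}) (\<lambda>y::real ^ 3. (y \<bullet> y) powr (- 1 / 2))
      (\<lambda>b y. (- 1 / 2 * (y \<bullet> y) powr (- 3 / 2)) * (2 * (y \<bullet> b)))
      (\<lambda>b c y. (3 / 4 * (y \<bullet> y) powr (- 5 / 2)) * (2 * (y \<bullet> c)) * (2 * (y \<bullet> b)) +
        (- 1 / 2 * (y \<bullet> y) powr (- 3 / 2)) * (2 * (b \<bullet> c)))"
  proof (rule C2_data_compose[OF C2_data_inner_self])
    fix y :: "real ^ 3" assume "y \<in> - {0}"
    note p = pos[OF this]
    show "((\<lambda>r. r powr (- 1 / 2)) has_real_derivative - 1 / 2 * (y \<bullet> y) powr (- 3 / 2)) (at (y \<bullet> y))"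
      using p by (auto intro!: derivative_eq_intros)
    show "((\<lambda>r. - 1 / 2 * r powr (- 3 / 2)) has_real_derivative 3 / 4 * (y \<bullet> y) powr (- 5 / 2)) (at (y \<bullet> y))"
      using p by (auto intro!: derivative_eq_intros)
  next
    show "continuous_on ((\<lambda>y. y \<bullet> y) ` (- {0 :: real ^ 3})) (\<lambda>r. 3 / 4 * r powr (- 5 / 2))"
      by (intro continuous_intros) auto
  qed
  have n1: "y \<bullet> y = 1" if "norm y = 1" for y :: "real ^ 3" using that by (simp add: norm_eq_1)
  show ?thesis
    by (intro exI conjI, rule C2_data_mult[OF C2_data_inner r])
      (auto simp: n1 inner_Basis power2_eq_square algebra_simps)
qed

lemma radial_extension_inner: "radial_extension (\<lambda>y. \<phi> (x \<bullet> y)) y = \<phi> ((x \<bullet> y) * (y \<bullet> y) powr (- 1 / 2))"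
proof -
  have "(y \<bullet> y) powr (- 1 / 2) = inverse (norm y)"
  \<comment> \<open>At the origin both sides are 0, by the conventions for \<open>powr\<close> and
    \<open>inverse\<close>.\<close>
  proof (cases "y = 0")
    case False
    then have n: "0 < norm y" by simp
    have "y \<bullet> y = norm y powr 2" using n by (simp add: powr_numeral power2_norm_eq_inner)
    then have "(y \<bullet> y) powr (- 1 / 2) = norm y powr (- 1)" by (simp only: powr_powr) simp
    also have "\<dots> = inverse (norm y)" using n by (simp add: powr_minus)
    finally show ?thesis .
  qed simp
  then show ?thesis unfolding radial_extension_def by (simp only: inner_scaleR_right mult.commute)
qed

text \<open>On functions of \<open>s = x \<bullet> y\<close> the Laplacian is the Legendre operator
  \<open>(1 - s\<^sup>2) * \<phi>'' - 2 * s * \<phi>'\<close>. In the variable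
  \<open>v = (1 + s) / 2\<close> it sends \<open>v ^ (n + 1)\<close> to a combination of
  \<open>v ^ n\<close> and \<open>v ^ (n + 1)\<close> alone, so the heat equation closes on these
  powers.\<close>

lemma zonal_power:
  fixes x :: "real ^ 3"
  assumes x: "norm x = 1"
  defines "f \<equiv> \<lambda>n y. ((1 + x \<bullet> y) / 2) ^ n"
  shows zonal_power_test: "f (Suc n) \<in> test round_sphere"
    and zonal_power_laplacian: "y \<in> sphere 0 1 \<Longrightarrow> laplacian round_sphere (f (Suc n)) y =
      real (Suc n) ^ 2 * f n y - real (Suc n) * (real n + 2) * f (Suc n) y"
proof -
  let ?u = "\<lambda>y. (x \<bullet> y) * (y \<bullet> y) powr (- 1 / 2)"
  obtain g H where d: "C2_data (- {0}) ?u g H"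
    and g: "\<And>y b. norm y = 1 \<Longrightarrow> g b y = x \<bullet> b - (x \<bullet> y) * (y \<bullet> b)"
    and H: "\<And>y b. norm y = 1 \<Longrightarrow> b \<in> Basis \<Longrightarrow>
      H b b y = - 2 * (x \<bullet> b) * (y \<bullet> b) + (x \<bullet> y) * (3 * (y \<bullet> b)\<^sup>2 - 1)"
    using C2_data_sphere_angle[of x] by blast
  let ?\<phi>1 = "\<lambda>u. real (Suc n) / 2 * ((1 + u) / 2) ^ n"
  \<comment> \<open>For \<open>n = 0\<close> the truncated exponent \<open>n - 1\<close> does no
    harm, since the factor \<open>real n\<close> vanishes.\<close>
  let ?\<phi>2 = "\<lambda>u. real (Suc n) / 2 * (real n / 2 * ((1 + u) / 2) ^ (n - 1)) :: real"
  have D: "C2_data (- {0}) (\<lambda>y. ((1 + ?u y) / 2) ^ Suc n) (\<lambda>b y. ?\<phi>1 (?u y) * g b y)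
      (\<lambda>b c y. ?\<phi>2 (?u y) * g c y * g b y + ?\<phi>1 (?u y) * H b c y)"
  proof (rule C2_data_compose[OF d])
    fix y :: "real ^ 3"
    have lin: "((\<lambda>u. (1 + u) / 2) has_real_derivative 1 / 2) (at z)" for z :: real
      by (auto intro!: derivative_eq_intros)
    show "((\<lambda>u. ((1 + u) / 2) ^ Suc n) has_real_derivative ?\<phi>1 (?u y)) (at (?u y))"
      using DERIV_power[OF lin[of "?u y"], of "Suc n"] by simp
    show "(?\<phi>1 has_real_derivative ?\<phi>2 (?u y)) (at (?u y))"
      using DERIV_cmult[OF DERIV_power[OF lin[of "?u y"], of n], of "real (Suc n) / 2"] by simp
  next
    show "continuous_on (?u ` (- {0})) ?\<phi>2" by (intro continuous_intros) auto
  qed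
  have re: "radial_extension (f (Suc n)) = (\<lambda>y. ((1 + ?u y) / 2) ^ Suc n)"
    unfolding f_def by (rule ext) (rule radial_extension_inner[of "\<lambda>s. ((1 + s) / 2) ^ Suc n"])
  show "f (Suc n) \<in> test round_sphere"
    using C2_on_of_data[OF D] by (simp add: round_sphere_def re)
  show "laplacian round_sphere (f (Suc n)) y =
      real (Suc n) ^ 2 * f n y - real (Suc n) * (real n + 2) * f (Suc n) y" if "y \<in> sphere 0 1"
  proof -
    have ny: "norm y = 1" using that by simp
    then have y0: "y \<in> - {0}" and yy: "y \<bullet> y = 1" by (auto simp: norm_eq_1)
    have xx: "x \<bullet> x = 1" using x by (simp add: norm_eq_1)
    define s where "s = x \<bullet> y"
    have us: "?u y = s" by (simp add: yy s_def)
    have G: "(\<Sum>b\<in>Basis. g b y * g b y) = 1 - s\<^sup>2"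
    proof -
      have "(\<Sum>b\<in>Basis. g b y * g b y) = (\<Sum>b\<in>Basis. ((x - s *\<^sub>R y) \<bullet> b) * ((x - s *\<^sub>R y) \<bullet> b))"
        by (rule sum.cong) (simp_all add: g[OF ny] s_def inner_diff_left)
      also have "\<dots> = (x - s *\<^sub>R y) \<bullet> (x - s *\<^sub>R y)" by (rule inner_eq_sum_Basis[symmetric])
      also have "\<dots> = 1 - s\<^sup>2"
        by (simp add: inner_diff_left inner_diff_right xx yy inner_commute[of y x] s_def[symmetric] power2_eq_square)
      finally show ?thesis .
    qed
    \<comment> \<open>Linear forms restricted to the sphere are eigenfunctions of the Laplacian with
      eigenvalue -2.\<close>
    have Hs: "(\<Sum>b\<in>Basis. H b b y) = - 2 * s"
    proof -
      have "(\<Sum>b\<in>Basis. H b b y) = (\<Sum>b\<in>Basis. - 2 * ((x \<bullet> b) * (y \<bullet> b)) + (3 * s * ((y \<bullet> b) * (y \<bullet> b)) - s))"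
        by (rule sum.cong) (simp_all add: H[OF ny] s_def power2_eq_square algebra_simps)
      also have "\<dots> = - 2 * (\<Sum>b\<in>Basis. (x \<bullet> b) * (y \<bullet> b)) + (3 * s * (\<Sum>b\<in>Basis. (y \<bullet> b) * (y \<bullet> b)) - real DIM(real ^ 3) * s)"
        by (simp only: sum.distrib sum_subtractf sum_distrib_left sum_constant of_nat_mult)
      also have "\<dots> = - 2 * s"
        unfolding inner_eq_sum_Basis[symmetric] yy s_def[symmetric] by simp
      finally show ?thesis .
    qed
    have "laplacian round_sphere (f (Suc n)) y =
        (\<Sum>b\<in>Basis. second_deriv0 (\<lambda>r. (\<lambda>y. ((1 + ?u y) / 2) ^ Suc n) (y + r *\<^sub>R b)))"
      by (simp only: round_sphere_def surface.simps euclidean_laplacian_def re)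
    also have "\<dots> = (\<Sum>b\<in>Basis. ?\<phi>2 (?u y) * g b y * g b y + ?\<phi>1 (?u y) * H b b y)"
      by (rule sum.cong[OF refl], rule second_deriv0_of_data[OF D _ y0]) auto
    also have "\<dots> = ?\<phi>2 s * (\<Sum>b\<in>Basis. g b y * g b y) + ?\<phi>1 s * (\<Sum>b\<in>Basis. H b b y)"
      by (simp only: us sum.distrib sum_distrib_left mult.assoc)
    also have "\<dots> = ?\<phi>2 s * (1 - s\<^sup>2) + ?\<phi>1 s * (- 2 * s)"
      unfolding G Hs ..
    also have "\<dots> = real (Suc n) ^ 2 * ((1 + s) / 2) ^ n - real (Suc n) * (real n + 2) * ((1 + s) / 2) ^ Suc n"
    proof -
      define v where "v = (1 + s) / 2"
      have s: "s = 2 * v - 1" by (simp add: v_def field_simps)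
      have "?\<phi>2 s * (1 - s\<^sup>2) = real (Suc n) * (real n * (v ^ n - v ^ Suc n))"
        unfolding v_def[symmetric] by (cases n) (simp_all add: s power2_eq_square field_simps)
      moreover have "?\<phi>1 s * (- 2 * s) = real (Suc n) * (v ^ n - 2 * v ^ Suc n)"
        unfolding v_def[symmetric] by (simp add: s field_simps)
      ultimately show ?thesis
        unfolding v_def[symmetric] by (simp add: algebra_simps power2_eq_square)
    qed
    finally show ?thesis by (simp add: f_def s_def)
  qed
qed

section \<open>The diagonal of the heat kernel on the sphere\<close>

locale sphere_heat =
  fixes p :: "real \<Rightarrow> real ^ 3 \<Rightarrow> real ^ 3 \<Rightarrow> real"
  assumes heat_kernel: "heat_kernel round_sphere p"
begin

sublocale compact_heat round_sphere p
  using heat_kernel finite_round_sphere sets_round_sphere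
  by (intro compact_heat.intro) (simp_all add: space_round_sphere)

text \<open>The moments of \<open>(1 + x \<bullet> y) / 2\<close> under \<open>p t x y dy\<close> satisfy a closed triangular system,
  and \<open>zonal_moment x n t\<close> tends to \<open>4 \<pi> p t x x\<close> as \<open>n\<close> grows.\<close>

definition zonal_moment :: "real ^ 3 \<Rightarrow> nat \<Rightarrow> real \<Rightarrow> real" where
  "zonal_moment x n t = (real n + 1) * flow x (\<lambda>y. ((1 + x \<bullet> y) / 2) ^ n) t"

context
  fixes x :: "real ^ 3" assumes x: "norm x = 1"
begin

lemma x_in: "x \<in> pts round_sphere" using x by (simp add: space_round_sphere)

lemma zonal_moment_0: "0 \<le> t \<Longrightarrow> zonal_moment x 0 t = 1"
  using avg_one[OF _ x_in, of t] by (simp add: zonal_moment_def flow_def)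

lemma zonal_moment_at_0: "zonal_moment x n 0 = real n + 1"
  using x by (simp add: zonal_moment_def flow_def norm_eq_1)

text \<open>The factor \<open>n + 1\<close> in the normalisation makes the rates of gain and loss
  equal. The equation then relaxes level \<open>n + 1\<close> towards level \<open>n\<close>, so
  bounds propagate upwards by induction on \<open>n\<close>, and constant sequences are
  stationary.\<close>

lemma
  shows zonal_moment_cont: "continuous_on {0..} (zonal_moment x (Suc n))"
    and zonal_moment_deriv: "0 < t \<Longrightarrow> (zonal_moment x (Suc n) has_real_derivative
      (real n + 1) * (real n + 2) / 2 * (zonal_moment x n t - zonal_moment x (Suc n) t)) (at t)"
proof -
  let ?f = "\<lambda>n y. ((1 + x \<bullet> y) / 2) ^ n"
  let ?g = "\<lambda>y. real (Suc n) ^ 2 * ?f n y - real (Suc n) * (real n + 2) * ?f (Suc n) y"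
  have lap: "laplacian round_sphere (?f (Suc n)) y = ?g y" if "y \<in> pts round_sphere" for y
    using zonal_power_laplacian[OF x, of y n] that by (simp only: space_round_sphere)
  have cf: "continuous_on (pts round_sphere) (?f k)" for k by (intro continuous_intros) auto
  have cg: "continuous_on (pts round_sphere) ?g" by (intro continuous_intros cf)
  show "continuous_on {0..} (zonal_moment x (Suc n))"
    unfolding zonal_moment_def 
    by (intro continuous_on_mult continuous_on_const flow_cont[OF x_in zonal_power_test[OF x] _ cg] lap)
  assume t: "0 < t"
  have "avg t x ?g = real (Suc n) ^ 2 * avg t x (?f n) - real (Suc n) * (real n + 2) * avg t x (?f (Suc n))"
  proof -
    have i: "integrable (vol round_sphere) (\<lambda>y. p t x y * ?f k y)" for k by (rule avg_integrable[OF t x_in cf])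
    have "avg t x ?g = (LINT y|vol round_sphere. real (Suc n) ^ 2 * (p t x y * ?f n y) -
        real (Suc n) * (real n + 2) * (p t x y * ?f (Suc n) y))"
      unfolding avg_def by (rule Bochner_Integration.integral_cong[OF refl]) (simp only: right_diff_distrib mult_ac)
    also have "\<dots> = (LINT y|vol round_sphere. real (Suc n) ^ 2 * (p t x y * ?f n y)) -
        (LINT y|vol round_sphere. real (Suc n) * (real n + 2) * (p t x y * ?f (Suc n) y))"
      by (intro Bochner_Integration.integral_diff integrable_mult_right i)
    finally show ?thesis by (simp only: avg_def integral_mult_right_zero)
  qed
  then have eq: "(real (Suc n) + 1) * (avg t x ?g / 2) =
      (real n + 1) * (real n + 2) / 2 * (zonal_moment x n t - zonal_moment x (Suc n) t)"
  proof -
    have "(real (Suc n) + 1) * ((real (Suc n) ^ 2 * A - real (Suc n) * (real n + 2) * B) / 2) =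
        (real n + 1) * (real n + 2) / 2 * ((real n + 1) * A - (real (Suc n) + 1) * B)" for A B
      by (simp add: power2_eq_square field_simps)
    with \<open>avg t x ?g = _\<close> show ?thesis by (simp only: zonal_moment_def flow_pos[OF t])
  qed
  have "(zonal_moment x (Suc n) has_real_derivative (real (Suc n) + 1) * (avg t x ?g / 2)) (at t)"
    unfolding zonal_moment_def
    by (intro DERIV_cmult flow_deriv[OF x_in zonal_power_test[OF x] _ cg t] lap)
  then show "(zonal_moment x (Suc n) has_real_derivative
      (real n + 1) * (real n + 2) / 2 * (zonal_moment x n t - zonal_moment x (Suc n) t)) (at t)"
    unfolding eq .
qed

text \<open>The constant 1 is the stationary solution, belonging to the uniform distribution, and
  lies below the initial values \<open>n + 1\<close>. In the limit it says that the diagonal is at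
  least the inverse area, which fixes a sign at large times.\<close>

lemma zonal_moment_ge_1: "0 \<le> t \<Longrightarrow> 1 \<le> zonal_moment x n t"
proof (induction n arbitrary: t)
  case 0
  then show ?case by (simp add: zonal_moment_0)
next
  case (Suc n)
  let ?a = "(real n + 1) * (real n + 2) / 2"
  have "0 \<le> zonal_moment x (Suc n) t - 1"
  proof (rule ode_nonneg[OF _ _ _ _ Suc.prems])
    show "continuous_on {0..} (\<lambda>t. zonal_moment x (Suc n) t - 1)"
      by (intro continuous_intros zonal_moment_cont)
    fix s :: real assume s: "0 < s"
    show "((\<lambda>t. zonal_moment x (Suc n) t - 1) has_real_derivative
        ?a * (zonal_moment x n s - zonal_moment x (Suc n) s) - 0) (at s)"
      by (intro DERIV_diff zonal_moment_deriv s DERIV_const)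
    have "0 \<le> ?a * (zonal_moment x n s - 1)" using Suc.IH[of s] s by simp
    then show "0 \<le> ?a * (zonal_moment x n s - zonal_moment x (Suc n) s) - 0 + ?a * (zonal_moment x (Suc n) s - 1)"
      unfolding right_diff_distrib by linarith
  qed (simp add: zonal_moment_at_0)
  then show ?case by simp
qed

text \<open>As \<open>n\<close> grows, the barrier \<open>(n + 1) / (1 + n \<tau>)\<close> tends to \<open>1 / \<tau>\<close>, which for \<open>\<tau> = t / 2\<close> is
  the planar value of \<open>4 \<pi> p t x x\<close>.\<close>

lemma barrier_deriv:
  fixes \<tau> :: "real \<Rightarrow> real"
  assumes "(\<tau> has_real_derivative \<tau>') (at s)" "0 \<le> \<tau> s"
  shows "((\<lambda>t. (real n + 2) / (1 + (real n + 1) * \<tau> t)) has_real_derivative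
    - ((real n + 2) * (real n + 1) * \<tau>' / (1 + (real n + 1) * \<tau> s)\<^sup>2)) (at s)"
proof -
  have "0 < 1 + (real n + 1) * \<tau> s" using assms(2) by (intro add_pos_nonneg mult_nonneg_nonneg) auto
  then show ?thesis
    using assms(1) by (auto intro!: derivative_eq_intros simp: power2_eq_square)
qed

text \<open>The numerator decides which \<open>\<tau>\<close> give barriers. With the denominators
  \<open>P = 1 + (n + 1) * \<tau>\<close> and \<open>Q = 1 + n * \<tau>\<close>, solving the system
  exactly would require \<open>2 * \<tau>' / (P * P) = (1 - \<tau>) / (P * Q)\<close>; each of the
  two choices below errs on a definite side.\<close>

lemma barrier_step:
  fixes T :: real
  assumes "0 \<le> T"
  shows "(real n + 2) / (1 + (real n + 1) * T) - (real n + 1) / (1 + real n * T) =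
    (1 - T) / ((1 + (real n + 1) * T) * (1 + real n * T))"
proof -
  have "0 < 1 + (real n + 1) * T" "0 < 1 + real n * T"
    using assms by (intro add_pos_nonneg mult_nonneg_nonneg; simp)+
  then show ?thesis by (simp add: divide_simps) (simp add: algebra_simps)
qed

text \<open>\<open>\<tau> = 1 - exp (- t / 2)\<close> solves
  \<open>2 * \<tau>' = 1 - \<tau>\<close>, so the balance fails only by \<open>Q \<le> P\<close>, in
  the direction of an upper solution. Since \<open>\<tau>\<close> tends to 1 exponentially fast,
  this barrier also gives the decay of the diagonal to the inverse area that integrability at
  infinity needs.\<close>

lemma zonal_moment_le: "0 \<le> t \<Longrightarrow> zonal_moment x n t \<le> (real n + 1) / (1 + real n * (1 - exp (- t / 2)))"
proof (induction n arbitrary: t)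
  case 0
  then show ?case by (simp add: zonal_moment_0)
next
  case (Suc n)
  let ?a = "(real n + 1) * (real n + 2) / 2" and ?\<tau> = "\<lambda>t::real. 1 - exp (- t / 2)"
  let ?B = "\<lambda>t. (real n + 2) / (1 + (real n + 1) * ?\<tau> t)"
  have pos: "0 < 1 + k * ?\<tau> s" if "0 \<le> s" "0 \<le> k" for s k :: real
    using that by (intro add_pos_nonneg mult_nonneg_nonneg) auto
  have "0 \<le> ?B t - zonal_moment x (Suc n) t"
  proof (rule ode_nonneg[OF _ _ _ _ Suc.prems])
    have nz: "1 + (real n + 1) * ?\<tau> s \<noteq> 0" if "s \<in> {0..}" for s
      using pos[of s "real n + 1"] that by simp
    show "continuous_on {0..} (\<lambda>t. ?B t - zonal_moment x (Suc n) t)"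
      by (intro continuous_intros zonal_moment_cont ballI nz) auto
    fix s :: real assume s: "0 < s"
    let ?B' = "- ((real n + 2) * (real n + 1) * (exp (- s / 2) / 2) / (1 + (real n + 1) * ?\<tau> s)\<^sup>2)"
    have B': "(?B has_real_derivative ?B') (at s)"
      by (rule barrier_deriv) (use s in \<open>auto intro!: derivative_eq_intros\<close>)
    show "((\<lambda>t. ?B t - zonal_moment x (Suc n) t) has_real_derivative
        ?B' - ?a * (zonal_moment x n s - zonal_moment x (Suc n) s)) (at s)"
      by (intro DERIV_diff zonal_moment_deriv s B')
    define P Q where "P = 1 + (real n + 1) * ?\<tau> s" and "Q = 1 + real n * ?\<tau> s"
    have PQ: "0 < Q" "Q \<le> P" "0 < P" using pos[of s "real n + 1"] pos[of s "real n"] s by (auto simp: P_def Q_def algebra_simps)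
    have "?B s - (real n + 1) / Q = exp (- s / 2) / (P * Q)"
      using barrier_step[of "?\<tau> s" n] s by (simp add: P_def Q_def)
    then have st: "?a * (?B s - (real n + 1) / Q) = ?a * exp (- s / 2) / (P * Q)" by simp
    have "?a * exp (- s / 2) / (P * P) \<le> ?a * exp (- s / 2) / (P * Q)"
      using PQ by (intro divide_left_mono mult_left_mono mult_pos_pos) auto
    moreover have "?B' = - (?a * exp (- s / 2) / (P * P))"
    proof -
      have "- (u * v * (r / 2) / R) = - (v * u / 2 * r / R)" for u v r R :: real by simp
      then show ?thesis unfolding P_def[symmetric] power2_eq_square .
    qed
    ultimately have "0 \<le> ?B' + ?a * (?B s - (real n + 1) / Q)"
      unfolding st by linarith
    moreover have "?a * zonal_moment x n s \<le> ?a * ((real n + 1) / Q)"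
      using Suc.IH[of s] s by (intro mult_left_mono) (auto simp: Q_def)
    ultimately have "0 \<le> ?B' + ?a * ?B s - ?a * zonal_moment x n s"
      unfolding right_diff_distrib by linarith
    then show "0 \<le> ?B' - ?a * (zonal_moment x n s - zonal_moment x (Suc n) s) + ?a * (?B s - zonal_moment x (Suc n) s)"
      unfolding right_diff_distrib by linarith
  qed (simp add: zonal_moment_at_0)
  then show ?case by (simp add: add.commute)
qed

text \<open>With \<open>2 * \<tau>' = 1\<close> the barrier is a lower solution as soon as
  \<open>(1 - \<tau>) * P \<le> Q\<close>, and the difference of the two sides is
  \<open>(n + 1) * \<tau>\<^sup>2\<close>.\<close>

lemma zonal_moment_ge: "0 \<le> t \<Longrightarrow> (real n + 1) / (1 + real n * (t / 2)) \<le> zonal_moment x n t"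
proof (induction n arbitrary: t)
  case 0
  then show ?case by (simp add: zonal_moment_0)
next
  case (Suc n)
  let ?a = "(real n + 1) * (real n + 2) / 2" and ?\<tau> = "\<lambda>t::real. t / 2"
  let ?B = "\<lambda>t. (real n + 2) / (1 + (real n + 1) * ?\<tau> t)"
  have pos: "0 < 1 + k * ?\<tau> s" if "0 \<le> s" "0 \<le> k" for s k :: real
    using that by (intro add_pos_nonneg mult_nonneg_nonneg) auto
  have "0 \<le> zonal_moment x (Suc n) t - ?B t"
  proof (rule ode_nonneg[OF _ _ _ _ Suc.prems])
    have nz: "1 + (real n + 1) * ?\<tau> s \<noteq> 0" if "s \<in> {0..}" for s
      using pos[of s "real n + 1"] that by simp
    show "continuous_on {0..} (\<lambda>t. zonal_moment x (Suc n) t - ?B t)"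
      by (intro continuous_intros zonal_moment_cont ballI nz) auto
    fix s :: real assume s: "0 < s"
    let ?B' = "- ((real n + 2) * (real n + 1) * (1 / 2) / (1 + (real n + 1) * ?\<tau> s)\<^sup>2)"
    have B': "(?B has_real_derivative ?B') (at s)"
      by (rule barrier_deriv) (use s in \<open>auto intro!: derivative_eq_intros\<close>)
    show "((\<lambda>t. zonal_moment x (Suc n) t - ?B t) has_real_derivative
        ?a * (zonal_moment x n s - zonal_moment x (Suc n) s) - ?B') (at s)"
      by (intro DERIV_diff zonal_moment_deriv s B')
    define P Q where "P = 1 + (real n + 1) * ?\<tau> s" and "Q = 1 + real n * ?\<tau> s"
    have PQ: "0 < Q" "0 < P" using pos[of s "real n + 1"] pos[of s "real n"] s by (auto simp: P_def Q_def)
    have "?B s - (real n + 1) / Q = (1 - ?\<tau> s) / (P * Q)"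
      using barrier_step[of "?\<tau> s" n] s by (simp add: P_def Q_def)
    then have st: "?a * (?B s - (real n + 1) / Q) = ?a * ((1 - ?\<tau> s) / (P * Q))" by simp
    have "(1 - ?\<tau> s) * P \<le> Q"
    proof -
      have "Q - (1 - ?\<tau> s) * P = (real n + 1) * (?\<tau> s * ?\<tau> s)"
        by (simp add: P_def Q_def field_simps)
      also have "0 \<le> \<dots>" by simp
      finally show ?thesis by simp
    qed
    then have "(1 - ?\<tau> s) / (P * Q) \<le> 1 / (P * P)"
      using PQ by (simp add: divide_simps)
    then have "?a * ((1 - ?\<tau> s) / (P * Q)) \<le> ?a * (1 / (P * P))"
      by (intro mult_left_mono) auto
    moreover have "?B' = - (?a * (1 / (P * P)))"
    proof -
      have "- (u * v * (1 / 2) / R) = - (v * u / 2 * (1 / R))" for u v R :: real by simp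
      then show ?thesis unfolding P_def[symmetric] power2_eq_square .
    qed
    ultimately have "?B' + ?a * (?B s - (real n + 1) / Q) \<le> 0"
      unfolding st by linarith
    moreover have "?a * ((real n + 1) / Q) \<le> ?a * zonal_moment x n s"
      using Suc.IH[of s] s by (intro mult_left_mono) (auto simp: Q_def)
    ultimately have "?B' + ?a * ?B s - ?a * zonal_moment x n s \<le> 0"
      unfolding right_diff_distrib by linarith
    then show "0 \<le> ?a * (zonal_moment x n s - zonal_moment x (Suc n) s) - ?B' + ?a * (zonal_moment x (Suc n) s - ?B s)"
      unfolding right_diff_distrib by linarith
  qed (simp add: zonal_moment_at_0)
  then show ?case by (simp add: add.commute)
qed

text \<open>The function \<open>(1 + x \<bullet> y) / 2\<close> takes the value 1 only at
  \<open>y = x\<close>, and its powers have mass \<open>4 * pi / (n + 1)\<close>, of polynomial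
  decay; so the normalised powers form an approximate identity at \<open>x\<close>.\<close>

lemma zonal_moment_tendsto: "0 < t \<Longrightarrow> (\<lambda>n. zonal_moment x n t) \<longlonglongrightarrow> 4 * pi * p t x x"
proof -
  assume t: "0 < t"
  let ?b = "\<lambda>y. (1 + x \<bullet> y) / 2"
  have I: "(LINT y|vol round_sphere. ?b y ^ n) = 4 * pi / (real n + 1)" for n
    by (rule integral_sphere_zonal_power[OF x])
  have xy: "\<bar>x \<bullet> y\<bar> \<le> 1" if "y \<in> pts round_sphere" for y
    using Cauchy_Schwarz_ineq2[of x y] that x by (simp add: space_round_sphere)
  have lim: "(\<lambda>n. (LINT y|vol round_sphere. p t x y * ?b y ^ n) / (LINT y|vol round_sphere. ?b y ^ n)) \<longlonglongrightarrow> p t x x"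
  proof (rule approximate_identity[OF x_in])
    show "continuous_on (pts round_sphere) ?b" by (intro continuous_intros) auto
    show "0 \<le> ?b y" if "y \<in> pts round_sphere" for y using xy[OF that] by (simp add: abs_le_iff)
    show "?b y < 1" if y: "y \<in> pts round_sphere" "y \<noteq> x" for y
    proof -
      have ny: "norm y = 1" using y by (simp add: space_round_sphere)
      have "x \<bullet> y \<noteq> 1"
      proof
        assume "x \<bullet> y = 1"
        then have "(x - y) \<bullet> (x - y) = 0"
          using x ny by (simp add: inner_diff_left inner_diff_right norm_eq_1 inner_commute)
        then show False using y(2) by simp
      qed
      then show ?thesis using xy[OF y(1)] by (simp add: abs_le_iff less_le)
    qed
    show "?b x = 1" using x by (simp add: norm_eq_1)
    show "0 < (LINT y|vol round_sphere. ?b y ^ n)" for n unfolding I by simp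
    show "(\<lambda>n. \<rho> ^ n / (LINT y|vol round_sphere. ?b y ^ n)) \<longlonglongrightarrow> 0" if "0 < \<rho>" "\<rho> < 1" for \<rho> :: real
      unfolding I using that by real_asymp
    show "continuous_on (pts round_sphere) (p t x)" by (rule p_slice_cont[OF t x_in])
  qed
  have "4 * pi * ((LINT y|vol round_sphere. p t x y * ?b y ^ n) / (LINT y|vol round_sphere. ?b y ^ n)) = zonal_moment x n t" for n
    unfolding I using t by (simp add: zonal_moment_def flow_pos avg_def field_simps)
  then show ?thesis
    using tendsto_mult[OF tendsto_const[of "4 * pi"] lim] by simp
qed

lemma diagonal_bounds:
  assumes t: "0 < t"
  shows "4 * pi * p t x x \<le> 1 / (1 - exp (- t / 2))" "2 / t \<le> 4 * pi * p t x x" "1 \<le> 4 * pi * p t x x"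
proof -
  have ratio_lim: "(\<lambda>n. (real n + 1) / (1 + real n * k)) \<longlonglongrightarrow> 1 / k" if "0 < k" for k :: real
  proof -
    have "(\<lambda>n. (real n + 1) / (1 + real n * k)) \<longlonglongrightarrow> inverse k" using that by real_asymp
    then show ?thesis by (simp add: inverse_eq_divide)
  qed
  have e: "0 < 1 - exp (- t / 2)" using t by simp
  have "(\<lambda>n. (real n + 1) / (1 + real n * (1 - exp (- t / 2)))) \<longlonglongrightarrow> 1 / (1 - exp (- t / 2))"
    by (rule ratio_lim[OF e])
  then show "4 * pi * p t x x \<le> 1 / (1 - exp (- t / 2))"
    by (rule LIMSEQ_le[OF zonal_moment_tendsto[OF t]]) (use t zonal_moment_le in auto)
  have "(\<lambda>n. (real n + 1) / (1 + real n * (t / 2))) \<longlonglongrightarrow> 2 / t"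
    using ratio_lim[of "t / 2"] t by simp
  then show "2 / t \<le> 4 * pi * p t x x"
    by (rule LIMSEQ_le[OF _ zonal_moment_tendsto[OF t]]) (use t zonal_moment_ge in auto)
  show "1 \<le> 4 * pi * p t x x"
    by (rule LIMSEQ_le_const[OF zonal_moment_tendsto[OF t]]) (use t zonal_moment_ge_1 in auto)
qed

end

text \<open>Rotation invariance is not part of \<open>heat_kernel\<close>. That the diagonal is the
  same at all points comes instead from uniqueness for the triangular system, whose equations and
  initial values do not mention \<open>x\<close>.\<close>

lemma zonal_moment_unique:
  assumes "norm x = 1" "norm x' = 1" "0 \<le> t"
  shows "zonal_moment x n t = zonal_moment x' n t"
  using assms(3)
proof (induction n arbitrary: t)
  case 0
  then show ?case using assms by (simp add: zonal_moment_0)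
next
  case (Suc n)
  let ?a = "(real n + 1) * (real n + 2) / 2"
  have ge: "0 \<le> zonal_moment u (Suc n) t - zonal_moment v (Suc n) t"
    if u: "norm u = 1" and v: "norm v = 1" and uv: "\<And>t. 0 \<le> t \<Longrightarrow> zonal_moment u n t = zonal_moment v n t" for u v
  proof (rule ode_nonneg[OF _ _ _ _ Suc.prems])
    show "continuous_on {0..} (\<lambda>t. zonal_moment u (Suc n) t - zonal_moment v (Suc n) t)"
      by (intro continuous_intros zonal_moment_cont u v)
    fix s :: real assume s: "0 < s"
    show "((\<lambda>t. zonal_moment u (Suc n) t - zonal_moment v (Suc n) t) has_real_derivative
        ?a * (zonal_moment u n s - zonal_moment u (Suc n) s) - ?a * (zonal_moment v n s - zonal_moment v (Suc n) s)) (at s)"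
      by (intro DERIV_diff zonal_moment_deriv s u v)
    show "0 \<le> ?a * (zonal_moment u n s - zonal_moment u (Suc n) s) - ?a * (zonal_moment v n s - zonal_moment v (Suc n) s)
        + ?a * (zonal_moment u (Suc n) s - zonal_moment v (Suc n) s)"
      using uv[of s] s by (simp add: right_diff_distrib)
  qed (simp add: zonal_moment_at_0 u v)
  show ?case
    using ge[OF assms(1,2) Suc.IH] ge[OF assms(2,1) Suc.IH[symmetric]] by simp
qed

end

lemma thick_points_sphere:
  fixes c :: "nat \<Rightarrow> real" and PX :: "'w measure" and PB :: "real ^ 3 \<Rightarrow> 'b measure"
  assumes c: "cutoff_sequence c"
    and setting: "liouville_setting round_sphere p (gff_cov round_sphere p) (gff_cutoff_cov round_sphere p c) \<gamma> PX X Xn PB B F"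
  shows "AE w in PX. \<forall>x\<in>pts round_sphere. AE b in PB x.
    {t \<in> {0..}. liouville_bm (\<lambda>s. F w x s b) (\<lambda>s. B x s b) t \<in> pts round_sphere - thick_points round_sphere c Xn \<gamma> w}
      \<in> null_sets (lebesgue_on {0..})"
proof -
  have "heat_kernel round_sphere p" using setting unfolding liouville_setting_def by blast
  then interpret sphere_heat p by (rule sphere_heat.intro)
  define x0 :: "real ^ 3" where "x0 = axis 1 1"
  have x0: "norm x0 = 1" by (simp add: x0_def)
  let ?q = "\<lambda>t. p t x0 x0"
  note b = diagonal_bounds[OF x0]
  have m: "measure (vol round_sphere) (pts round_sphere) = 4 * pi"
    by (simp only: space_round_sphere measure_round_sphere)
  have heq: "pi * (?q t - 1 / measure (vol round_sphere) (pts round_sphere)) = (4 * pi * ?q t - 1) / 4" for t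
    unfolding m by (simp add: field_simps)
  have up: "(4 * pi * ?q t - 1) / 4 \<le> 1 / (4 * (exp (t / 2) - 1))" if t: "0 < t" for t
  proof -
    have e: "0 < exp (t / 2) - 1" using t by simp
    have "1 / (1 - exp (- t / 2)) - 1 = 1 / (exp (t / 2) - 1)"
      using e by (simp add: exp_minus divide_simps)
    then have "4 * pi * ?q t - 1 \<le> 1 / (exp (t / 2) - 1)" using b(1)[OF t] by linarith
    then have "(4 * pi * ?q t - 1) / 4 \<le> 1 / (exp (t / 2) - 1) / 4" by (rule divide_right_mono) simp
    also have "\<dots> = 1 / (4 * (exp (t / 2) - 1))" by simp
    finally show ?thesis .
  qed
  show ?thesis
  proof (rule thick_points_of_diagonal[OF c setting, where q = ?q and K = 1])
    fix t :: real and x assume t: "0 < t" and xs: "x \<in> pts round_sphere"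
    then have x: "norm x = 1" by (simp add: space_round_sphere)
    have "4 * pi * p t x x = 4 * pi * p t x0 x0"
      using LIMSEQ_unique[OF zonal_moment_tendsto[OF x t]] zonal_moment_tendsto[OF x0 t]
        zonal_moment_unique[OF x x0 less_imp_le[OF t]] by simp
    then show "p t x x = ?q t" by simp
  next
    show "continuous_on {0<..} ?q" by (rule p_diag_cont[OF x_in[OF x0]])
  next
    fix t :: real assume t: "0 < t" "t \<le> 1"
    have "t / 2 \<le> exp (t / 2) - 1" using exp_ge_add_one_self[of "t / 2"] by linarith
    then have "1 / (4 * (exp (t / 2) - 1)) \<le> 1 / (4 * (t / 2))"
      using t by (intro divide_left_mono mult_pos_pos) auto
    then have u: "(4 * pi * ?q t - 1) / 4 \<le> 1 / (2 * t)" using up[OF t(1)] by simp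
    \<comment> \<open>The \<open>1 / 4\<close> lost here is absorbed by \<open>1 / sqrt t\<close>,
      as \<open>t \<le> 1\<close>.\<close>
    have l: "1 / (2 * t) - 1 / 4 \<le> (4 * pi * ?q t - 1) / 4" using b(2)[OF t(1)] t by (simp add: field_simps)
    have "1 \<le> 1 / sqrt t" using t by simp
    then show "\<bar>pi * (?q t - 1 / measure (vol round_sphere) (pts round_sphere)) - 1 / (2 * t)\<bar> \<le> 1 / sqrt t"
      unfolding heq using u l by linarith
  next
    \<comment> \<open>For \<open>t \<ge> 1\<close> the factor \<open>1 - exp (- t / 2)\<close> is at
      least its value at 1, so the upper barrier leaves an exponentially decaying majorant.\<close>
    let ?k = "\<lambda>t::real. exp (- t / 2) / (4 * (1 - exp (- 1 / 2)))"
    have e0: "0 < 1 - exp (- 1 / 2 :: real)" by simp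
    have k: "set_integrable lborel {1..} ?k"
    proof (rule set_integral_atLeast_FTC(1)[where F = "\<lambda>t. - 2 * exp (- t / 2) / (4 * (1 - exp (- 1 / 2)))" and T = 0])
      show "((\<lambda>t::real. - 2 * exp (- t / 2) / (4 * (1 - exp (- 1 / 2)))) \<longlongrightarrow> 0) at_top"
        using e0 by real_asymp
    qed (use e0 in \<open>auto intro!: derivative_eq_intros\<close>)
    show "set_integrable lborel {1..} (\<lambda>t. pi * (?q t - 1 / measure (vol round_sphere) (pts round_sphere)))"
      unfolding heq
    proof (rule set_integrable_bound[OF k])
      have "continuous_on {1..} (\<lambda>t. (4 * pi * ?q t - 1) / 4)"
        by (intro continuous_intros continuous_on_subset[OF p_diag_cont[OF x_in[OF x0]]]) auto
      from borel_measurable_continuous_on_indicator[OF _ this]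
      show "set_borel_measurable lborel {1..} (\<lambda>t. (4 * pi * ?q t - 1) / 4)"
        by (simp add: set_borel_measurable_def)
      show "AE t in lborel. t \<in> {1..} \<longrightarrow> norm ((4 * pi * ?q t - 1) / 4) \<le> norm (?k t)"
      proof (intro AE_I2 impI)
        fix t :: real assume "t \<in> {1..}"
        then have t: "1 \<le> t" "0 < t" by auto
        have "exp (- t / 2) \<le> exp (- 1 / 2)" using t by simp
        then have "(1 - exp (- 1 / 2)) * exp (t / 2) \<le> (1 - exp (- t / 2)) * exp (t / 2)"
          by (intro mult_right_mono) auto
        also have "\<dots> = exp (t / 2) - 1" by (simp add: left_diff_distrib mult_exp_exp)
        finally have "1 / (4 * (exp (t / 2) - 1)) \<le> 1 / (4 * ((1 - exp (- 1 / 2)) * exp (t / 2)))"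
          using e0 t by (intro divide_left_mono mult_pos_pos mult_left_mono) auto
        also have "\<dots> = ?k t" by (simp add: exp_minus field_simps)
        finally have "(4 * pi * ?q t - 1) / 4 \<le> ?k t" using up[OF t(2)] by linarith
        moreover have "0 \<le> (4 * pi * ?q t - 1) / 4" using b(3)[OF t(2)] by simp
        ultimately show "norm ((4 * pi * ?q t - 1) / 4) \<le> norm (?k t)" by simp
      qed
    qed
  qed
qed

section \<open>The torus\<close>

text \<open>Jacobi's theta function, the sum of \<open>exp (- s * k\<^sup>2)\<close> over all
  integers, with the negative ones folded onto the positive ones.\<close>

definition theta :: "real \<Rightarrow> real" where
  "theta s = 1 + 2 * (\<Sum>k. exp (- s * real (Suc k) ^ 2))"

lemma exp_square_le_power:
  assumes "0 \<le> (s::real)"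
  shows "exp (- s * real (Suc k) ^ 2) \<le> exp (- s) ^ Suc k"
proof -
  have "real (Suc k) \<le> real (Suc k) ^ 2" by (rule self_le_power) auto
  then have "s * real (Suc k) \<le> s * real (Suc k) ^ 2" using assms by (rule mult_left_mono)
  then have "exp (- s * real (Suc k) ^ 2) \<le> exp (real (Suc k) * (- s))" by (simp add: mult.commute)
  then show ?thesis by (simp only: exp_of_nat_mult)
qed

lemma geometric_exp:
  assumes "0 < (s::real)"
  shows "(\<lambda>k. exp (- s) ^ Suc k) sums (exp (- s) / (1 - exp (- s)))"
proof -
  have "(\<lambda>k. exp (- s) * exp (- s) ^ k) sums (exp (- s) * (1 / (1 - exp (- s))))"
    by (intro sums_mult geometric_sums) (use assms in simp)
  then show ?thesis by simp
qed

lemma summable_theta: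
  assumes "0 < s"
  shows "summable (\<lambda>k. exp (- s * real (Suc k) ^ 2))"
  by (rule summable_comparison_test'[OF sums_summable[OF geometric_exp[OF assms]], of 0])
    (use exp_square_le_power[of s] assms in simp)

lemma theta_ge_1: "0 < s \<Longrightarrow> 1 \<le> theta s"
  unfolding theta_def using suminf_nonneg[OF summable_theta, of s] by simp

lemma theta_le: "0 < s \<Longrightarrow> theta s \<le> 1 + 2 * (exp (- s) / (1 - exp (- s)))"
proof -
  assume s: "0 < s"
  have "(\<Sum>k. exp (- s * real (Suc k) ^ 2)) \<le> (\<Sum>k. exp (- s) ^ Suc k)"
    using exp_square_le_power[of s] s
    by (intro suminf_le summable_theta sums_summable[OF geometric_exp]) auto
  also have "\<dots> = exp (- s) / (1 - exp (- s))" by (rule sums_unique[OF geometric_exp[OF s], symmetric])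
  finally show ?thesis by (simp add: theta_def)
qed

lemma gaussian_integral_atLeast:
  assumes s: "0 < s"
  shows "set_integrable lborel {0..} (\<lambda>x. exp (- s * x\<^sup>2))"
    "(LINT x:{0..}|lborel. exp (- s * x\<^sup>2)) = sqrt (pi / s) / 2"
proof -
  have "has_bochner_integral lborel (\<lambda>x. indicator {0..} (0 + sqrt s * x) *\<^sub>R exp (- (0 + sqrt s * x)\<^sup>2)) ((sqrt pi / 2) /\<^sub>R \<bar>sqrt s\<bar>)"
    using gaussian_moment_0 s
    by (subst (asm) lborel_has_bochner_integral_real_affine_iff[where c = "sqrt s" and t = 0]) auto
  moreover have "(\<lambda>x. indicator {0..} (0 + sqrt s * x) *\<^sub>R exp (- (0 + sqrt s * x)\<^sup>2)) =
      (\<lambda>x. indicator {0..} x *\<^sub>R exp (- s * x\<^sup>2))"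
    using s by (auto simp: fun_eq_iff indicator_def power_mult_distrib zero_le_mult_iff)
  ultimately have "has_bochner_integral lborel (\<lambda>x. indicator {0..} x *\<^sub>R exp (- s * x\<^sup>2)) ((sqrt pi / 2) /\<^sub>R \<bar>sqrt s\<bar>)"
    by simp
  moreover have "(sqrt pi / 2) /\<^sub>R \<bar>sqrt s\<bar> = sqrt (pi / s) / 2"
    using s by (simp add: real_sqrt_divide inverse_eq_divide)
  ultimately have h: "has_bochner_integral lborel (\<lambda>x. indicator {0..} x *\<^sub>R exp (- s * x\<^sup>2)) (sqrt (pi / s) / 2)"
    by simp
  show "set_integrable lborel {0..} (\<lambda>x. exp (- s * x\<^sup>2))"
    unfolding set_integrable_def by (rule integrable.intros[OF h])
  show "(LINT x:{0..}|lborel. exp (- s * x\<^sup>2)) = sqrt (pi / s) / 2"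
    unfolding set_lebesgue_integral_def by (rule has_bochner_integral_integral_eq[OF h])
qed

text \<open>For a decreasing function the sum over \<open>k \<ge> 0\<close> exceeds the integral by
  something between 0 and the value 1 at the origin. Here theta is twice the sum minus 1 and
  \<open>sqrt (pi / s)\<close> is twice the integral. A bounded error suffices, as it becomes one of
  order \<open>1 / sqrt s\<close> upon squaring.\<close>

lemma theta_asymp:
  assumes s: "0 < s"
  shows "\<bar>theta s - sqrt (pi / s)\<bar> \<le> 1"
proof -
  let ?f = "\<lambda>x::real. exp (- s * x\<^sup>2)"
  interpret f: antimono_fun_sum_integral_diff ?f
  proof
    fix x y :: real assume "0 \<le> x" "x \<le> y"
    then have "x\<^sup>2 \<le> y\<^sup>2" by (intro power_mono)
    then show "?f y \<le> ?f x" using s by simp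
  next
    show "continuous_on {0..} ?f" by (intro continuous_intros)
  qed simp
  have int: "integral {0..real n} ?f = (LINT x:{0..real n}|lborel. ?f x)" for n
    by (rule set_borel_integral_eq_integral(2)[symmetric], rule borel_integrable_atLeastAtMost', intro continuous_intros)
  have "((\<lambda>b. LINT x:{0..b}|lborel. ?f x) \<longlongrightarrow> (LINT x:{0..}|lborel. ?f x)) at_top"
    by (rule tendsto_set_lebesgue_integral_at_top[OF _ gaussian_integral_atLeast(1)[OF s]]) simp
  from filterlim_compose[OF this filterlim_real_sequentially]
  have I: "(\<lambda>n. integral {0..real n} ?f) \<longlonglongrightarrow> sqrt (pi / s) / 2"
    by (simp only: int gaussian_integral_atLeast(2)[OF s])
  have "(\<lambda>n. \<Sum>k<n. ?f (real (Suc k))) \<longlonglongrightarrow> (\<Sum>k. ?f (real (Suc k)))"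
    by (rule summable_LIMSEQ[OF summable_theta[OF s]])
  then have "(\<lambda>n. 1 + (\<Sum>k<n. ?f (real (Suc k)))) \<longlonglongrightarrow> 1 + (\<Sum>k. ?f (real (Suc k)))"
    by (intro tendsto_intros)
  moreover have "1 + (\<Sum>k<n. ?f (real (Suc k))) = (\<Sum>k\<le>n. ?f (real k))" for n
    by (simp only: sum.atMost_shift) simp
  ultimately have "(\<lambda>n. \<Sum>k\<le>n. ?f (real k)) \<longlonglongrightarrow> 1 + (\<Sum>k. ?f (real (Suc k)))" by simp
  from tendsto_diff[OF this I]
  have d: "f.sum_integral_diff_series \<longlonglongrightarrow> 1 + (\<Sum>k. ?f (real (Suc k))) - sqrt (pi / s) / 2"
    unfolding f.sum_integral_diff_series_def[abs_def] .
  have "0 \<le> 1 + (\<Sum>k. ?f (real (Suc k))) - sqrt (pi / s) / 2"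
    by (rule LIMSEQ_le_const[OF d]) (use f.sum_integral_diff_series_nonneg in blast)
  moreover have "1 + (\<Sum>k. ?f (real (Suc k))) - sqrt (pi / s) / 2 \<le> 1"
  proof (rule LIMSEQ_le_const2[OF d], intro exI allI impI)
    fix n :: nat
    have "f.sum_integral_diff_series 0 = 1" unfolding f.sum_integral_diff_series_def by simp
    with f.sum_integral_diff_series_antimono[of 0 n] show "f.sum_integral_diff_series n \<le> 1" by linarith
  qed
  ultimately show ?thesis unfolding theta_def by linarith
qed

text \<open>Passing from \<open>k\<close> to \<open>k + 1\<close> multiplies the ratio by
  \<open>(n - k) / (n + k + 1)\<close>, which tends to 1 for fixed \<open>k\<close>.\<close>

lemma central_binomial_ratio_tendsto:
  "(\<lambda>n. real (2 * n choose (n + k)) / real (2 * n choose n)) \<longlonglongrightarrow> 1"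
proof (induction k)
  case (Suc k)
  have "real (2 * n choose (n + Suc k)) / real (2 * n choose n) =
      real (2 * n choose (n + k)) / real (2 * n choose n) * ((real n - real k) / (real n + real k + 1))" if "k \<le> n" for n
  proof -
    have "Suc (n + k) * (2 * n choose Suc (n + k)) = (2 * n - (n + k)) * (2 * n choose (n + k))"
      by (simp only: binomial_absorption binomial_absorb_comp)
    then have "real (Suc (n + k)) * real (2 * n choose Suc (n + k)) = real (2 * n - (n + k)) * real (2 * n choose (n + k))"
      by (simp only: of_nat_mult[symmetric])
    moreover have "real (2 * n - (n + k)) = real n - real k" using that by simp
    ultimately have "real (2 * n choose (n + Suc k)) = real (2 * n choose (n + k)) * ((real n - real k) / (real n + real k + 1))"
      by (simp add: field_simps)
    then show ?thesis by simp
  qed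
  then have ev: "eventually (\<lambda>n. real (2 * n choose (n + k)) / real (2 * n choose n) * ((real n - real k) / (real n + real k + 1)) =
      real (2 * n choose (n + Suc k)) / real (2 * n choose n)) sequentially"
    by (intro eventually_sequentiallyI[of k]) simp
  have "(\<lambda>n. (real n - real k) / (real n + real k + 1)) \<longlonglongrightarrow> 1" by real_asymp
  then have "(\<lambda>n. real (2 * n choose (n + k)) / real (2 * n choose n) * ((real n - real k) / (real n + real k + 1))) \<longlonglongrightarrow> 1 * 1"
    by (intro tendsto_mult Suc.IH)
  then have "(\<lambda>n. real (2 * n choose (n + Suc k)) / real (2 * n choose n)) \<longlonglongrightarrow> 1 * 1"
    by (rule Lim_transform_eventually[OF _ ev])
  then show ?case by simp
qed simp

lemma sum_symmetric_split:
  fixes g :: "nat \<Rightarrow> real"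
  shows "(\<Sum>i\<le>2 * n. g i) = g n + (\<Sum>k<n. g (n - Suc k)) + (\<Sum>k<n. g (n + Suc k))"
proof -
  have "{..2 * n} = {..<n} \<union> {n..n + n}" by auto
  then have "(\<Sum>i\<le>2 * n. g i) = (\<Sum>i<n. g i) + (\<Sum>i\<in>{n..n + n}. g i)"
    by (simp only:) (rule sum.union_disjoint, auto)
  also have "(\<Sum>i\<in>{n..n + n}. g i) = g n + (\<Sum>i\<in>{Suc n..n + n}. g i)"
    by (rule sum.atLeast_Suc_atMost) simp
  also have "(\<Sum>i\<in>{Suc n..n + n}. g i) = (\<Sum>k<n. g (n + Suc k))"
    by (rule sum.reindex_bij_witness[of _ "\<lambda>k. n + Suc k" "\<lambda>i. i - Suc n"]) auto
  finally show ?thesis by (simp add: sum.nat_diff_reindex)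
qed

text \<open>Both coordinates of the approximate identity on the torus contribute this factor.\<close>

lemma theta_limit:
  assumes s: "0 < s"
  shows "(\<lambda>n. (\<Sum>i\<le>2 * n. real (2 * n choose i) * exp (- s * (real i - real n)\<^sup>2)) / real (2 * n choose n)) \<longlonglongrightarrow> theta s"
proof -
  let ?r = "\<lambda>n k. real (2 * n choose (n + Suc k)) / real (2 * n choose n)"
  define a where "a k n = ?r n k * exp (- s * real (Suc k) ^ 2)" for k n
  have pos: "0 < real (2 * n choose n)" for n by simp
  have r1: "?r n k \<le> 1" for n k
    using binomial_maximum'[of n "n + Suc k"] pos[of n] by (simp add: divide_le_eq)
  have ak: "norm (a k n) \<le> exp (- s * real (Suc k) ^ 2)" for k n
    using mult_right_mono[OF r1[of n k], of "exp (- s * real (Suc k) ^ 2)"] by (simp add: a_def)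
  have lim: "(a k) \<longlonglongrightarrow> exp (- s * real (Suc k) ^ 2)" for k
    using tendsto_mult[OF central_binomial_ratio_tendsto[of "Suc k"] tendsto_const[of "exp (- s * real (Suc k) ^ 2)"]]
    by (simp add: a_def[abs_def])
  \<comment> \<open>Tannery's theorem: the ratios are at most 1, the central coefficient being the
    largest, so the theta series itself dominates.\<close>
  have "(\<lambda>n. suminf (\<lambda>k. a k n)) \<longlonglongrightarrow> (\<Sum>k. exp (- s * real (Suc k) ^ 2))"
    by (rule conjunct2[OF conjunct2[OF tannerys_theorem[OF lim _ summable_theta[OF s]]]])
      (use ak in \<open>auto intro!: always_eventually\<close>)
  then have "(\<lambda>n. 1 + 2 * suminf (\<lambda>k. a k n)) \<longlonglongrightarrow> theta s"
    unfolding theta_def by (intro tendsto_intros)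
  moreover have "1 + 2 * suminf (\<lambda>k. a k n) =
      (\<Sum>i\<le>2 * n. real (2 * n choose i) * exp (- s * (real i - real n)\<^sup>2)) / real (2 * n choose n)" for n
  proof -
    let ?g = "\<lambda>i. real (2 * n choose i) * exp (- s * (real i - real n)\<^sup>2)"
    \<comment> \<open>For \<open>k \<ge> n\<close> the coefficient
      \<open>2 * n choose (n + Suc k)\<close> is 0 and the series is a finite sum.\<close>
    have "suminf (\<lambda>k. a k n) = (\<Sum>k<n. a k n)"
      by (rule suminf_finite) (auto simp: a_def)
    moreover have "?g (n + Suc k) = real (2 * n choose n) * a k n" for k
      by (simp add: a_def)
    moreover have "?g (n - Suc k) = real (2 * n choose n) * a k n" if "k < n" for k
    proof -
      have "2 * n choose (n - Suc k) = 2 * n choose (n + Suc k)"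
        using binomial_symmetric[of "n - Suc k" "2 * n"] that by (simp add: add.commute)
      moreover have "(real (n - Suc k) - real n)\<^sup>2 = real (Suc k) ^ 2"
        using that by (simp add: of_nat_diff power2_eq_square algebra_simps)
      ultimately show ?thesis by (simp add: a_def)
    qed
    moreover have "?g n = real (2 * n choose n)" by simp
    ultimately show ?thesis
      unfolding sum_symmetric_split[of ?g] by (simp add: sum_distrib_left[symmetric] add_divide_distrib)
  qed
  ultimately show ?thesis by simp
qed

text \<open>\<open>2 + 2 * cos \<phi>\<close> equals
  \<open>(1 + cis \<phi>)\<^sup>2 * cis (- \<phi>)\<close>; the binomial theorem for the exponent
  \<open>2 * n\<close>, followed by real parts, gives the expansion, with frequencies centred at
  \<open>n\<close>.\<close>

lemma cos_power_expansion:
  "((1 + cos \<phi>) / 2) ^ n = (\<Sum>i\<le>2 * n. real (2 * n choose i) * cos ((real i - real n) * \<phi>)) / 4 ^ n"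
proof -
  have sq: "complex_of_real (2 + 2 * cos \<phi>) = (1 + cis \<phi>)\<^sup>2 * cis (- \<phi>)"
  proof -
    have "cis \<phi> * cis (- \<phi>) = 1" by (simp add: cis_mult)
    moreover have "(1 + w)\<^sup>2 * v = v + 2 * (w * v) + w * (w * v)" for w v :: complex
      by (simp add: power2_eq_square algebra_simps)
    ultimately have "(1 + cis \<phi>)\<^sup>2 * cis (- \<phi>) = cis (- \<phi>) + 2 + cis \<phi>" by simp
    then show ?thesis by (simp add: complex_eq_iff)
  qed
  have "complex_of_real ((2 + 2 * cos \<phi>) ^ n) = (1 + cis \<phi>) ^ (2 * n) * cis (- \<phi>) ^ n"
    by (simp only: of_real_power sq power_mult_distrib power_mult)
  also have "(1 + cis \<phi>) ^ (2 * n) = (\<Sum>i\<le>2 * n. of_nat (2 * n choose i) * cis \<phi> ^ i)"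
    by (subst add.commute) (simp add: binomial_ring)
  also have "(\<Sum>i\<le>2 * n. of_nat (2 * n choose i) * cis \<phi> ^ i) * cis (- \<phi>) ^ n =
      (\<Sum>i\<le>2 * n. of_nat (2 * n choose i) * cis ((real i - real n) * \<phi>))"
  proof -
    have "cis \<phi> ^ i * cis (- \<phi>) ^ n = cis ((real i - real n) * \<phi>)" for i
      by (simp only: Complex.DeMoivre cis_mult) (simp add: algebra_simps)
    then show ?thesis unfolding sum_distrib_right by (intro sum.cong refl) (simp only: mult.assoc)
  qed
  finally have "(2 + 2 * cos \<phi>) ^ n = Re (\<Sum>i\<le>2 * n. of_nat (2 * n choose i) * cis ((real i - real n) * \<phi>))"
    by (metis Re_complex_of_real)
  also have "\<dots> = (\<Sum>i\<le>2 * n. real (2 * n choose i) * cos ((real i - real n) * \<phi>))"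
    by (simp add: Re_sum)
  finally have "(2 + 2 * cos \<phi>) ^ n = (\<Sum>i\<le>2 * n. real (2 * n choose i) * cos ((real i - real n) * \<phi>))" .
  moreover have "((1 + cos \<phi>) / 2) ^ n = (2 + 2 * cos \<phi>) ^ n / 4 ^ n"
  proof -
    have "(1 + cos \<phi>) / 2 = (2 + 2 * cos \<phi>) / 4" by simp
    then show ?thesis by (simp only: power_divide)
  qed
  ultimately show ?thesis by simp
qed

lemma integral_cos_period:
  assumes L: "0 < L"
  shows "(LINT a:{0..<L}|lborel. cos (real_of_int k * (2 * pi * a / L - \<alpha>))) = (if k = 0 then L else 0)"
proof -
  let ?f = "\<lambda>a. cos (real_of_int k * (2 * pi * a / L - \<alpha>))"
  have c: "continuous_on {0..L} ?f" by (intro continuous_intros) (use L in auto)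
  have "(LINT a:{0..<L}|lborel. ?f a) = (LINT a:{0..L}|lborel. ?f a)"
    unfolding set_lebesgue_integral_def
  proof (rule integral_cong_AE)
    show "AE a in lborel. indicat_real {0..<L} a *\<^sub>R ?f a = indicat_real {0..L} a *\<^sub>R ?f a"
      by (rule eventually_mono[OF AE_lborel_singleton[of L]]) (auto simp: indicator_def)
  qed (use L in measurable)
  also have "\<dots> = (if k = 0 then L else 0)"
  proof (cases "k = 0")
    case True
    then show ?thesis using L by (simp add: set_lebesgue_integral_def)
  next
    case False
    let ?F = "\<lambda>a. sin (real_of_int k * (2 * pi * a / L - \<alpha>)) * L / (2 * pi * real_of_int k)"
    have "(LINT a:{0..L}|lborel. ?f a) = ?F L - ?F 0"
      unfolding set_lebesgue_integral_def
    proof (rule integral_FTC_atLeastAtMost[OF _ _ c])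
      fix a
      have "(?F has_real_derivative ?f a) (at a within {0..L})"
        using L False by (auto intro!: derivative_eq_intros simp: field_simps)
      then show "(?F has_vector_derivative ?f a) (at a within {0..L})"
        by (simp add: has_real_derivative_iff_has_vector_derivative)
    qed (use L in simp)
    moreover have "sin (real_of_int k * (2 * pi * L / L - \<alpha>)) = sin (real_of_int k * (2 * pi * 0 / L - \<alpha>))"
    proof -
      have "real_of_int k * (2 * pi * L / L - \<alpha>) = real_of_int k * (2 * pi * 0 / L - \<alpha>) + 2 * pi * real_of_int k"
        using L by (simp add: field_simps)
      then show ?thesis by (simp only: sin_add sin_int_2pin cos_int_2pin mult_zero_right mult_1_right add_0_right)
    qed
    ultimately show ?thesis using False by simp
  qed
  finally show ?thesis .
qed

section \<open>Integration and trigonometric modes on the flat torus\<close>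

lemma space_flat_torus: "space (vol (flat_torus L)) = sphere 0 1 \<times> sphere 0 1"
  and sets_flat_torus: "sets (vol (flat_torus L)) = sets (restrict_space borel (sphere 0 1 \<times> sphere 0 1))"
  by (simp_all add: flat_torus_def space_restrict_space)

lemma torus_cover_measurable:
  assumes "0 < L"
  shows "torus_cover L \<in> measurable (restrict_space lborel ({0..<L} \<times> {0..<L})) (restrict_space borel (sphere 0 1 \<times> sphere 0 1))"
proof (rule measurable_restrict_space2)
  have "torus_cover L \<in> borel_measurable borel"
    unfolding torus_cover_def[abs_def]
    by (intro borel_measurable_continuous_onI continuous_intros) (use assms in auto)
  then have "torus_cover L \<in> borel_measurable lborel" by simp
  then show "torus_cover L \<in> borel_measurable (restrict_space lborel ({0..<L} \<times> {0..<L}))"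
    by (rule measurable_restrict_space1)
qed (auto simp: torus_cover_def)

lemma torus_square_sets: "{0..<L} \<times> {0..<L::real} \<in> sets borel"
  by (simp add: borel_prod[symmetric])

lemma emeasure_flat_torus:
  assumes L: "0 < L"
  shows "emeasure (vol (flat_torus L)) (sphere 0 1 \<times> sphere 0 1) = ennreal (L\<^sup>2)"
proof -
  have "torus_cover L -` (sphere 0 1 \<times> sphere 0 1) \<inter> ({0..<L} \<times> {0..<L}) = {0..<L} \<times> {0..<L}"
    by (auto simp: torus_cover_def)
  moreover have "emeasure lborel ({0..<L} \<times> {0..<L}) = ennreal (L\<^sup>2)"
    using L by (simp add: lborel_prod[symmetric] lborel.emeasure_pair_measure_Times ennreal_mult'[symmetric] power2_eq_square)
  moreover have sm: "sphere 0 1 \<times> sphere 0 1 \<in> sets (restrict_space borel (sphere 0 1 \<times> sphere 0 1 :: (complex \<times> complex) set))"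
    unfolding sets_restrict_space by (rule image_eqI[of _ _ UNIV]) auto
  moreover have "emeasure (vol (flat_torus L)) (sphere 0 1 \<times> sphere 0 1) =
      emeasure (restrict_space lborel ({0..<L} \<times> {0..<L}))
        (torus_cover L -` (sphere 0 1 \<times> sphere 0 1) \<inter> space (restrict_space lborel ({0..<L} \<times> {0..<L})))"
    by (simp only: flat_torus_def surface.simps) (rule emeasure_distr[OF torus_cover_measurable[OF L] sm])
  ultimately show ?thesis
    using torus_square_sets[of L] by (simp add: space_restrict_space emeasure_restrict_space)
qed

lemma measure_flat_torus: "0 < L \<Longrightarrow> measure (vol (flat_torus L)) (sphere 0 1 \<times> sphere 0 1) = L\<^sup>2"
  by (simp only: measure_def emeasure_flat_torus) simp

lemma integral_flat_torus_product:
  fixes f1 f2 :: "complex \<Rightarrow> real"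
  assumes L: "0 < L" and f: "continuous_on UNIV f1" "continuous_on UNIV f2"
  shows "(LINT z|vol (flat_torus L). f1 (fst z) * f2 (snd z)) =
    (LINT a:{0..<L}|lborel. f1 (cis (2 * pi * a / L))) * (LINT a:{0..<L}|lborel. f2 (cis (2 * pi * a / L)))"
proof -
  let ?h = "\<lambda>z. f1 (fst z) * f2 (snd z)"
  let ?g1 = "\<lambda>a. indicator {0..<L} a * f1 (cis (2 * pi * a / L))"
  let ?g2 = "\<lambda>a. indicator {0..<L} a * f2 (cis (2 * pi * a / L))"
  have hc: "continuous_on UNIV ?h"
    by (intro continuous_intros continuous_on_compose2[OF f(1)] continuous_on_compose2[OF f(2)]) auto
  then have hm: "?h \<in> borel_measurable (restrict_space borel (sphere 0 1 \<times> sphere 0 1))"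
    by (intro measurable_restrict_space1 borel_measurable_continuous_onI)
  have cm: "continuous_on UNIV (\<lambda>a. f1 (cis (2 * pi * a / L)))" "continuous_on UNIV (\<lambda>a. f2 (cis (2 * pi * a / L)))"
    by (rule continuous_on_compose2[OF f(1)], (use L in \<open>auto intro!: continuous_intros\<close>)[2])
      (rule continuous_on_compose2[OF f(2)], (use L in \<open>auto intro!: continuous_intros\<close>)[2])
  note gm[measurable] = cm[THEN borel_measurable_continuous_onI]
  have "bounded (f1 ` sphere 0 1)" "bounded (f2 ` sphere 0 1)"
    by (intro compact_imp_bounded compact_continuous_image continuous_on_subset[OF f(1)] continuous_on_subset[OF f(2)] compact_sphere subset_UNIV)+
  then obtain C1 C2 where C: "\<forall>z\<in>f1 ` sphere 0 1. norm z \<le> C1" "\<forall>z\<in>f2 ` sphere 0 1. norm z \<le> C2"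
    unfolding bounded_iff by blast
  have C': "\<bar>f1 (cis t)\<bar> \<le> C1" "\<bar>f2 (cis t)\<bar> \<le> C2" for t
    using C(1)[THEN bspec, of "f1 (cis t)"] C(2)[THEN bspec, of "f2 (cis t)"] by auto
  have Q: "{0..<L} \<times> {0..<L} \<in> sets (lborel \<Otimes>\<^sub>M lborel)" by simp
  have "emeasure (lborel \<Otimes>\<^sub>M lborel) ({0..<L} \<times> {0..<L}) < \<infinity>"
    using L by (simp add: lborel.emeasure_pair_measure_Times ennreal_mult_less_top)
  then have "integrable (lborel \<Otimes>\<^sub>M lborel) (\<lambda>a. indicator ({0..<L} \<times> {0..<L}) a *\<^sub>R
      (f1 (cis (2 * pi * fst a / L)) * f2 (cis (2 * pi * snd a / L))))"
  proof (rule integrableI_bounded_set_indicator[OF Q, where B = "C1 * C2", rotated])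
    show "AE a in lborel \<Otimes>\<^sub>M lborel. a \<in> {0..<L} \<times> {0..<L} \<longrightarrow>
        norm (f1 (cis (2 * pi * fst a / L)) * f2 (cis (2 * pi * snd a / L))) \<le> C1 * C2"
    proof (intro AE_I2 impI)
      fix a :: "real \<times> real"
      have "0 \<le> C1" using C'(1)[of 0] by linarith
      then show "norm (f1 (cis (2 * pi * fst a / L)) * f2 (cis (2 * pi * snd a / L))) \<le> C1 * C2"
        using C' by (simp add: abs_mult mult_mono)
    qed
  qed measurable
  moreover have "indicator ({0..<L} \<times> {0..<L}) a *\<^sub>R (f1 (cis (2 * pi * fst a / L)) * f2 (cis (2 * pi * snd a / L))) =
      ?g1 (fst a) * ?g2 (snd a)" for a
    by (cases a) (auto simp: indicator_def)
  ultimately have int: "integrable (lborel \<Otimes>\<^sub>M lborel) (\<lambda>a. ?g1 (fst a) * ?g2 (snd a))" by (simp only:)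
  have "(LINT z|vol (flat_torus L). ?h z) = (LINT a|restrict_space lborel ({0..<L} \<times> {0..<L}). ?h (torus_cover L a))"
    by (simp add: flat_torus_def integral_distr[OF torus_cover_measurable[OF L] hm])
  also have "\<dots> = (LINT a:{0..<L} \<times> {0..<L}|lborel. ?h (torus_cover L a))"
    unfolding set_lebesgue_integral_def
    by (rule integral_restrict_space) (use torus_square_sets in simp)
  also have "\<dots> = (LINT a|(lborel \<Otimes>\<^sub>M lborel). ?g1 (fst a) * ?g2 (snd a))"
    unfolding set_lebesgue_integral_def lborel_prod
    by (rule Bochner_Integration.integral_cong) (auto simp: indicator_def torus_cover_def)
  also have "\<dots> = (LINT a|lborel. LINT b|lborel. ?g1 a * ?g2 b)"
    using lborel_pair.integral_fst'[OF int] by simp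
  also have "\<dots> = (LINT a|lborel. ?g1 a) * (LINT b|lborel. ?g2 b)"
    by simp
  finally show ?thesis by (simp add: set_lebesgue_integral_def)
qed

lemma second_deriv0_cos: "second_deriv0 (\<lambda>s. cos (w * s + b) * C) = - w\<^sup>2 * (cos b * C)"
proof -
  have "deriv (\<lambda>s. cos (w * s + b) * C) = (\<lambda>s. - w * sin (w * s + b) * C)"
    by (rule ext, rule DERIV_imp_deriv) (auto intro!: derivative_eq_intros)
  moreover have "deriv (\<lambda>s. - w * sin (w * s + b) * C) 0 = - w * (cos (w * 0 + b) * w) * C"
    by (rule DERIV_imp_deriv) (auto intro!: derivative_eq_intros)
  ultimately show ?thesis by (simp add: second_deriv0_def power2_eq_square)
qed

text \<open>The product of \<open>cos (k * (\<phi> - \<alpha>))\<close> and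
  \<open>cos (l * (\<psi> - \<beta>))\<close> in angular coordinates, written without a choice of
  angles so that it is a continuous function on the ambient space.\<close>

definition torus_mode :: "complex \<times> complex \<Rightarrow> nat \<Rightarrow> nat \<Rightarrow> complex \<times> complex \<Rightarrow> real" where
  "torus_mode x k l z = Re ((fst z * cnj (fst x)) ^ k) * Re ((snd z * cnj (snd x)) ^ l)"

lemma torus_mode_cis: "torus_mode (cis \<alpha>, cis \<beta>) k l (cis \<phi>, cis \<psi>) = cos (real k * (\<phi> - \<alpha>)) * cos (real l * (\<psi> - \<beta>))"
  by (simp add: torus_mode_def cis_cnj cis_mult Complex.DeMoivre)

lemma torus_point:
  assumes "z \<in> sphere 0 1 \<times> (sphere 0 1 :: complex set)"
  obtains \<phi> \<psi> where "z = (cis \<phi>, cis \<psi>)"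
proof -
  have "fst z = cis (Arg (fst z))" "snd z = cis (Arg (snd z))"
    using assms rcis_cmod_Arg[of "fst z"] rcis_cmod_Arg[of "snd z"] by (auto simp: rcis_def)
  then show ?thesis using that by (metis prod.collapse)
qed

lemma flat_torus_point:
  assumes "z \<in> pts (flat_torus L)"
  obtains \<phi> \<psi> where "z = (cis \<phi>, cis \<psi>)"
  using torus_point[of z] assms unfolding space_flat_torus by blast

lemma C2_data_cos_inner:
  fixes v :: "'a::euclidean_space"
  shows "C2_data UNIV (\<lambda>a. cos (w * (v \<bullet> a) + b)) (\<lambda>c a. - w * sin (w * (v \<bullet> a) + b) * (v \<bullet> c))
    (\<lambda>c d a. - w * (w * cos (w * (v \<bullet> a) + b)) * (v \<bullet> d) * (v \<bullet> c) + - w * sin (w * (v \<bullet> a) + b) * 0)"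
  by (rule C2_data_compose[OF C2_data_inner])
    (auto intro!: derivative_eq_intros continuous_intros)

section \<open>The diagonal of the heat kernel on the torus\<close>

locale torus_heat =
  fixes L :: real and p :: "real \<Rightarrow> complex \<times> complex \<Rightarrow> complex \<times> complex \<Rightarrow> real"
  assumes L: "0 < L" and heat_kernel: "heat_kernel (flat_torus L) p"
begin

abbreviation \<omega> :: real where "\<omega> \<equiv> 2 * pi / L"

sublocale compact_heat "flat_torus L" p
proof (rule compact_heat.intro)
  show "compact (pts (flat_torus L))" by (simp only: space_flat_torus) (intro compact_Times compact_sphere)
  show "finite_measure (vol (flat_torus L))"
    by (rule finite_measureI) (simp only: space_flat_torus emeasure_flat_torus[OF L], simp)
qed (simp_all only: space_flat_torus sets_flat_torus heat_kernel)

lemma torus_mode_test: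
  assumes "x \<in> pts (flat_torus L)"
  shows "torus_mode x k l \<in> test (flat_torus L)"
proof -
  obtain \<alpha> \<beta> where x: "x = (cis \<alpha>, cis \<beta>)" using flat_torus_point assms by blast
  have "torus_mode x k l \<circ> torus_cover L = (\<lambda>a. cos (real k * \<omega> * ((1, 0) \<bullet> a) + - real k * \<alpha>) * cos (real l * \<omega> * ((0, 1) \<bullet> a) + - real l * \<beta>))"
    unfolding x by (rule ext) (simp add: torus_cover_def torus_mode_cis case_prod_beta algebra_simps inner_prod_def)
  moreover have "C2_on UNIV (\<lambda>a :: real \<times> real. cos (real k * \<omega> * ((1, 0) \<bullet> a) + - real k * \<alpha>) * cos (real l * \<omega> * ((0, 1) \<bullet> a) + - real l * \<beta>))"
    by (rule C2_on_of_data[OF C2_data_mult[OF C2_data_cos_inner C2_data_cos_inner]])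
  ultimately show ?thesis by (simp add: flat_torus_def)
qed

lemma torus_mode_laplacian:
  assumes "x \<in> pts (flat_torus L)" "z \<in> pts (flat_torus L)"
  shows "laplacian (flat_torus L) (torus_mode x k l) z = - (\<omega>\<^sup>2 * (real k ^ 2 + real l ^ 2)) * torus_mode x k l z"
proof -
  obtain \<alpha> \<beta> where x: "x = (cis \<alpha>, cis \<beta>)" using flat_torus_point assms by blast
  obtain \<phi> \<psi> where z: "z = (cis \<phi>, cis \<psi>)" using flat_torus_point assms by blast
  have 1: "(\<lambda>s. torus_mode x k l (fst z * cis (2 * pi * s / L), snd z)) =
      (\<lambda>s. cos (real k * \<omega> * s + real k * (\<phi> - \<alpha>)) * cos (real l * (\<psi> - \<beta>)))"
    unfolding x z by (rule ext) (simp add: cis_mult torus_mode_cis algebra_simps)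
  have 2: "(\<lambda>s. torus_mode x k l (fst z, snd z * cis (2 * pi * s / L))) =
      (\<lambda>s. cos (real l * \<omega> * s + real l * (\<psi> - \<beta>)) * cos (real k * (\<phi> - \<alpha>)))"
    unfolding x z by (rule ext) (simp add: cis_mult torus_mode_cis algebra_simps)
  have "laplacian (flat_torus L) (torus_mode x k l) z =
      - (real k * \<omega>)\<^sup>2 * (cos (real k * (\<phi> - \<alpha>)) * cos (real l * (\<psi> - \<beta>))) +
      - (real l * \<omega>)\<^sup>2 * (cos (real l * (\<psi> - \<beta>)) * cos (real k * (\<phi> - \<alpha>)))"
    by (simp only: flat_torus_def surface.simps 1 2 second_deriv0_cos)
  also have "\<dots> = - (\<omega>\<^sup>2 * (real k ^ 2 + real l ^ 2)) * torus_mode x k l z"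
  proof -
    have "- (k * w)\<^sup>2 * (a * b) + - (l * w)\<^sup>2 * (b * a) = - (w\<^sup>2 * (k\<^sup>2 + l\<^sup>2)) * (a * b)" for k l w a b :: real
      by (simp add: power2_eq_square algebra_simps)
    then show ?thesis unfolding x z torus_mode_cis .
  qed
  finally show ?thesis .
qed

lemma torus_mode_cont: "continuous_on A (torus_mode x k l)"
  unfolding torus_mode_def by (intro continuous_intros)

lemma torus_mode_self: "x \<in> pts (flat_torus L) \<Longrightarrow> torus_mode x k l x = 1"
  by (erule flat_torus_point) (simp add: torus_mode_cis)

text \<open>The mode is an eigenfunction equal to 1 at \<open>x\<close>, so its flow satisfies a
  scalar linear equation with initial value 1. Comparing with the exponential solution in both
  directions identifies the two.\<close>

lemma avg_torus_mode:
  assumes x: "x \<in> pts (flat_torus L)" and t: "0 < t"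
  shows "avg t x (torus_mode x k l) = exp (- (\<omega>\<^sup>2 * t / 2) * real k ^ 2) * exp (- (\<omega>\<^sup>2 * t / 2) * real l ^ 2)"
proof -
  define \<kappa> where "\<kappa> = \<omega>\<^sup>2 * (real k ^ 2 + real l ^ 2)"
  let ?U = "flow x (torus_mode x k l)" and ?g = "\<lambda>z. - \<kappa> * torus_mode x k l z"
  have lap: "laplacian (flat_torus L) (torus_mode x k l) z = ?g z" if "z \<in> pts (flat_torus L)" for z
    unfolding \<kappa>_def by (rule torus_mode_laplacian[OF x that])
  have cg: "continuous_on (pts (flat_torus L)) ?g" by (intro continuous_intros torus_mode_cont)
  have Uc: "continuous_on {0..} ?U"
    by (rule flow_cont[OF x torus_mode_test[OF x] _ cg]) (rule lap)
  have Ud: "(?U has_real_derivative - (\<kappa> / 2) * ?U s) (at s)" if s: "0 < s" for s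
  proof -
    have "(?U has_real_derivative avg s x ?g / 2) (at s)"
      by (rule flow_deriv[OF x torus_mode_test[OF x] _ cg s]) (rule lap)
    moreover have "avg s x ?g = - \<kappa> * avg s x (torus_mode x k l)"
      unfolding avg_def by (simp only: mult.left_commute[of _ "- \<kappa>"] integral_mult_right_zero)
    ultimately show ?thesis using s by (simp add: flow_pos)
  qed
  have Ec: "continuous_on {0..} (\<lambda>t. exp (- (\<kappa> / 2) * t))" by (intro continuous_intros)
  have Ed: "((\<lambda>t. exp (- (\<kappa> / 2) * t)) has_real_derivative - (\<kappa> / 2) * exp (- (\<kappa> / 2) * s)) (at s)" for s
    by (auto intro!: derivative_eq_intros)
  have U0: "?U 0 = 1" by (simp add: flow_def torus_mode_self[OF x])
  have "0 \<le> ?U t - exp (- (\<kappa> / 2) * t)"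
    by (rule ode_nonneg[OF continuous_on_diff[OF Uc Ec] DERIV_diff[OF Ud Ed], where a = "\<kappa> / 2"])
      (use t in \<open>auto simp: U0 algebra_simps\<close>)
  moreover have "0 \<le> exp (- (\<kappa> / 2) * t) - ?U t"
    by (rule ode_nonneg[OF continuous_on_diff[OF Ec Uc] DERIV_diff[OF Ed Ud], where a = "\<kappa> / 2"])
      (use t in \<open>auto simp: U0 algebra_simps\<close>)
  ultimately have "avg t x (torus_mode x k l) = exp (- (\<kappa> / 2) * t)"
    using t by (simp add: flow_pos)
  also have "- (\<kappa> / 2) * t = - (\<omega>\<^sup>2 * t / 2) * real k ^ 2 + - (\<omega>\<^sup>2 * t / 2) * real l ^ 2"
  proof -
    have "- (w * (a + b) / 2) * t = - (w * t / 2) * a + - (w * t / 2) * b" for w a b :: real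
      by (simp add: field_simps)
    then show ?thesis unfolding \<kappa>_def .
  qed
  finally show ?thesis by (simp only: exp_add)
qed

text \<open>A function equal to 1 at \<open>x\<close> and smaller elsewhere, whose powers are
  trigonometric polynomials: up to normalisation, \<open>bump x z ^ n\<close> is a product of two de
  la Vallee Poussin kernels.\<close>

definition bump :: "complex \<times> complex \<Rightarrow> complex \<times> complex \<Rightarrow> real" where
  "bump x z = (1 + Re (fst z * cnj (fst x))) / 2 * ((1 + Re (snd z * cnj (snd x))) / 2)"

lemma bump_cis: "bump (cis \<alpha>, cis \<beta>) (cis \<phi>, cis \<psi>) = (1 + cos (\<phi> - \<alpha>)) / 2 * ((1 + cos (\<psi> - \<beta>)) / 2)"
  by (simp add: bump_def cis_cnj cis_mult)

lemma bump_cont: "continuous_on A (bump x)"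
  unfolding bump_def by (intro continuous_intros) auto

text \<open>Both factors are expanded by the cosine formula. Modes are indexed by natural numbers,
  so the centred frequency \<open>i - n\<close> is replaced by its absolute value, the cosine being
  even.\<close>

lemma bump_power:
  assumes "x \<in> pts (flat_torus L)" "z \<in> pts (flat_torus L)"
  shows "bump x z ^ n = (\<Sum>i\<le>2 * n. \<Sum>j\<le>2 * n. real (2 * n choose i) * real (2 * n choose j) / 16 ^ n *
    torus_mode x (nat \<bar>int i - int n\<bar>) (nat \<bar>int j - int n\<bar>) z)"
proof -
  obtain \<alpha> \<beta> where x: "x = (cis \<alpha>, cis \<beta>)" using flat_torus_point assms by blast
  obtain \<phi> \<psi> where z: "z = (cis \<phi>, cis \<psi>)" using flat_torus_point assms by blast
  have c: "cos (real (nat \<bar>int i - int n\<bar>) * a) = cos ((real i - real n) * a)" for i a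
  proof -
    have "real (nat \<bar>int i - int n\<bar>) = \<bar>real i - real n\<bar>" by simp
    moreover have "cos (\<bar>d\<bar> * a) = cos (d * a)" for d :: real
      by (cases "0 \<le> d") (simp_all add: abs_of_neg)
    ultimately show ?thesis by (simp only:)
  qed
  have "bump x z ^ n = (\<Sum>i\<le>2 * n. real (2 * n choose i) * cos ((real i - real n) * (\<phi> - \<alpha>))) / 4 ^ n *
      ((\<Sum>j\<le>2 * n. real (2 * n choose j) * cos ((real j - real n) * (\<psi> - \<beta>))) / 4 ^ n)"
    unfolding x z bump_cis power_mult_distrib cos_power_expansion ..
  also have "\<dots> = (\<Sum>i\<le>2 * n. \<Sum>j\<le>2 * n. real (2 * n choose i) * cos ((real i - real n) * (\<phi> - \<alpha>)) *
      (real (2 * n choose j) * cos ((real j - real n) * (\<psi> - \<beta>)))) / (4 ^ n * 4 ^ n)"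
    by (simp only: sum_product times_divide_times_eq)
  also have "(4 :: real) ^ n * 4 ^ n = 16 ^ n" by (simp only: power_mult_distrib[symmetric]) simp
  finally have eq: "bump x z ^ n = (\<Sum>i\<le>2 * n. \<Sum>j\<le>2 * n. real (2 * n choose i) * cos ((real i - real n) * (\<phi> - \<alpha>)) *
      (real (2 * n choose j) * cos ((real j - real n) * (\<psi> - \<beta>)))) / 16 ^ n" .
  show ?thesis
  proof -
    have "(a * b * (a' * b')) / k = a * a' / k * (b * b')" for a b a' b' k :: real by simp
    then show ?thesis unfolding eq unfolding x z torus_mode_cis c sum_divide_distrib by (simp only:)
  qed
qed

lemma avg_bump_power:
  assumes x: "x \<in> pts (flat_torus L)" and t: "0 < t"
  shows "avg t x (\<lambda>z. bump x z ^ n) =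
    ((\<Sum>i\<le>2 * n. real (2 * n choose i) * exp (- (\<omega>\<^sup>2 * t / 2) * (real i - real n)\<^sup>2)) / 4 ^ n)\<^sup>2"
proof -
  let ?m = "\<lambda>i j. torus_mode x (nat \<bar>int i - int n\<bar>) (nat \<bar>int j - int n\<bar>)"
  let ?c = "\<lambda>i j. real (2 * n choose i) * real (2 * n choose j) / 16 ^ n"
  let ?e = "\<lambda>i. exp (- (\<omega>\<^sup>2 * t / 2) * (real i - real n)\<^sup>2)"
  have int: "integrable (vol (flat_torus L)) (\<lambda>z. ?c i j * (p t x z * ?m i j z))" for i j
    by (intro integrable_mult_right avg_integrable[OF t x] torus_mode_cont)
  have "avg t x (\<lambda>z. bump x z ^ n) = avg t x (\<lambda>z. \<Sum>i\<le>2 * n. \<Sum>j\<le>2 * n. ?c i j * ?m i j z)"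
    by (rule avg_cong[OF bump_power[OF x]])
  also have "\<dots> = (LINT z|vol (flat_torus L). (\<Sum>i\<le>2 * n. \<Sum>j\<le>2 * n. ?c i j * (p t x z * ?m i j z)))"
    unfolding avg_def by (simp only: sum_distrib_left mult.left_commute[of "p t x _"])
  also have "\<dots> = (\<Sum>i\<le>2 * n. \<Sum>j\<le>2 * n. LINT z|vol (flat_torus L). ?c i j * (p t x z * ?m i j z))"
    by (subst Bochner_Integration.integral_sum, intro Bochner_Integration.integrable_sum int)
      (intro sum.cong refl Bochner_Integration.integral_sum int)
  also have "\<dots> = (\<Sum>i\<le>2 * n. \<Sum>j\<le>2 * n. ?c i j * avg t x (?m i j))"
    by (simp only: avg_def integral_mult_right_zero)
  also have "\<dots> = (\<Sum>i\<le>2 * n. \<Sum>j\<le>2 * n. (real (2 * n choose i) * ?e i / 4 ^ n) * (real (2 * n choose j) * ?e j / 4 ^ n))"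
  proof (intro sum.cong refl)
    fix i j
    have sq: "real (nat \<bar>int i - int n\<bar>) ^ 2 = (real i - real n)\<^sup>2" for i by simp
    have "(16 :: real) ^ n = 4 ^ n * 4 ^ n" by (simp only: power_mult_distrib[symmetric]) simp
    then show "?c i j * avg t x (?m i j) = (real (2 * n choose i) * ?e i / 4 ^ n) * (real (2 * n choose j) * ?e j / 4 ^ n)"
      unfolding avg_torus_mode[OF x t] sq by simp
  qed
  also have "\<dots> = (\<Sum>i\<le>2 * n. real (2 * n choose i) * ?e i / 4 ^ n)\<^sup>2"
    by (simp only: power2_eq_square sum_product)
  finally show ?thesis by (simp only: sum_divide_distrib)
qed

text \<open>Integration over a full period kills every frequency except 0, that is
  \<open>i = n\<close>, so only the central binomial coefficient survives in each
  coordinate.\<close>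

lemma integral_bump_power:
  assumes "x \<in> pts (flat_torus L)"
  shows "(LINT z|vol (flat_torus L). bump x z ^ n) = (L * real (2 * n choose n) / 4 ^ n)\<^sup>2"
proof -
  obtain \<alpha> \<beta> where x: "x = (cis \<alpha>, cis \<beta>)" using flat_torus_point assms by blast
  have one: "(LINT a:{0..<L}|lborel. ((1 + Re (cis (2 * pi * a / L) * cnj (cis \<alpha>))) / 2) ^ n) =
      L * real (2 * n choose n) / 4 ^ n" for \<alpha>
  proof -
    have i: "set_integrable lborel {0..<L} (\<lambda>a. real (2 * n choose i) / 4 ^ n * cos (real_of_int (int i - int n) * (2 * pi * a / L - \<alpha>)))" for i
      by (rule set_integrable_subset[OF borel_integrable_atLeastAtMost'[of 0 L]])
        (use L in \<open>auto intro!: continuous_intros\<close>)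
    have "(LINT a:{0..<L}|lborel. ((1 + Re (cis (2 * pi * a / L) * cnj (cis \<alpha>))) / 2) ^ n) =
      (LINT a:{0..<L}|lborel. (\<Sum>i\<le>2 * n. real (2 * n choose i) / 4 ^ n * cos (real_of_int (int i - int n) * (2 * pi * a / L - \<alpha>))))"
      by (simp add: cis_cnj cis_mult cos_power_expansion sum_divide_distrib)
    also have "\<dots> = (\<Sum>i\<le>2 * n. LINT a:{0..<L}|lborel. real (2 * n choose i) / 4 ^ n * cos (real_of_int (int i - int n) * (2 * pi * a / L - \<alpha>)))"
      using i unfolding set_lebesgue_integral_def set_integrable_def scaleR_sum_right
      by (intro Bochner_Integration.integral_sum) auto
    also have "\<dots> = (\<Sum>i\<le>2 * n. if i = n then real (2 * n choose n) / 4 ^ n * L else 0)"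
      by (intro sum.cong refl) (simp only: set_integral_mult_right integral_cos_period[OF L], simp)
    also have "\<dots> = L * real (2 * n choose n) / 4 ^ n" by simp
    finally show ?thesis .
  qed
  have "(LINT z|vol (flat_torus L). bump x z ^ n) =
      (LINT z|vol (flat_torus L). ((1 + Re (fst z * cnj (cis \<alpha>))) / 2) ^ n * ((1 + Re (snd z * cnj (cis \<beta>))) / 2) ^ n)"
    by (simp only: x bump_def fst_conv snd_conv power_mult_distrib)
  also have "\<dots> = (LINT a:{0..<L}|lborel. ((1 + Re (cis (2 * pi * a / L) * cnj (cis \<alpha>))) / 2) ^ n) *
      (LINT a:{0..<L}|lborel. ((1 + Re (cis (2 * pi * a / L) * cnj (cis \<beta>))) / 2) ^ n)"
    by (rule integral_flat_torus_product[OF L]) (intro continuous_intros; simp)+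
  finally show ?thesis by (simp only: one power2_eq_square)
qed

text \<open>The ratio of the average of \<open>bump x z ^ n\<close> to its integral tends to the
  diagonal value. Numerator and denominator factor over the coordinates and the powers of 4 cancel;
  each coordinate leaves the binomial average of Gaussian weights whose limit is theta.\<close>

lemma torus_diagonal:
  assumes x: "x \<in> pts (flat_torus L)" and t: "0 < t"
  shows "p t x x = (theta (\<omega>\<^sup>2 * t / 2))\<^sup>2 / L\<^sup>2"
proof -
  let ?s = "\<omega>\<^sup>2 * t / 2" and ?V = "vol (flat_torus L)"
  have s: "0 < ?s" using L t by simp
  let ?W = "\<lambda>n. \<Sum>i\<le>2 * n. real (2 * n choose i) * exp (- ?s * (real i - real n)\<^sup>2)"
  obtain \<alpha> \<beta> where xc: "x = (cis \<alpha>, cis \<beta>)" using flat_torus_point x by blast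
  have half_bounds: "0 \<le> (1 + r) / 2 \<and> (1 + r) / 2 \<le> 1" if "- 1 \<le> r" "r \<le> 1" for r :: real
    using that by simp
  have half1: "0 \<le> (1 + cos a) / 2" and half2: "(1 + cos a) / 2 \<le> 1" for a :: real
    using half_bounds[OF cos_ge_minus_one cos_le_one] by blast+
  note half = half1 half2
  have lim: "(\<lambda>n. (LINT z|?V. p t x z * bump x z ^ n) / (LINT z|?V. bump x z ^ n)) \<longlonglongrightarrow> p t x x"
  proof (rule approximate_identity[OF x bump_cont])
    show "0 \<le> bump x z" if zp: "z \<in> pts (flat_torus L)" for z
    proof -
      obtain \<phi> \<psi> where z: "z = (cis \<phi>, cis \<psi>)" using flat_torus_point zp by blast
      show ?thesis unfolding xc z bump_cis by (intro mult_nonneg_nonneg half)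
    qed
    show "bump x z < 1" if zp: "z \<in> pts (flat_torus L)" and zx: "z \<noteq> x" for z
    proof -
      obtain \<phi> \<psi> where z: "z = (cis \<phi>, cis \<psi>)" using flat_torus_point zp by blast
      have eq: "cis a = cis b" if "cos (a - b) = 1" for a b
      proof -
        have "sin (a - b) = 0" using that by (metis cos_one_sin_zero)
        then have "cis (a - b) = 1" using that by (simp add: complex_eq_iff)
        then have "cis (a - b) * cis b = cis b" by simp
        then show ?thesis by (simp add: cis_mult)
      qed
      have "\<not> (cos (\<phi> - \<alpha>) = 1 \<and> cos (\<psi> - \<beta>) = 1)" using zx eq unfolding xc z by blast
      moreover have "(1 + r) / 2 < 1" if "r \<noteq> 1" "r \<le> 1" for r :: real
        using that by simp
      ultimately consider "(1 + cos (\<phi> - \<alpha>)) / 2 < 1" | "(1 + cos (\<psi> - \<beta>)) / 2 < 1"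
        using cos_le_one[of "\<phi> - \<alpha>"] cos_le_one[of "\<psi> - \<beta>"] by blast
      then show ?thesis
      proof cases
        case 1
        have "bump x z \<le> (1 + cos (\<phi> - \<alpha>)) / 2 * 1"
          unfolding xc z bump_cis by (intro mult_left_mono half)
        with 1 show ?thesis by simp
      next
        case 2
        have "bump x z \<le> 1 * ((1 + cos (\<psi> - \<beta>)) / 2)"
          unfolding xc z bump_cis by (intro mult_right_mono half)
        with 2 show ?thesis by simp
      qed
    qed
    show "bump x x = 1" unfolding xc bump_cis by simp
    show "0 < (LINT z|?V. bump x z ^ n)" for n
      unfolding integral_bump_power[OF x] using L by simp
    show "(\<lambda>n. \<rho> ^ n / (LINT z|?V. bump x z ^ n)) \<longlonglongrightarrow> 0" if r: "0 < \<rho>" "\<rho> < 1" for \<rho> :: real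
    proof (rule tendsto_sandwich[OF _ _ tendsto_const])
      show "(\<lambda>n. \<rho> ^ n * (2 * real n + 1)\<^sup>2 / L\<^sup>2) \<longlonglongrightarrow> 0"
        using r L by real_asymp
      have "\<rho> ^ n / (LINT z|?V. bump x z ^ n) \<le> \<rho> ^ n * (2 * real n + 1)\<^sup>2 / L\<^sup>2" for n
      proof -
        \<comment> \<open>The central coefficient is the largest of the \<open>2 * n + 1\<close>
          coefficients adding up to \<open>4 ^ n\<close>; hence the mass of the powers of the bump
          decays only polynomially.\<close>
        have "(4::real) ^ n \<le> (2 * real n + 1) * real (2 * n choose n)"
        proof -
          have "(4::real) ^ n = (\<Sum>i\<le>2 * n. real (2 * n choose i))"
            using choose_row_sum[of "2 * n"] by (simp add: power_mult flip: of_nat_sum)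
          also have "\<dots> \<le> (\<Sum>i\<le>2 * n. real (2 * n choose n))"
            by (intro sum_mono of_nat_mono binomial_maximum')
          also have "\<dots> = (2 * real n + 1) * real (2 * n choose n)"
            by (simp add: add.commute)
          finally show ?thesis .
        qed
        moreover have "L / A \<le> L * C / k" if h: "k \<le> A * C" "0 < k" "0 < A" for A C k :: real
        proof -
          have "L * k \<le> L * C * A" using mult_left_mono[OF h(1), of L] L by (simp add: mult_ac)
          then show ?thesis using h by (simp add: pos_divide_le_eq pos_le_divide_eq)
        qed
        ultimately have "L / (2 * real n + 1) \<le> L * real (2 * n choose n) / 4 ^ n"
          by simp
        then have "(L / (2 * real n + 1))\<^sup>2 \<le> (LINT z|?V. bump x z ^ n)"
          unfolding integral_bump_power[OF x] using L by (intro power_mono) auto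
        then have "\<rho> ^ n / (LINT z|?V. bump x z ^ n) \<le> \<rho> ^ n / (L / (2 * real n + 1))\<^sup>2"
          using L r by (intro divide_left_mono mult_pos_pos) (auto simp: integral_bump_power[OF x])
        then show ?thesis by (simp add: power_divide)
      qed
      then show "eventually (\<lambda>n. \<rho> ^ n / (LINT z|?V. bump x z ^ n) \<le> \<rho> ^ n * (2 * real n + 1)\<^sup>2 / L\<^sup>2) sequentially"
        by simp
      show "eventually (\<lambda>n. 0 \<le> \<rho> ^ n / (LINT z|?V. bump x z ^ n)) sequentially"
        using r by (simp add: integral_bump_power[OF x])
    qed
    show "continuous_on (pts (flat_torus L)) (p t x)" by (rule p_slice_cont[OF t x])
  qed
  have "(LINT z|?V. p t x z * bump x z ^ n) / (LINT z|?V. bump x z ^ n) = (?W n / real (2 * n choose n))\<^sup>2 / L\<^sup>2" for n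
  proof -
    have "(LINT z|?V. p t x z * bump x z ^ n) = (?W n / 4 ^ n)\<^sup>2"
      using avg_bump_power[OF x t] by (simp only: avg_def)
    moreover have "(A / k)\<^sup>2 / (L * B / k)\<^sup>2 = (A / B)\<^sup>2 / L\<^sup>2" if "k \<noteq> 0" for A B k :: real
      using that by (simp add: power_divide power_mult_distrib mult.commute)
    ultimately show ?thesis unfolding integral_bump_power[OF x] by simp
  qed
  with lim have "(\<lambda>n. (?W n / real (2 * n choose n))\<^sup>2 / L\<^sup>2) \<longlonglongrightarrow> p t x x" by simp
  moreover have "(\<lambda>n. (?W n / real (2 * n choose n))\<^sup>2 / L\<^sup>2) \<longlonglongrightarrow> (theta ?s)\<^sup>2 / L\<^sup>2"
    by (intro tendsto_intros theta_limit s) (use L in simp)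
  ultimately show ?thesis by (rule LIMSEQ_unique)
qed

end

lemma thick_points_torus:
  fixes c :: "nat \<Rightarrow> real" and PX :: "'w measure" and PB :: "complex \<times> complex \<Rightarrow> 'b measure"
  assumes c: "cutoff_sequence c" and L: "0 < L"
    and setting: "liouville_setting (flat_torus L) p (gff_cov (flat_torus L) p) (gff_cutoff_cov (flat_torus L) p c) \<gamma> PX X Xn PB B F"
  shows "AE w in PX. \<forall>x\<in>pts (flat_torus L). AE b in PB x.
    {t \<in> {0..}. liouville_bm (\<lambda>s. F w x s b) (\<lambda>s. B x s b) t \<in> pts (flat_torus L) - thick_points (flat_torus L) c Xn \<gamma> w}
      \<in> null_sets (lebesgue_on {0..})"
proof -
  have "heat_kernel (flat_torus L) p" using setting unfolding liouville_setting_def by blast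
  then interpret torus_heat L p by (intro torus_heat.intro L)
  have m: "measure (vol (flat_torus L)) (pts (flat_torus L)) = L\<^sup>2"
    by (simp only: space_flat_torus measure_flat_torus[OF L])
  let ?s = "\<lambda>t. \<omega>\<^sup>2 * t / 2" and ?q = "\<lambda>t. (theta (\<omega>\<^sup>2 * t / 2))\<^sup>2 / L\<^sup>2"
  have sp: "0 < ?s t" if "0 < t" for t using L that by simp
  have heq: "pi * (?q t - 1 / measure (vol (flat_torus L)) (pts (flat_torus L))) = pi / L\<^sup>2 * ((theta (?s t))\<^sup>2 - 1)" for t
    unfolding m by (simp add: right_diff_distrib)
  define x0 :: "complex \<times> complex" where "x0 = (1, 1)"
  have x0: "x0 \<in> pts (flat_torus L)" by (simp add: x0_def space_flat_torus)
  have qc: "continuous_on {0<..} ?q"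
    by (rule continuous_on_eq[OF p_diag_cont[OF x0]]) (simp add: torus_diagonal[OF x0])
  \<comment> \<open>Writing \<open>J = sqrt (pi / s)\<close>, with \<open>s\<close> the argument of
    theta, the square of theta differs from \<open>J\<^sup>2 + 1\<close> by at most
    \<open>2 * J + 1\<close>. Here \<open>J\<close> is \<open>L / sqrt (2 * pi) / sqrt t\<close>,
    and \<open>pi / L\<^sup>2 * J\<^sup>2\<close> is the main term
    \<open>1 / (2 * t)\<close>.\<close>
  define K where "K = pi / L\<^sup>2 * (2 * (L / sqrt (2 * pi)) + 1)"
  show ?thesis
  proof (rule thick_points_of_diagonal[OF c setting, where q = ?q and K = K])
    show "p t x x = ?q t" if "0 < t" "x \<in> pts (flat_torus L)" for t x by (rule torus_diagonal[OF that(2,1)])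
    show "continuous_on {0<..} ?q" by (rule qc)
  next
    fix t :: real assume t: "0 < t" "t \<le> 1"
    let ?J = "sqrt (pi / ?s t)"
    have J2: "?J\<^sup>2 = L\<^sup>2 / (2 * pi * t)"
      using L t by (simp add: power_divide power2_eq_square field_simps)
    have J: "?J = L / sqrt (2 * pi) / sqrt t"
    proof -
      have "?J = sqrt (L\<^sup>2 / (2 * pi * t))" using J2 L t by (metis real_sqrt_ge_0_iff real_sqrt_unique less_imp_le real_sqrt_ge_zero sp divide_nonneg_pos pi_ge_zero)
      then show ?thesis using L by (simp add: real_sqrt_divide real_sqrt_mult)
    qed
    have J0: "0 \<le> ?J" using sp[OF t(1)] by simp
    define d where "d = theta (?s t) - ?J"
    have d: "\<bar>d\<bar> \<le> 1" unfolding d_def by (rule theta_asymp[OF sp[OF t(1)]])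
    have "(theta (?s t))\<^sup>2 - 1 - ?J\<^sup>2 = 2 * ?J * d + (d\<^sup>2 - 1)"
      unfolding d_def by (simp add: power2_eq_square algebra_simps)
    moreover have "\<bar>2 * ?J * d\<bar> \<le> 2 * ?J * 1"
      unfolding abs_mult using J0 d by (intro mult_mono) auto
    moreover have "\<bar>d\<^sup>2 - 1\<bar> \<le> 1" using d abs_square_le_1[of d] by (simp add: abs_le_iff)
    ultimately have "\<bar>(theta (?s t))\<^sup>2 - 1 - ?J\<^sup>2\<bar> \<le> 2 * ?J + 1" by linarith
    also have "1 \<le> 1 / sqrt t" using t by simp
    then have "2 * ?J + 1 \<le> (2 * (L / sqrt (2 * pi)) + 1) / sqrt t"
      unfolding J by (simp add: add_divide_distrib)
    finally have "pi / L\<^sup>2 * \<bar>(theta (?s t))\<^sup>2 - 1 - ?J\<^sup>2\<bar> \<le> pi / L\<^sup>2 * ((2 * (L / sqrt (2 * pi)) + 1) / sqrt t)"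
      by (intro mult_left_mono) auto
    moreover have "pi / L\<^sup>2 * ((theta (?s t))\<^sup>2 - 1) - 1 / (2 * t) = pi / L\<^sup>2 * ((theta (?s t))\<^sup>2 - 1 - ?J\<^sup>2)"
    proof -
      have "pi / L\<^sup>2 * ?J\<^sup>2 = 1 / (2 * t)" unfolding J2 using L by (simp add: power2_eq_square)
      then show ?thesis by (simp only: right_diff_distrib)
    qed
    ultimately show "\<bar>pi * (?q t - 1 / measure (vol (flat_torus L)) (pts (flat_torus L))) - 1 / (2 * t)\<bar> \<le> K / sqrt t"
      unfolding heq K_def by (simp add: abs_mult)
  next
    define E where "E = 1 - exp (- ?s 1)"
    have E: "0 < E" unfolding E_def using sp[of 1] by simp
    \<comment> \<open>From the factors of theta squared minus 1: for \<open>t \<ge> 1\<close> the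
      geometric bound makes theta minus 1 at most \<open>2 / E\<close> times the exponential and
      theta plus 1 at most \<open>2 + 2 / E\<close>.\<close>
    define A where "A = pi / L\<^sup>2 * (2 / E * (2 + 2 / E))"
    have A: "0 \<le> A" using E by (simp add: A_def)
    let ?k = "\<lambda>t::real. A * exp (- ?s t)"
    have w: "0 < \<omega>\<^sup>2 / 2" using L by simp
    have k: "set_integrable lborel {1..} ?k"
    proof (rule set_integral_atLeast_FTC(1)[where F = "\<lambda>t. - A * exp (- (\<omega>\<^sup>2 / 2) * t) / (\<omega>\<^sup>2 / 2)" and T = 0])
      have "((\<lambda>t::real. - A * exp (- v * t) / v) \<longlongrightarrow> 0) at_top" if "0 < v" for v
        using that by real_asymp
      from this[OF w] show "((\<lambda>t. - A * exp (- (\<omega>\<^sup>2 / 2) * t) / (\<omega>\<^sup>2 / 2)) \<longlongrightarrow> 0) at_top" .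
      show "((\<lambda>t. - A * exp (- (\<omega>\<^sup>2 / 2) * t) / (\<omega>\<^sup>2 / 2)) has_real_derivative ?k t) (at t)" for t
      proof -
        have "((\<lambda>t. - A * exp (- v * t) / v) has_real_derivative A * exp (- v * t)) (at t)" if "0 < v" for v
          using that by (auto intro!: derivative_eq_intros)
        from this[OF w] show ?thesis by simp
      qed
    qed (use A in auto)
    show "set_integrable lborel {1..} (\<lambda>t. pi * (?q t - 1 / measure (vol (flat_torus L)) (pts (flat_torus L))))"
    proof (rule set_integrable_bound[OF k])
      have "continuous_on {1..} (\<lambda>t. pi * (?q t - 1 / measure (vol (flat_torus L)) (pts (flat_torus L))))"
        by (intro continuous_intros continuous_on_subset[OF qc]) auto
      from borel_measurable_continuous_on_indicator[OF _ this]
      show "set_borel_measurable lborel {1..} (\<lambda>t. pi * (?q t - 1 / measure (vol (flat_torus L)) (pts (flat_torus L))))"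
        by (simp add: set_borel_measurable_def)
      show "AE t in lborel. t \<in> {1..} \<longrightarrow>
          norm (pi * (?q t - 1 / measure (vol (flat_torus L)) (pts (flat_torus L)))) \<le> norm (?k t)"
      proof (intro AE_I2 impI)
        fix t :: real assume "t \<in> {1..}"
        then have t: "1 \<le> t" "0 < t" by auto
        note s = sp[OF t(2)]
        define e where "e = exp (- ?s t)"
        have e: "0 < e" "e \<le> 1" using s by (simp_all add: e_def)
        have "\<omega>\<^sup>2 * 1 \<le> \<omega>\<^sup>2 * t" using t(1) by (intro mult_left_mono) auto
        then have "e \<le> exp (- ?s 1)" unfolding e_def by simp
        then have E1: "E \<le> 1 - e" by (simp add: E_def)
        have "theta (?s t) \<le> 1 + 2 * (e / (1 - e))" unfolding e_def by (rule theta_le[OF s])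
        also have "e / (1 - e) \<le> e / E" using E E1 e by (intro divide_left_mono mult_pos_pos) auto
        finally have th: "theta (?s t) - 1 \<le> 2 / E * e" by simp
        have th1: "1 \<le> theta (?s t)" by (rule theta_ge_1[OF s])
        have "e / E \<le> 1 / E" using E e by (intro divide_right_mono) auto
        with th have th2: "theta (?s t) + 1 \<le> 2 + 2 / E" by simp
        have "(theta (?s t))\<^sup>2 - 1 = (theta (?s t) - 1) * (theta (?s t) + 1)"
          by (simp add: power2_eq_square algebra_simps)
        also have "\<dots> \<le> (2 / E * e) * (2 + 2 / E)"
          using th th1 th2 E e by (intro mult_mono) auto
        finally have "pi / L\<^sup>2 * ((theta (?s t))\<^sup>2 - 1) \<le> pi / L\<^sup>2 * ((2 / E * e) * (2 + 2 / E))"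
          by (intro mult_left_mono) auto
        also have "\<dots> = ?k t" by (simp add: A_def e_def)
        finally have up: "pi / L\<^sup>2 * ((theta (?s t))\<^sup>2 - 1) \<le> ?k t" .
        moreover have "0 \<le> pi / L\<^sup>2 * ((theta (?s t))\<^sup>2 - 1)"
          using th1 by (intro mult_nonneg_nonneg) (auto intro: one_le_power)
        ultimately show "norm (pi * (?q t - 1 / measure (vol (flat_torus L)) (pts (flat_torus L)))) \<le> norm (?k t)"
          unfolding heq by simp
      qed
    qed
  qed
qed

theorem corollary2p16:
  fixes \<gamma> :: real and c :: "nat \<Rightarrow> real"
  assumes "0 \<le> \<gamma>" and "\<gamma> < 2" and "cutoff_sequence c"
  shows
    "(\<forall>m>0. \<forall>p (PX :: 'w measure) X Xn (PB :: real ^ 2 \<Rightarrow> 'b measure) B F.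
        liouville_setting plane p (mff_cov m) (mff_cutoff_cov m c) \<gamma> PX X Xn PB B F \<longrightarrow>
        (AE w in PX. \<forall>x\<in>pts plane. AE b in PB x.
           {t \<in> {0..}. liouville_bm (\<lambda>s. F w x s b) (\<lambda>s. B x s b) t
                          \<in> pts plane - thick_points plane c Xn \<gamma> w}
             \<in> null_sets (lebesgue_on {0..})))
     \<and>
     (\<forall>L>0. \<forall>p (PX :: 'w measure) X Xn (PB :: complex \<times> complex \<Rightarrow> 'b measure) B F.
        liouville_setting (flat_torus L) p (gff_cov (flat_torus L) p)
          (gff_cutoff_cov (flat_torus L) p c) \<gamma> PX X Xn PB B F \<longrightarrow>
        (AE w in PX. \<forall>x\<in>pts (flat_torus L). AE b in PB x.
           {t \<in> {0..}. liouville_bm (\<lambda>s. F w x s b) (\<lambda>s. B x s b) t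
                          \<in> pts (flat_torus L) - thick_points (flat_torus L) c Xn \<gamma> w}
             \<in> null_sets (lebesgue_on {0..})))
     \<and>
     (\<forall>p (PX :: 'w measure) X Xn (PB :: real ^ 3 \<Rightarrow> 'b measure) B F.
        liouville_setting round_sphere p (gff_cov round_sphere p)
          (gff_cutoff_cov round_sphere p c) \<gamma> PX X Xn PB B F \<longrightarrow>
        (AE w in PX. \<forall>x\<in>pts round_sphere. AE b in PB x.
           {t \<in> {0..}. liouville_bm (\<lambda>s. F w x s b) (\<lambda>s. B x s b) t
                          \<in> pts round_sphere - thick_points round_sphere c Xn \<gamma> w}
             \<in> null_sets (lebesgue_on {0..})))"
  using thick_points_plane[OF assms(3)] thick_points_torus[OF assms(3)] thick_points_sphere[OF assms(3)]
  by (intro conjI allI impI)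

end
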